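(* Let $0<T<\infty$, $\alpha\in(0,1)$, let $P$ be a probability distribution on the space $\mathcal{D}_T$ of positive, countable, $T$-bounded persistence diagrams, and let $\mathcal{P}_1,\mathcal{P}_2,\ldots$ be independent and identically distributed diagrams with distribution $P$. Let $\mathcal{L}_i(t)=\mathcal{L}_{\mathcal{P}_i}(1,t)$, $t\in\mathbb{R}$, be the corresponding first persistence landscapes, $\mu(t)=\mathbb{E}_P[\mathcal{L}_i(t)]$ the mean landscape, and $\overline{\mathcal{L}}_n(t)=\frac1n\sum_{i=1}^n\mathcal{L}_i(t)$ the empirical mean landscape. Let $q_\alpha$ (depending on $n$ and on $\mathcal{P}_1,\ldots,\mathcal{P}_n$) be the bootstrap quantile $$q_\alpha=\inf\left\{q:\ \mathbb{P}\left(\hat\theta^*\ge q\mid \mathcal{P}_1,\ldots,\mathcal{P}_n\right)\le\alpha\right\},\qquad \hat\theta^*=\sup_{t\in\mathbb{R}}\left|\sqrt{n}\left(\overline{\mathcal{L}}_n^*(t)-\overline{\mathcal{L}}_n(t)\right)\right|,$$ where $\overline{\mathcal{L}}_n^*$ is the average of the first landscapes of a bootstrap sample $\mathcal{P}_1^*,\ldots,\mathcal{P}_n^*$. Define $$C_n(t)=\left[\overline{\mathcal{L}}_n(t)-\frac{q_\alpha}{\sqrt n},\ \overline{\mathcal{L}}_n(t)+\frac{q_\alpha}{\sqrt n}\right],\qquad t\in\mathbb{R}.$$ Then $$\lim_{n\to\infty}\mathbb{P}\left(\mu(t)\in C_n(t)\ \text{for all } t\in\mathbb{R}\right)\ge 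1-\alpha.$$
   Context: Persistence diagrams. A homological feature with birth $b$ and death $d$ (with $d\le b$) is recorded as the point $(x,y)=\left(\frac{b+d}{2},\frac{b-d}{2}\right)$. $\mathcal{D}_T$ is the set of multisets $\mathcal{P}$ of such points with $0\le d\le b\le T$ for every point, with only countably many points (with multiplicity) having $y>0$; points on the line $y=0$ are included with infinite multiplicity. $\mathcal{D}_T$ carries a $\sigma$-algebra for which every map $\mathcal{P}\mapsto\mathcal{L}_{\mathcal{P}}(1,t)$ is measurable (for instance the Borel $\sigma$-algebra of the bottleneck distance). Landscapes. For a point $p=(x,y)$ define the triangle function $t_p:\mathbb{R}\to\mathbb{R}$ by $t_p(z)=z-x+y$ if $z\in[x-y,x]$, $t_p(z)=x+y-z$ if $z\in(x,x+y]$, and $t_p(z)=0$ otherwise. The first persistence landscape of $\mathcal{P}$ is $\mathcal{L}_{\mathcal{P}}(1,z)=\sup_{p\in\mathcal{P}}t_p(z)$. Bootstrap. Let $P_n$ be the empirical measure putting mass $1/n$ at each $\mathcal{P}_i$, $1\le i\le n$. Conditionally on $\mathcal{P}_1,\ldots,\mathcal{P}_n$, the bootstrap sample $\mathcal{P}_1^*,\ldots,\mathcal{P}_n^*$ consists of $n$ independent draws from $P_n$ (i.e. drawn with replacement from the sample), and $\overline{\mathcal{L}}_n^*(t)=\frac1n\sum_{i=1}^n\mathcal{L}_{\mathcal{P}_i^*}(1,t)$. The quantile $q_\alpha$ is the exact conditional quantile, i.e. the Monte Carlo error from simulating finitely many bootstrap samples is ignored. *)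

theory Defs
  imports "HOL-Probability.Probability"
begin

text \<open>A point is a rotated birth-death pair \<open>(x, y) = ((b + d) / 2, (b - d) / 2)\<close>, and a diagram
  is a multiset of points given by its multiplicity function. Off-diagonal multiplicities may
  be \<open>\<infinity>\<close>, which stands for countably infinitely many copies.\<close>

type_synonym point = "real \<times> real"
type_synonym diagram = "point \<Rightarrow> enat"

definition rotate_bd :: "real \<Rightarrow> real \<Rightarrow> point" where
  "rotate_bd b d = ((b + d) / 2, (b - d) / 2)"

definition points :: "diagram \<Rightarrow> point set" where
  "points D = {p. D p > 0}"

definition bounded_points :: "real \<Rightarrow> point set" where
  "bounded_points T = {rotate_bd b d | b d. 0 \<le> d \<and> d \<le> b \<and> b \<le> T}"

definition diagrams :: "real \<Rightarrow> diagram set" where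
  "diagrams T = {D. points D \<subseteq> bounded_points T
     \<and> countable {p \<in> points D. snd p > 0}
     \<and> (\<forall>p \<in> bounded_points T. snd p = 0 \<longrightarrow> D p = \<infinity>)}"

definition triangle :: "point \<Rightarrow> real \<Rightarrow> real" where
  "triangle p z = (case p of (x, y) \<Rightarrow>
     if z \<in> {x - y..x} then z - x + y
     else if z \<in> {x<..x + y} then x + y - z
     else 0)"

text \<open>For \<open>0 \<le> T\<close> and \<open>D \<in> diagrams T\<close> the supremum is over a nonempty set (the diagonal points
  belong to \<open>D\<close>) bounded by \<open>T / 2\<close>.\<close>

definition first_landscape :: "diagram \<Rightarrow> real \<Rightarrow> real" where
  "first_landscape D z = (SUP p \<in> points D. triangle p z)"

definition mean_landscape :: "diagram measure \<Rightarrow> real \<Rightarrow> real" where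
  "mean_landscape P t = (\<integral>D. first_landscape D t \<partial>P)"

definition avg_landscape :: "nat \<Rightarrow> (nat \<Rightarrow> diagram) \<Rightarrow> real \<Rightarrow> real" where
  "avg_landscape n Ds t = (1 / real n) * (\<Sum>i<n. first_landscape (Ds i) t)"

text \<open>The empirical measure of \<open>Ds 0, \<dots>, Ds (n - 1)\<close>: repeated diagrams accumulate their
  masses \<open>1 / n\<close>. It is meaningful for \<open>n > 0\<close> only.\<close>

definition empirical :: "nat \<Rightarrow> (nat \<Rightarrow> diagram) \<Rightarrow> diagram pmf" where
  "empirical n Ds = map_pmf Ds (pmf_of_set {..<n})"

text \<open>The conditional law of the bootstrap sample, given that the data are \<open>Ds\<close>: \<open>n\<close> independent
  draws from the empirical measure. The value \<open>undefined\<close> is assigned to the unused indices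
  \<open>i \<ge> n\<close>.\<close>

definition bootstrap_sample :: "nat \<Rightarrow> (nat \<Rightarrow> diagram) \<Rightarrow> (nat \<Rightarrow> diagram) pmf" where
  "bootstrap_sample n Ds = Pi_pmf {..<n} undefined (\<lambda>_. empirical n Ds)"

definition bootstrap_stat :: "nat \<Rightarrow> (nat \<Rightarrow> diagram) \<Rightarrow> (nat \<Rightarrow> diagram) \<Rightarrow> real" where
  "bootstrap_stat n Ds Ds' =
     (SUP t. \<bar>sqrt (real n) * (avg_landscape n Ds' t - avg_landscape n Ds t)\<bar>)"

definition bootstrap_quantile :: "real \<Rightarrow> nat \<Rightarrow> (nat \<Rightarrow> diagram) \<Rightarrow> real" where
  "bootstrap_quantile \<alpha> n Ds =
     Inf {q. measure_pmf.prob (bootstrap_sample n Ds) {Ds'. bootstrap_stat n Ds Ds' \<ge> q} \<le> \<alpha>}"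

definition confidence_band :: "real \<Rightarrow> nat \<Rightarrow> (nat \<Rightarrow> diagram) \<Rightarrow> real \<Rightarrow> real set" where
  "confidence_band \<alpha> n Ds t =
     {avg_landscape n Ds t - bootstrap_quantile \<alpha> n Ds / sqrt (real n) ..
      avg_landscape n Ds t + bootstrap_quantile \<alpha> n Ds / sqrt (real n)}"

end

theory Submission imports Defs begin

text \<open>
Let \<open>\<theta>\<close> be the supremum over \<open>t\<close> of the absolute value of \<open>S t\<close>, where \<open>S\<close> is \<open>sqrt n\<close> times the
difference of the empirical mean landscape and the mean landscape, and let \<open>F\<close> be the distribution
function of \<open>\<theta>\<close>. The band covers the mean landscape exactly if \<open>\<theta>\<close> is at most the bootstrap quantile.
If the conditional distribution function of the bootstrap statistic is, with probability tending to
one, uniformly close to \<open>F\<close>, and if \<open>F\<close> has asymptotically no jumps, then the bootstrap quantile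
is squeezed between two deterministic quantiles of \<open>F\<close> whose levels are close to \<open>1 - \<alpha>\<close>, and the
coverage tends to \<open>1 - \<alpha>\<close> (lemma \<open>quantile_coverage\<close>). No limiting Gaussian process is
constructed: distribution functions that belong to the same \<open>n\<close> are compared with each other.

\<^item> Landscapes are Lipschitz with constant 1 and vanish outside \<open>[0, T]\<close>. Hence the increments of \<open>S\<close> satisfy
  \<open>E (S s - S t)\<^sup>2 \<le> 4 (s - t)\<^sup>2\<close>, for the data as well as, conditionally on the data, for the
  bootstrap. This is a bound for the mean of the squared \<open>L\<^sup>2\<close> norm of the derivative of \<open>S\<close>, and
  Cauchy-Schwarz turns it into a modulus of continuity that is uniform in \<open>n\<close>: suprema over \<open>t\<close> are maxima
  over a finite grid up to a small error (\<open>modulus_event\<close>).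

\<^item> On a finite grid, Lindeberg's argument compares two normalized sums of independent, identically
  distributed, centred and bounded vectors: smooth functions of the sums have almost the same expectation
  if the covariances almost agree (\<open>lindeberg_comparison\<close>). Together with the modulus of continuity
  this compares the distribution functions of the suprema (\<open>sup_cdf_transfer\<close>). By the weak law of
  large numbers the covariances of the bootstrap are close to those of the data.

\<^item> That \<open>F\<close> has asymptotically no jumps is shown by the same comparison, with sums
  whose suprema have a log-concave distribution function: sums of independent uniform variables times fixed
  paths. Log-concavity is the Prekopa-Leindler inequality, proved here in its midpoint form. A log-concave
  distribution function is equicontinuous wherever it is bounded away from 0, and a covering argument with
  Anderson's inequality gives a lower bound for small balls that depends on \<open>T\<close> and the radius only (\<open>small_ball\<close>).
  The central limit theorem at a single \<open>t\<close> with positive variance controls \<open>F\<close> near 0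
  (\<open>asymptotic_equicontinuity\<close>, \<open>clt_small_ball\<close>).

\<^item> If the variance vanishes for every \<open>t\<close>, then \<open>\<theta>\<close> is 0 almost surely, the bootstrap quantile is
  nonnegative, and the coverage is 1 for every positive \<open>n\<close>.
\<close>

section \<open>Landscapes as Lipschitz paths\<close>

lemma triangle_eq: "0 \<le> y \<Longrightarrow> triangle (x, y) z = max 0 (y - \<bar>z - x\<bar>)"
  by (auto simp: triangle_def)

lemma bounded_points_bounds:
  assumes "p \<in> bounded_points T"
  shows "0 \<le> snd p" "snd p \<le> fst p" "fst p + snd p \<le> T"
  using assms by (auto simp: bounded_points_def rotate_bd_def field_simps)

text \<open>The random functions of the proof are differences and averages of landscapes. Vanishing
outside \<open>[0, T]\<close> makes the Lipschitz constant bound the supremum and reduces all suprema to \<open>[0, T]\<close>.\<close>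

definition lip_path :: "real \<Rightarrow> real \<Rightarrow> (real \<Rightarrow> real) \<Rightarrow> bool" where
  "lip_path T C S \<longleftrightarrow> (\<forall>s t. \<bar>S s - S t\<bar> \<le> C * \<bar>s - t\<bar>) \<and> (\<forall>t. t \<le> 0 \<or> T \<le> t \<longrightarrow> S t = 0)"

lemma lip_pathD:
  assumes "lip_path T C S"
  shows "\<bar>S s - S t\<bar> \<le> C * \<bar>s - t\<bar>" "t \<le> 0 \<Longrightarrow> S t = 0" "T \<le> t \<Longrightarrow> S t = 0"
  using assms by (auto simp: lip_path_def)

lemma lip_path_nonneg: "lip_path T C S \<Longrightarrow> 0 \<le> C"
  using lip_pathD(1)[of T C S 1 0] abs_ge_zero[of "S 1 - S 0"] by (auto simp del: abs_ge_zero)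

lemma lip_path_bound:
  assumes S: "lip_path T C S" and "0 < T"
  shows "\<bar>S t\<bar> \<le> C * T"
proof (cases "0 < t \<and> t < T")
  case True
  have "\<bar>S t\<bar> \<le> C * t" using lip_pathD(1)[OF S, of t 0] lip_pathD(2)[OF S, of 0] True by simp
  also have "\<dots> \<le> C * T" using True lip_path_nonneg[OF S] by (intro mult_left_mono) auto
  finally show ?thesis .
next
  case False
  then have "S t = 0" using lip_pathD(2,3)[OF S, of t] by auto
  then show ?thesis using lip_path_nonneg[OF S] \<open>0 < T\<close> by simp
qed

lemma lip_path_mono: "lip_path T C S \<Longrightarrow> C \<le> C' \<Longrightarrow> lip_path T C' S"
  unfolding lip_path_def by (meson abs_ge_zero mult_right_mono order_trans)

lemma lip_path_diff:
  assumes S: "lip_path T C S" and S': "lip_path T C' S'"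
  shows "lip_path T (C + C') (\<lambda>t. S t - S' t)"
  unfolding lip_path_def
proof (intro conjI allI impI)
  fix s t
  show "\<bar>S s - S' s - (S t - S' t)\<bar> \<le> (C + C') * \<bar>s - t\<bar>"
    using lip_pathD(1)[OF S, of s t] lip_pathD(1)[OF S', of s t] unfolding distrib_right by linarith
qed (use S S' in \<open>auto simp: lip_path_def\<close>)

lemma lip_path_cmult:
  assumes S: "lip_path T C S"
  shows "lip_path T (\<bar>c\<bar> * C) (\<lambda>t. c * S t)"
  unfolding lip_path_def
proof (intro conjI allI impI)
  fix s t
  have "\<bar>c * S s - c * S t\<bar> = \<bar>c\<bar> * \<bar>S s - S t\<bar>" by (simp add: abs_mult[symmetric] right_diff_distrib)
  also have "\<dots> \<le> \<bar>c\<bar> * (C * \<bar>s - t\<bar>)" using lip_pathD(1)[OF S, of s t] by (intro mult_left_mono) auto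
  finally show "\<bar>c * S s - c * S t\<bar> \<le> \<bar>c\<bar> * C * \<bar>s - t\<bar>" by simp
qed (use S in \<open>auto simp: lip_path_def\<close>)

lemma lip_path_sum:
  assumes "\<And>i. i \<in> I \<Longrightarrow> lip_path T (C i) (S i)"
  shows "lip_path T (\<Sum>i\<in>I. C i) (\<lambda>t. \<Sum>i\<in>I. S i t)"
  unfolding lip_path_def
proof (intro conjI allI impI)
  fix s t
  have "\<bar>(\<Sum>i\<in>I. S i s) - (\<Sum>i\<in>I. S i t)\<bar> \<le> (\<Sum>i\<in>I. \<bar>S i s - S i t\<bar>)"
    by (simp add: sum_subtractf[symmetric] sum_abs)
  also have "\<dots> \<le> (\<Sum>i\<in>I. C i * \<bar>s - t\<bar>)" using assms by (intro sum_mono) (auto simp: lip_path_def)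
  finally show "\<bar>(\<Sum>i\<in>I. S i s) - (\<Sum>i\<in>I. S i t)\<bar> \<le> (\<Sum>i\<in>I. C i) * \<bar>s - t\<bar>" by (simp add: sum_distrib_right)
qed (use assms in \<open>auto simp: lip_path_def\<close>)

lemma lip_path_sup_le_iff:
  assumes S: "lip_path T C S" and "0 < T"
  shows "(SUP t. \<bar>S t\<bar>) \<le> r \<longleftrightarrow> (\<forall>t. \<bar>S t\<bar> \<le> r)"
proof -
  have "bdd_above (range (\<lambda>t. \<bar>S t\<bar>))" using lip_path_bound[OF assms] by (intro bdd_aboveI2)
  then show ?thesis by (subst cSUP_le_iff) auto
qed

text \<open>By continuity rational arguments suffice, which makes events on all \<open>t\<close> measurable.\<close>

lemma lip_path_all_rat:
  assumes S: "lip_path T C S"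
  shows "(\<forall>t. \<bar>S t\<bar> \<le> r) \<longleftrightarrow> (\<forall>t\<in>\<rat>. \<bar>S t\<bar> \<le> r)"
proof (intro iffI allI)
  fix t assume r: "\<forall>t\<in>\<rat>. \<bar>S t\<bar> \<le> r"
  show "\<bar>S t\<bar> \<le> r"
  proof (rule field_le_epsilon)
    fix e :: real assume "e > 0"
    define d where "d = e / (C + 1)"
    have C: "0 \<le> C" by (rule lip_path_nonneg[OF S])
    have d: "d > 0" using \<open>e > 0\<close> C by (simp add: d_def)
    obtain q where q: "q \<in> \<rat>" "t < q" "q < t + d" using Rats_dense_in_real[of t "t + d"] d by auto
    have "\<bar>S t - S q\<bar> \<le> C * \<bar>t - q\<bar>" by (rule lip_pathD(1)[OF S])
    also have "\<dots> \<le> C * d" using q C by (intro mult_left_mono) auto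
    also have "\<dots> \<le> e" using C \<open>e > 0\<close> by (simp add: d_def field_simps)
    finally show "\<bar>S t\<bar> \<le> r + e" using r q(1) by fastforce
  qed
qed auto

text \<open>Each triangle function is \<open>max 0 (y - \<bar>z - x\<bar>)\<close>, and a supremum of functions with Lipschitz
constant 1 inherits the constant. The triangles of points with \<open>0 \<le> d \<le> b \<le> T\<close> live on \<open>[0, T]\<close>.\<close>

lemma first_landscape_lip_path:
  assumes D: "D \<in> diagrams T" and T: "0 < T"
  shows "lip_path T 1 (first_landscape D)"
proof -
  have "(0, 0) \<in> bounded_points T"
    using T by (auto simp: bounded_points_def rotate_bd_def intro!: exI[of _ 0])
  then have "D (0, 0) = \<infinity>" using D by (auto simp: diagrams_def)
  then have "(0, 0) \<in> points D" by (simp add: points_def)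
  then have ne: "points D \<noteq> {}" by blast
  have tri: "triangle p z = max 0 (snd p - \<bar>z - fst p\<bar>)" and pb: "0 \<le> snd p" "snd p \<le> fst p" "fst p + snd p \<le> T"
    if "p \<in> points D" for p z
  proof -
    have "p \<in> bounded_points T" using D that by (auto simp: diagrams_def)
    note b = bounded_points_bounds[OF this]
    show "triangle p z = max 0 (snd p - \<bar>z - fst p\<bar>)"
      using triangle_eq[of "snd p" "fst p" z] b(1) by simp
    show "0 \<le> snd p" "snd p \<le> fst p" "fst p + snd p \<le> T" by (fact b)+
  qed
  have bdd: "bdd_above ((\<lambda>p. triangle p z) ` points D)" for z
  proof (rule bdd_aboveI2)
    fix p assume "p \<in> points D"
    then show "triangle p z \<le> T" using pb[of p] T abs_ge_zero[of "z - fst p"] unfolding tri[OF \<open>p \<in> points D\<close>] by linarith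
  qed
  have lip: "first_landscape D s \<le> first_landscape D t + \<bar>s - t\<bar>" for s t
    unfolding first_landscape_def
  proof (rule cSUP_least[OF ne])
    fix p assume p: "p \<in> points D"
    have "triangle p s \<le> triangle p t + \<bar>s - t\<bar>"
      unfolding tri[OF p] by (simp add: max_def abs_if)
    also have "triangle p t \<le> (SUP p\<in>points D. triangle p t)"
      by (rule cSUP_upper[OF p bdd])
    finally show "triangle p s \<le> (SUP p\<in>points D. triangle p t) + \<bar>s - t\<bar>" by simp
  qed
  show ?thesis
    unfolding lip_path_def
  proof (intro conjI allI impI)
    show "\<bar>first_landscape D s - first_landscape D t\<bar> \<le> 1 * \<bar>s - t\<bar>" for s t
      using lip[of s t] lip[of t s] by (simp add: abs_minus_commute abs_le_iff)
    fix t assume t: "t \<le> 0 \<or> T \<le> t"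
    have "triangle p t = 0" if p: "p \<in> points D" for p
      using pb[OF p] t unfolding tri[OF p] by (auto simp: max_def abs_if)
    then show "first_landscape D t = 0"
      using ne by (simp add: first_landscape_def)
  qed
qed

definition grid :: "real \<Rightarrow> nat \<Rightarrow> nat \<Rightarrow> real" where
  "grid T k j = T * real j / real k"

text \<open>A cell of the coarse grid consists of \<open>p\<close> cells of the fine grid, so by Cauchy-Schwarz the square of an
increment within a coarse cell is at most \<open>p\<close> times the sum of all squared fine increments. The Lipschitz
bound is used only between neighbours of the fine grid and may therefore be as poor as \<open>sqrt n\<close>.\<close>

lemma lip_path_modulus:
  assumes S: "lip_path T C S" and T: "0 < T" and k: "0 < k" and p: "0 < p"
    and fine: "C * T / real (k * p) \<le> \<eta>"
    and Q: "real p * (\<Sum>i<k * p. (S (grid T (k * p) (Suc i)) - S (grid T (k * p) i))\<^sup>2) \<le> \<eta>\<^sup>2"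
    and j: "j < k" and t: "grid T k j \<le> t" "t \<le> grid T k (Suc j)"
  shows "\<bar>S t - S (grid T k j)\<bar> \<le> 2 * \<eta>"
proof -
  define h where "h = T / real (k * p)"
  have h: "h > 0" using T k p by (simp add: h_def)
  have gr: "grid T (k * p) i = real i * h" for i by (simp add: grid_def h_def)
  have grk: "grid T k i = real (i * p) * h" for i using p by (simp add: grid_def h_def)
  have \<eta>: "0 \<le> \<eta>"
    using lip_path_nonneg[OF S] T fine by (meson divide_nonneg_nonneg less_imp_le mult_nonneg_nonneg of_nat_0_le_iff order_trans)
  define a where "a = nat \<lfloor>(t - grid T k j) / h\<rfloor>"
  have ra: "real a = of_int \<lfloor>(t - grid T k j) / h\<rfloor>" using t h by (simp add: a_def)
  have a1: "real a * h \<le> t - grid T k j" "t - grid T k j \<le> (real a + 1) * h"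
    using of_int_floor_le[of "(t - grid T k j) / h"] real_of_int_floor_add_one_gt[of "(t - grid T k j) / h"] h
    unfolding ra[symmetric] by (simp_all add: le_divide_eq divide_less_eq)
  have "real a * h \<le> real p * h"
    using a1(1) t(2) unfolding grk by (simp add: algebra_simps)
  then have ap: "a \<le> p" using h by simp
  define s where "s = grid T k j + real a * h"
  have "\<bar>S t - S s\<bar> \<le> C * \<bar>t - s\<bar>" by (rule lip_pathD(1)[OF S])
  also have "\<dots> \<le> C * h"
    using a1 lip_path_nonneg[OF S] by (intro mult_left_mono) (auto simp: s_def algebra_simps)
  also have "\<dots> \<le> \<eta>" using fine by (simp add: h_def)
  finally have 1: "\<bar>S t - S s\<bar> \<le> \<eta>" .
  let ?\<Delta> = "\<lambda>i. S (grid T (k * p) (Suc i)) - S (grid T (k * p) i)"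
  have "S s - S (grid T k j) = S (grid T (k * p) (j * p + a)) - S (grid T (k * p) (j * p))"
    by (simp add: s_def gr grk algebra_simps)
  also have "\<dots> = (\<Sum>i = j * p..<j * p + a. ?\<Delta> i)"
    by (subst sum_Suc_diff') auto
  finally have "(S s - S (grid T k j))\<^sup>2 = (\<Sum>i = j * p..<j * p + a. ?\<Delta> i)\<^sup>2" by simp
  also have "\<dots> \<le> real (card {j * p..<j * p + a}) * (\<Sum>i = j * p..<j * p + a. (?\<Delta> i)\<^sup>2)"
    using sum_squared_le_sum_of_squares[of ?\<Delta> "{j * p..<j * p + a}"] by (simp add: mult.commute)
  also have "\<dots> \<le> real p * (\<Sum>i<k * p. (?\<Delta> i)\<^sup>2)"
  proof (intro mult_mono sum_mono2)
    have "Suc j * p \<le> k * p" using j by (intro mult_right_mono) auto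
    then show "{j * p..<j * p + a} \<subseteq> {..<k * p}" using ap by auto
  qed (use ap in \<open>auto intro: sum_nonneg\<close>)
  also have "\<dots> \<le> \<eta>\<^sup>2" by (rule Q)
  finally have "\<bar>S s - S (grid T k j)\<bar> \<le> \<eta>" using \<eta> by (simp add: abs_le_square_iff[symmetric])
  with 1 show ?thesis by linarith
qed

lemma grid_cell:
  assumes "0 < T" "0 < k" "0 \<le> t" "t < T"
  obtains j where "j < k" "grid T k j \<le> t" "t \<le> grid T k (Suc j)"
proof
  define j where "j = nat \<lfloor>t * real k / T\<rfloor>"
  have rj: "real j = of_int \<lfloor>t * real k / T\<rfloor>" using assms by (simp add: j_def)
  have j: "real j \<le> t * real k / T" "t * real k / T < real j + 1"
    using floor_correct[of "t * real k / T"] unfolding rj by auto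
  have "t * real k / T < real k" using assms by (simp add: field_simps)
  then show "j < k" using j by linarith
  show "grid T k j \<le> t" "t \<le> grid T k (Suc j)"
    using j assms by (auto simp: grid_def field_simps)
qed

section \<open>Smooth approximations of boxes\<close>

definition cube_pos :: "real \<Rightarrow> real" where
  "cube_pos u = (max 0 u) ^ 3"

lemma cube_pos_taylor: "\<bar>cube_pos (u + v) - (cube_pos u + 3 * (max 0 u)\<^sup>2 * v + 3 * max 0 u * v\<^sup>2)\<bar> \<le> \<bar>v\<bar> ^ 3"
proof -
  consider "0 \<le> u" "0 \<le> u + v" | "0 \<le> u" "u + v < 0" | "u < 0" "0 \<le> u + v" | "u < 0" "u + v < 0" by linarith
  then show ?thesis
  proof cases
    case 1
    have "(u + v) ^ 3 - (u ^ 3 + 3 * u\<^sup>2 * v + 3 * u * v\<^sup>2) = v ^ 3" by algebra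
    then show ?thesis using 1 by (simp add: cube_pos_def max_absorb2 power_abs)
  next
    case 2
    have e: "- (u ^ 3 + 3 * u\<^sup>2 * v + 3 * u * v\<^sup>2) = v ^ 3 - (u + v) ^ 3" by algebra
    have "(- (u + v)) ^ 3 \<le> (- v) ^ 3" using 2 by (intro power_mono) auto
    moreover have "(- (u + v)) ^ 3 \<ge> 0" using 2 by (intro zero_le_power) auto
    moreover have "(- (u + v)) ^ 3 = - ((u + v) ^ 3)" "(- v) ^ 3 = - (v ^ 3)" by algebra+
    moreover have "\<bar>v\<bar> ^ 3 = (- v) ^ 3" using 2 by simp
    ultimately have "\<bar>v ^ 3 - (u + v) ^ 3\<bar> \<le> \<bar>v\<bar> ^ 3" by linarith
    then show ?thesis using 2 e by (simp add: cube_pos_def max_def)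
  next
    case 3
    have "(u + v) ^ 3 \<le> v ^ 3" using 3 by (intro power_mono) auto
    then show ?thesis using 3 by (simp add: cube_pos_def max_def)
  next
    case 4
    then show ?thesis by (simp add: cube_pos_def max_def)
  qed
qed

text \<open>The third difference of the cubic spline \<open>cube_pos\<close>, divided by 6, is a monotone step from 0 to 1 on
\<open>[0, 3]\<close> with Lipschitz continuous second derivative. This is the least smoothness for which
the second order Taylor expansion has a cubic remainder.\<close>

definition spline_step :: "real \<Rightarrow> real" where
  "spline_step u = (cube_pos u - 3 * cube_pos (u - 1) + 3 * cube_pos (u - 2) - cube_pos (u - 3)) / 6"

lemma spline_step_0: "u \<le> 0 \<Longrightarrow> spline_step u = 0"
  by (simp add: spline_step_def cube_pos_def max_def)

lemma spline_step_1: "3 \<le> u \<Longrightarrow> spline_step u = 1"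
proof -
  have "u ^ 3 - 3 * (u - 1) ^ 3 + 3 * (u - 2) ^ 3 - (u - 3) ^ 3 = 6"
    by (simp add: power3_eq_cube algebra_simps)
  then show "3 \<le> u \<Longrightarrow> spline_step u = 1" by (simp add: spline_step_def cube_pos_def max_def)
qed

text \<open>On each of the three pieces the polynomial is rewritten as a sum of nonnegative terms.\<close>

lemma spline_step_range: "0 \<le> spline_step u" "spline_step u \<le> 1"
proof -
  consider "u \<le> 0" | "0 \<le> u" "u \<le> 1" | "1 \<le> u" "u \<le> 2" | "2 \<le> u" "u \<le> 3" | "3 \<le> u" by linarith
  then have "0 \<le> spline_step u \<and> spline_step u \<le> 1"
  proof cases
    case 2
    have "u ^ 3 \<le> 1 ^ 3" using 2 by (intro power_mono) auto
    then show ?thesis using 2 by (simp add: spline_step_def cube_pos_def max_def)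
  next
    case 3
    have eq: "spline_step u = (u ^ 3 - 3 * (u - 1) ^ 3) / 6"
      using 3 by (simp add: spline_step_def cube_pos_def max_def)
    have "u ^ 3 - 3 * (u - 1) ^ 3 = 1 + 3 * (u - 1) + 3 * (u - 1)\<^sup>2 * (1 - (u - 1)) + (u - 1) ^ 3" by algebra
    also have "\<dots> \<ge> 0" using 3 by (intro add_nonneg_nonneg mult_nonneg_nonneg) auto
    finally have lo: "0 \<le> u ^ 3 - 3 * (u - 1) ^ 3" .
    have "6 - (u ^ 3 - 3 * (u - 1) ^ 3) = 1 + 3 * (2 - u) + 3 * (2 - u)\<^sup>2 * (1 - (2 - u)) + (2 - u) ^ 3" by algebra
    also have "\<dots> \<ge> 0" using 3 by (intro add_nonneg_nonneg mult_nonneg_nonneg) auto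
    finally have hi: "u ^ 3 - 3 * (u - 1) ^ 3 \<le> 6" by simp
    show ?thesis using lo hi eq by simp
  next
    case 4
    have "spline_step u = (u ^ 3 - 3 * (u - 1) ^ 3 + 3 * (u - 2) ^ 3) / 6"
      using 4 by (simp add: spline_step_def cube_pos_def max_def)
    also have "u ^ 3 - 3 * (u - 1) ^ 3 + 3 * (u - 2) ^ 3 = 6 - (3 - u) ^ 3" by algebra
    finally have e: "spline_step u = 1 - (3 - u) ^ 3 / 6" by (simp add: diff_divide_distrib)
    have "(3 - u) ^ 3 \<le> 1 ^ 3" "0 \<le> (3 - u) ^ 3" using 4 by (intro power_mono zero_le_power; auto)+
    then show ?thesis unfolding e by simp
  qed (auto simp: spline_step_0 spline_step_1)
  then show "0 \<le> spline_step u" "spline_step u \<le> 1" by auto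
qed

lemma spline_step_taylor:
  obtains a b where "\<bar>a\<bar> \<le> 12" "\<bar>b\<bar> \<le> 12"
    "\<And>v. \<bar>spline_step (u + v) - (spline_step u + a * v + b * v\<^sup>2)\<bar> \<le> 12 * \<bar>v\<bar> ^ 3"
proof -
  define m where "m i = max 0 (u - i)" for i :: real
  define a where "a = ((m 0)\<^sup>2 - 3 * (m 1)\<^sup>2 + 3 * (m 2)\<^sup>2 - (m 3)\<^sup>2) / 2"
  define b where "b = (m 0 - 3 * m 1 + 3 * m 2 - m 3) / 2"
  have "\<bar>a\<bar> \<le> 12 \<and> \<bar>b\<bar> \<le> 12"
  proof (cases "u \<le> 0 \<or> 3 \<le> u")
    case True
    then have "a = 0 \<and> b = 0"
    proof
      assume "3 \<le> u"
      moreover have "u\<^sup>2 - 3 * (u - 1)\<^sup>2 + 3 * (u - 2)\<^sup>2 - (u - 3)\<^sup>2 = 0" by algebra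
      ultimately show ?thesis by (simp add: a_def b_def m_def max_absorb2)
    qed (auto simp: a_def b_def m_def max_absorb1)
    then show ?thesis by simp
  next
    case False
    then have m: "0 \<le> m 0" "m 0 \<le> 3" "0 \<le> m 1" "m 1 \<le> 2" "0 \<le> m 2" "m 2 \<le> 1" and "m 3 = 0"
      by (auto simp: m_def)
    then have "(m 0)\<^sup>2 \<le> 3\<^sup>2" "(m 1)\<^sup>2 \<le> 2\<^sup>2" "(m 2)\<^sup>2 \<le> 1\<^sup>2" by (intro power_mono; simp)+
    then have "(m 0)\<^sup>2 \<le> 9" "(m 1)\<^sup>2 \<le> 4" "(m 2)\<^sup>2 \<le> 1" by simp_all
    moreover have "(m 3)\<^sup>2 = 0" using \<open>m 3 = 0\<close> by simp
    moreover have "0 \<le> (m 0)\<^sup>2" "0 \<le> (m 1)\<^sup>2" "0 \<le> (m 2)\<^sup>2" by auto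
    moreover have "\<bar>(a0 - 3 * a1 + 3 * a2 - a3) / 2\<bar> \<le> 12"
      if "0 \<le> a0" "a0 \<le> 9" "0 \<le> a1" "a1 \<le> 4" "0 \<le> a2" "a2 \<le> 1" "a3 = 0" for a0 a1 a2 a3 :: real
      using that by (simp add: abs_le_iff)
    ultimately show ?thesis unfolding a_def b_def using m \<open>m 3 = 0\<close> by simp
  qed
  moreover have "\<bar>spline_step (u + v) - (spline_step u + a * v + b * v\<^sup>2)\<bar> \<le> 12 * \<bar>v\<bar> ^ 3" for v
  proof -
    define R where "R i = cube_pos (u - i + v) - (cube_pos (u - i) + 3 * (m i)\<^sup>2 * v + 3 * m i * v\<^sup>2)" for i :: real
    have R: "\<bar>R i\<bar> \<le> \<bar>v\<bar> ^ 3" for i unfolding R_def m_def by (rule cube_pos_taylor)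
    have "spline_step (u + v) - (spline_step u + a * v + b * v\<^sup>2) = (R 0 - 3 * R 1 + 3 * R 2 - R 3) / 6"
      unfolding spline_step_def R_def a_def b_def by (simp add: field_simps)
    moreover have "\<bar>(a - 3 * b + 3 * c - d) / 6\<bar> \<le> 12 * w"
      if "\<bar>a\<bar> \<le> w" "\<bar>b\<bar> \<le> w" "\<bar>c\<bar> \<le> w" "\<bar>d\<bar> \<le> w" for a b c d w :: real
    proof -
      have "\<bar>a - 3 * b + 3 * c - d\<bar> \<le> 8 * w" using that by linarith
      then show ?thesis using that by simp
    qed
    ultimately show ?thesis using R by metis
  qed
  ultimately show ?thesis using that[of a b] by auto
qed

lemma continuous_spline_step: "continuous_on A spline_step"
  unfolding spline_step_def cube_pos_def by (intro continuous_intros) auto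

text \<open>A second order expansion at \<open>x\<close> whose coefficients and cubic remainder are controlled by one constant.
Only displacements of size at most 1 are considered, because products of expansions produce
terms of higher degree that have to be absorbed into the cubic remainder.\<close>

definition taylor2 :: "nat set \<Rightarrow> real \<Rightarrow> ((nat \<Rightarrow> real) \<Rightarrow> real) \<Rightarrow> (nat \<Rightarrow> real) \<Rightarrow> (nat \<Rightarrow> real) \<Rightarrow> (nat \<Rightarrow> nat \<Rightarrow> real) \<Rightarrow> bool" where
  "taylor2 J K f x a b \<longleftrightarrow> (\<forall>i\<in>J. \<bar>a i\<bar> \<le> K) \<and> (\<forall>i\<in>J. \<forall>j\<in>J. \<bar>b i j\<bar> \<le> K) \<and>
     (\<forall>u d. 0 \<le> d \<and> d \<le> 1 \<and> (\<forall>i\<in>J. \<bar>u i\<bar> \<le> d) \<longrightarrow>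
       \<bar>f (\<lambda>i. x i + u i) - (f x + (\<Sum>i\<in>J. a i * u i) + (\<Sum>i\<in>J. \<Sum>j\<in>J. b i j * (u i * u j)))\<bar> \<le> K * d ^ 3)"

text \<open>The coefficients of the expansions may depend on the point in an arbitrary way: the comparison of sums
below evaluates them at a fixed point only, so no measurability is required of them.\<close>

definition smooth3 :: "nat set \<Rightarrow> real \<Rightarrow> ((nat \<Rightarrow> real) \<Rightarrow> real) \<Rightarrow> bool" where
  "smooth3 J K f \<longleftrightarrow> (\<forall>x. \<bar>f x\<bar> \<le> K \<and> (\<exists>a b. taylor2 J K f x a b))"

lemma smooth3D:
  assumes "smooth3 J K f"
  shows "\<bar>f x\<bar> \<le> K" "\<exists>a b. taylor2 J K f x a b"
  using assms unfolding smooth3_def by blast+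

lemma smooth3_coordinate:
  assumes j: "j \<in> J" and fin: "finite J" and \<sigma>: "\<bar>\<sigma>\<bar> = 1" and \<eta>: "0 < \<eta>" "\<eta> \<le> 1"
  shows "smooth3 J (12 / \<eta> ^ 3) (\<lambda>x. spline_step ((c + \<sigma> * x j) / \<eta>))"
  unfolding smooth3_def
proof (intro allI conjI)
  have e: "\<eta> ^ 3 \<le> \<eta>\<^sup>2" "\<eta> ^ 3 \<le> \<eta>" "\<eta> ^ 3 \<le> 1" "0 < \<eta> ^ 3"
    using \<eta> power_decreasing[of 2 3 \<eta>] power_decreasing[of 1 3 \<eta>] power_decreasing[of 0 3 \<eta>] by auto
  fix x :: "nat \<Rightarrow> real"
  have "1 \<le> 12 / \<eta> ^ 3" using e by (simp add: field_simps)
  then show "\<bar>spline_step ((c + \<sigma> * x j) / \<eta>)\<bar> \<le> 12 / \<eta> ^ 3"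
    using spline_step_range[of "(c + \<sigma> * x j) / \<eta>"] by (simp add: abs_if)
  obtain a b where ab: "\<bar>a\<bar> \<le> 12" "\<bar>b\<bar> \<le> 12"
    "\<And>v. \<bar>spline_step ((c + \<sigma> * x j) / \<eta> + v) - (spline_step ((c + \<sigma> * x j) / \<eta>) + a * v + b * v\<^sup>2)\<bar> \<le> 12 * \<bar>v\<bar> ^ 3"
    using spline_step_taylor[of "(c + \<sigma> * x j) / \<eta>"] by metis
  define a' where "a' i = (if i = j then a * \<sigma> / \<eta> else 0)" for i
  define b' where "b' i l = (if i = j then if l = j then b / \<eta>\<^sup>2 else 0 else 0)" for i l
  have \<sigma>2: "\<sigma> * \<sigma> = 1" using \<sigma> by (metis abs_mult abs_mult_self_eq mult_1)
  have "\<bar>a\<bar> / \<eta> \<le> 12 / \<eta> ^ 3" using ab e \<eta> by (intro frac_le) auto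
  then have a1: "\<forall>i\<in>J. \<bar>a' i\<bar> \<le> 12 / \<eta> ^ 3" using \<sigma> \<eta> by (auto simp: a'_def abs_mult)
  have "\<bar>b\<bar> / \<eta>\<^sup>2 \<le> 12 / \<eta> ^ 3" using ab e \<eta> by (intro frac_le) auto
  then have b1: "\<forall>i\<in>J. \<forall>l\<in>J. \<bar>b' i l\<bar> \<le> 12 / \<eta> ^ 3" using \<eta> by (auto simp: b'_def)
  have "\<bar>spline_step ((c + \<sigma> * (x j + u j)) / \<eta>) - (spline_step ((c + \<sigma> * x j) / \<eta>) + (\<Sum>i\<in>J. a' i * u i)
      + (\<Sum>i\<in>J. \<Sum>l\<in>J. b' i l * (u i * u l)))\<bar> \<le> 12 / \<eta> ^ 3 * d ^ 3"
    if d: "0 \<le> d" "d \<le> 1" "\<forall>i\<in>J. \<bar>u i\<bar> \<le> d" for u d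
  proof -
    have s1: "(\<Sum>i\<in>J. a' i * u i) = a * (\<sigma> * u j / \<eta>)"
      using j fin by (simp add: a'_def if_distrib[of "\<lambda>z. z * _"] sum.delta cong: if_cong)
    have "(\<Sum>l\<in>J. b' i l * (u i * u l)) = (if i = j then b / \<eta>\<^sup>2 * (u j * u j) else 0)" for i
      using j fin by (simp add: b'_def if_distrib[of "\<lambda>z. z * _"] sum.delta cong: if_cong)
    then have "(\<Sum>i\<in>J. \<Sum>l\<in>J. b' i l * (u i * u l)) = b / \<eta>\<^sup>2 * (u j * u j)"
      using j fin by simp
    also have "\<dots> = b * (\<sigma> * u j / \<eta>)\<^sup>2"
      using \<sigma>2 by (simp add: power2_eq_square field_simps)
    finally have s2: "(\<Sum>i\<in>J. \<Sum>l\<in>J. b' i l * (u i * u l)) = b * (\<sigma> * u j / \<eta>)\<^sup>2" .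
    have "\<bar>spline_step ((c + \<sigma> * x j) / \<eta> + \<sigma> * u j / \<eta>) - (spline_step ((c + \<sigma> * x j) / \<eta>) + a * (\<sigma> * u j / \<eta>) + b * (\<sigma> * u j / \<eta>)\<^sup>2)\<bar>
        \<le> 12 * \<bar>\<sigma> * u j / \<eta>\<bar> ^ 3" by (rule ab(3))
    also have "\<bar>\<sigma> * u j / \<eta>\<bar> ^ 3 = \<bar>u j\<bar> ^ 3 / \<eta> ^ 3"
      using \<sigma> \<eta> by (simp add: abs_mult power_divide)
    also have "12 * (\<bar>u j\<bar> ^ 3 / \<eta> ^ 3) \<le> 12 * (d ^ 3 / \<eta> ^ 3)"
      using d j e by (intro mult_left_mono divide_right_mono power_mono) auto
    finally show ?thesis unfolding s1 s2 by (simp add: distrib_left add_divide_distrib add.assoc)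
  qed
  then show "\<exists>a b. taylor2 J (12 / \<eta> ^ 3) (\<lambda>x. spline_step ((c + \<sigma> * x j) / \<eta>)) x a b"
    unfolding taylor2_def using a1 b1 by blast
qed

text \<open>Multiply the two expansions and collect the terms of degree at least 3; there are seven of them, each at
most \<open>(1 + card J)\<^sup>4 K L d\<^sup>3\<close>.\<close>

lemma smooth3_mult:
  assumes fin: "finite J" and f: "smooth3 J K f" and g: "smooth3 J L g"
  shows "smooth3 J (7 * (1 + real (card J)) ^ 4 * (K * L)) (\<lambda>x. f x * g x)"
  unfolding smooth3_def
proof (intro allI conjI)
  define c where "c = real (card J)"
  have c: "0 \<le> c" by (simp add: c_def)
  have KL: "0 \<le> K" "0 \<le> L" using smooth3D(1)[OF f, of undefined] smooth3D(1)[OF g, of undefined] by linarith+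
  have pw: "c ^ i \<le> (1 + c) ^ 4" if "i \<le> 4" for i
    using power_mono[of c "1 + c" i] power_increasing[of i 4 "1 + c"] c that by simp
  define M where "M = 7 * (1 + c) ^ 4 * (K * L)"
  have M: "3 * (K * L) \<le> M"
  proof -
    have "1 \<le> (1 + c) ^ 4" using c by simp
    then have "3 \<le> 7 * (1 + c) ^ 4" by simp
    then show ?thesis unfolding M_def using KL by (intro mult_right_mono) auto
  qed
  have KL0: "0 \<le> K * L" using KL by simp
  fix x
  have fx: "\<bar>f x\<bar> \<le> K" and gx: "\<bar>g x\<bar> \<le> L" using smooth3D(1)[OF f] smooth3D(1)[OF g] by auto
  have "\<bar>f x\<bar> * \<bar>g x\<bar> \<le> K * L" using fx gx KL by (intro mult_mono) auto
  then have v: "\<bar>f x * g x\<bar> \<le> M" using M KL0 by (simp add: abs_mult)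
  then show "\<bar>f x * g x\<bar> \<le> 7 * (1 + real (card J)) ^ 4 * (K * L)" by (simp add: M_def c_def)
  obtain a b where ab: "\<forall>i\<in>J. \<bar>a i\<bar> \<le> K" "\<forall>i\<in>J. \<forall>j\<in>J. \<bar>b i j\<bar> \<le> K"
    "\<And>u d. 0 \<le> d \<Longrightarrow> d \<le> 1 \<Longrightarrow> (\<forall>i\<in>J. \<bar>u i\<bar> \<le> d) \<Longrightarrow>
       \<bar>f (\<lambda>i. x i + u i) - (f x + (\<Sum>i\<in>J. a i * u i) + (\<Sum>i\<in>J. \<Sum>j\<in>J. b i j * (u i * u j)))\<bar> \<le> K * d ^ 3"
    using smooth3D(2)[OF f, of x] unfolding taylor2_def by blast
  obtain a' b' where ab': "\<forall>i\<in>J. \<bar>a' i\<bar> \<le> L" "\<forall>i\<in>J. \<forall>j\<in>J. \<bar>b' i j\<bar> \<le> L"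
    "\<And>u d. 0 \<le> d \<Longrightarrow> d \<le> 1 \<Longrightarrow> (\<forall>i\<in>J. \<bar>u i\<bar> \<le> d) \<Longrightarrow>
       \<bar>g (\<lambda>i. x i + u i) - (g x + (\<Sum>i\<in>J. a' i * u i) + (\<Sum>i\<in>J. \<Sum>j\<in>J. b' i j * (u i * u j)))\<bar> \<le> L * d ^ 3"
    using smooth3D(2)[OF g, of x] unfolding taylor2_def by blast
  define A where "A i = f x * a' i + g x * a i" for i
  define B where "B i j = f x * b' i j + a i * a' j + g x * b i j" for i j
  have pr: "\<bar>p * q\<bar> \<le> K * L" if "\<bar>p\<bar> \<le> K" "\<bar>q\<bar> \<le> L" for p q
    using that KL by (simp add: abs_mult mult_mono)
  have A: "\<forall>i\<in>J. \<bar>A i\<bar> \<le> M"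
  proof
    fix i assume "i \<in> J"
    then have "\<bar>f x * a' i\<bar> \<le> K * L" "\<bar>a i * g x\<bar> \<le> K * L" using ab ab' fx gx by (auto intro!: pr)
    then show "\<bar>A i\<bar> \<le> M" using M KL0 unfolding A_def by (simp add: mult.commute)
  qed
  have B: "\<forall>i\<in>J. \<forall>j\<in>J. \<bar>B i j\<bar> \<le> M"
  proof (intro ballI)
    fix i j assume "i \<in> J" "j \<in> J"
    then have "\<bar>f x * b' i j\<bar> \<le> K * L" "\<bar>a i * a' j\<bar> \<le> K * L" "\<bar>b i j * g x\<bar> \<le> K * L"
      using ab ab' fx gx by (auto intro!: pr)
    then show "\<bar>B i j\<bar> \<le> M" using M KL0 unfolding B_def by (simp add: mult.commute)
  qed
  have R: "\<bar>f (\<lambda>i. x i + u i) * g (\<lambda>i. x i + u i) - (f x * g x + (\<Sum>i\<in>J. A i * u i) + (\<Sum>i\<in>J. \<Sum>j\<in>J. B i j * (u i * u j)))\<bar> \<le> M * d ^ 3"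
    if d: "0 \<le> d" "d \<le> 1" "\<forall>i\<in>J. \<bar>u i\<bar> \<le> d" for u d
  proof -
    have lin: "\<bar>\<Sum>i\<in>J. p i * u i\<bar> \<le> C * c * d" if "\<forall>i\<in>J. \<bar>p i\<bar> \<le> C" "0 \<le> C" for p C
    proof -
      have "\<bar>\<Sum>i\<in>J. p i * u i\<bar> \<le> (\<Sum>i\<in>J. C * d)"
        using that d by (intro order_trans[OF sum_abs] sum_mono) (auto simp: abs_mult intro!: mult_mono)
      then show ?thesis by (simp add: c_def mult_ac)
    qed
    have qua: "\<bar>\<Sum>i\<in>J. \<Sum>j\<in>J. p i j * (u i * u j)\<bar> \<le> C * c\<^sup>2 * d\<^sup>2" if "\<forall>i\<in>J. \<forall>j\<in>J. \<bar>p i j\<bar> \<le> C" "0 \<le> C" for p C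
    proof -
      have "\<bar>\<Sum>i\<in>J. \<Sum>j\<in>J. p i j * (u i * u j)\<bar> \<le> (\<Sum>i\<in>J. \<Sum>j\<in>J. C * (d * d))"
        using that d by (intro order_trans[OF sum_abs] sum_mono) (auto simp: abs_mult intro!: mult_mono)
      then show ?thesis by (simp add: c_def mult_ac power2_eq_square)
    qed
    define l where "l = (\<Sum>i\<in>J. a i * u i)"
    define l' where "l' = (\<Sum>i\<in>J. a' i * u i)"
    define q where "q = (\<Sum>i\<in>J. \<Sum>j\<in>J. b i j * (u i * u j))"
    define q' where "q' = (\<Sum>i\<in>J. \<Sum>j\<in>J. b' i j * (u i * u j))"
    define fu where "fu = f (\<lambda>i. x i + u i)"
    define gu where "gu = g (\<lambda>i. x i + u i)"
    define r where "r = fu - (f x + l + q)"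
    define r' where "r' = gu - (g x + l' + q')"
    have l: "\<bar>l\<bar> \<le> K * c * d" "\<bar>l'\<bar> \<le> L * c * d" unfolding l_def l'_def using ab ab' KL by (intro lin; simp)+
    have q: "\<bar>q\<bar> \<le> K * c\<^sup>2 * d\<^sup>2" "\<bar>q'\<bar> \<le> L * c\<^sup>2 * d\<^sup>2" unfolding q_def q'_def using ab ab' KL by (intro qua; simp)+
    have r: "\<bar>r\<bar> \<le> K * d ^ 3" "\<bar>r'\<bar> \<le> L * d ^ 3"
      unfolding r_def r'_def fu_def gu_def l_def q_def l'_def q'_def using ab(3) ab'(3) d by auto
    have gu: "\<bar>gu\<bar> \<le> L" unfolding gu_def by (rule smooth3D(1)[OF g])
    have SA: "(\<Sum>i\<in>J. A i * u i) = f x * l' + g x * l"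
      unfolding A_def l_def l'_def by (simp add: sum.distrib sum_distrib_left algebra_simps)
    have ll: "l * l' = (\<Sum>i\<in>J. \<Sum>j\<in>J. a i * a' j * (u i * u j))"
      unfolding l_def l'_def sum_product by (intro sum.cong refl) (simp add: mult_ac)
    have SB: "(\<Sum>i\<in>J. \<Sum>j\<in>J. B i j * (u i * u j)) = f x * q' + l * l' + g x * q"
      unfolding ll B_def q_def q'_def by (simp add: sum.distrib sum_distrib_left algebra_simps)
    have eq: "fu * gu - (f x * g x + (f x * l' + g x * l) + (f x * q' + l * l' + g x * q))
       = f x * r' + l * q' + l * r' + q * l' + q * q' + q * r' + r * gu"
      unfolding r_def r'_def by algebra
    have dd: "d ^ i \<le> d ^ 3" if "3 \<le> i" for i using power_decreasing[of 3 i d] d that by simp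
    have term_le: "\<bar>p * p'\<bar> \<le> (1 + c) ^ 4 * (K * L) * d ^ 3"
      if p: "\<bar>p\<bar> \<le> K * c ^ i * d ^ m" and p': "\<bar>p'\<bar> \<le> L * c ^ i' * d ^ m'" and "i + i' \<le> 4" "3 \<le> m + m'" for p p' i m i' m'
    proof -
      have "\<bar>p * p'\<bar> \<le> (K * c ^ i * d ^ m) * (L * c ^ i' * d ^ m')"
        using p p' KL c d unfolding abs_mult by (intro mult_mono) auto
      also have "\<dots> = (K * L) * (c ^ (i + i') * d ^ (m + m'))" by (simp add: power_add mult_ac)
      also have "\<dots> \<le> (K * L) * ((1 + c) ^ 4 * d ^ 3)"
        using KL0 pw[OF that(3)] dd[OF that(4)] c d by (intro mult_left_mono mult_mono) auto
      finally show ?thesis by (simp add: mult_ac)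
    qed
    have t1: "\<bar>f x * r'\<bar> \<le> (1 + c) ^ 4 * (K * L) * d ^ 3" using term_le[of "f x" 0 0 r' 0 3] fx r by simp
    have t2: "\<bar>l * q'\<bar> \<le> (1 + c) ^ 4 * (K * L) * d ^ 3" using term_le[of l 1 1 q' 2 2] l q by simp
    have t3: "\<bar>l * r'\<bar> \<le> (1 + c) ^ 4 * (K * L) * d ^ 3" using term_le[of l 1 1 r' 0 3] l r by simp
    have t4: "\<bar>q * l'\<bar> \<le> (1 + c) ^ 4 * (K * L) * d ^ 3" using term_le[of q 2 2 l' 1 1] l q by simp
    have t5: "\<bar>q * q'\<bar> \<le> (1 + c) ^ 4 * (K * L) * d ^ 3" using term_le[of q 2 2 q' 2 2] q by simp
    have t6: "\<bar>q * r'\<bar> \<le> (1 + c) ^ 4 * (K * L) * d ^ 3" using term_le[of q 2 2 r' 0 3] q r by simp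
    have t7: "\<bar>r * gu\<bar> \<le> (1 + c) ^ 4 * (K * L) * d ^ 3" using term_le[of r 0 3 gu 0 0] gu r by simp
    show ?thesis
      unfolding SA SB fu_def[symmetric] gu_def[symmetric] eq M_def using t1 t2 t3 t4 t5 t6 t7 by linarith
  qed
  show "\<exists>a b. taylor2 J (7 * (1 + real (card J)) ^ 4 * (K * L)) (\<lambda>x. f x * g x) x a b"
    unfolding taylor2_def c_def[symmetric] M_def[symmetric] using A B R by blast
qed

text \<open>A smooth function between the indicator functions of the boxes with half widths \<open>r\<close> and \<open>r + 3 \<eta>\<close>.\<close>

definition bump :: "nat set \<Rightarrow> real \<Rightarrow> real \<Rightarrow> (nat \<Rightarrow> real) \<Rightarrow> real" where
  "bump J \<eta> r x = (\<Prod>j\<in>J. spline_step ((r + 3 * \<eta> + (-1) * x j) / \<eta>) * spline_step ((r + 3 * \<eta> + 1 * x j) / \<eta>))"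

lemma bump_range: "0 \<le> bump J \<eta> r x" "bump J \<eta> r x \<le> 1"
  unfolding bump_def by (auto intro!: prod_nonneg prod_le_1 mult_le_one simp: spline_step_range)

lemma bump_1: "0 < \<eta> \<Longrightarrow> (\<And>j. j \<in> J \<Longrightarrow> \<bar>x j\<bar> \<le> r) \<Longrightarrow> bump J \<eta> r x = 1"
proof -
  assume \<eta>: "0 < \<eta>" and x: "\<And>j. j \<in> J \<Longrightarrow> \<bar>x j\<bar> \<le> r"
  have "3 \<le> (r + 3 * \<eta> + s * x j) / \<eta>" if "j \<in> J" "s = 1 \<or> s = -1" for j s
    using x[OF that(1)] that(2) \<eta> by (auto simp: field_simps abs_le_iff)
  then have "spline_step ((r + 3 * \<eta> + s * x j) / \<eta>) = 1" if "j \<in> J" "s = 1 \<or> s = -1" for j s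
    using that by (intro spline_step_1) auto
  from this[where s="-1"] this[where s=1] show ?thesis
    unfolding bump_def by (intro prod.neutral ballI) simp
qed

lemma bump_nonzeroD:
  assumes "finite J" "0 < \<eta>" "bump J \<eta> r x \<noteq> 0" "j \<in> J"
  shows "\<bar>x j\<bar> \<le> r + 3 * \<eta>"
proof (rule ccontr)
  assume "\<not> \<bar>x j\<bar> \<le> r + 3 * \<eta>"
  then have "spline_step ((r + 3 * \<eta> + (-1) * x j) / \<eta>) = 0 \<or> spline_step ((r + 3 * \<eta> + 1 * x j) / \<eta>) = 0"
    using \<open>0 < \<eta>\<close> by (auto simp: abs_le_iff not_le divide_nonpos_pos intro!: spline_step_0)
  then show False using assms by (auto simp: bump_def)
qed

text \<open>The constant is uniform in the half width \<open>r\<close>, since \<open>r\<close> enters only through a translation of the spline.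
This is what makes all later comparisons of distribution functions uniform.\<close>

lemma smooth3_bump:
  assumes "finite J" "0 < \<eta>" "\<eta> \<le> 1"
  obtains K where "\<And>r. smooth3 J K (bump J \<eta> r)"
proof -
  have "\<exists>K. \<forall>r. smooth3 J K (bump I \<eta> r)" if "finite I" "I \<subseteq> J" for I
    using that
  proof induction
    case empty
    show ?case by (intro exI[of _ 1]) (auto simp: smooth3_def taylor2_def bump_def intro!: exI[of _ "\<lambda>_. 0"] exI[of _ "\<lambda>_ _. 0"])
  next
    case (insert i I)
    then obtain K where K: "\<And>r. smooth3 J K (bump I \<eta> r)" by auto
    have "smooth3 J (7 * (1 + real (card J)) ^ 4 * (7 * (1 + real (card J)) ^ 4 * (12 / \<eta> ^ 3 * (12 / \<eta> ^ 3)) * K)) (bump (insert i I) \<eta> r)" for r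
    proof -
      have "smooth3 J (7 * (1 + real (card J)) ^ 4 * (7 * (1 + real (card J)) ^ 4 * (12 / \<eta> ^ 3 * (12 / \<eta> ^ 3)) * K))
         (\<lambda>x. (spline_step ((r + 3 * \<eta> + (-1) * x i) / \<eta>) * spline_step ((r + 3 * \<eta> + 1 * x i) / \<eta>)) * bump I \<eta> r x)"
        using insert.prems assms by (intro smooth3_mult smooth3_coordinate K) auto
      also have "(\<lambda>x. (spline_step ((r + 3 * \<eta> + (-1) * x i) / \<eta>) * spline_step ((r + 3 * \<eta> + 1 * x i) / \<eta>)) * bump I \<eta> r x) = bump (insert i I) \<eta> r"
        using insert.hyps by (simp add: bump_def fun_eq_iff)
      finally show ?thesis .
    qed
    then show ?case by blast
  qed
  from this[OF assms(1) subset_refl] show ?thesis using that by blast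
qed

lemma bump_measurable: "bump J \<eta> r \<in> borel_measurable borel"
proof -
  have [measurable]: "spline_step \<in> borel_measurable borel"
    by (intro borel_measurable_continuous_onI continuous_spline_step)
  show ?thesis unfolding bump_def by measurable
qed

section \<open>Comparing sums of independent vectors\<close>

lemma measurable_shift:
  fixes u :: "'a \<Rightarrow> nat \<Rightarrow> real"
  assumes u: "\<And>j. (\<lambda>v. u v j) \<in> borel_measurable N"
  shows "(\<lambda>(x, v) j. x j + u v j) \<in> borel \<Otimes>\<^sub>M N \<rightarrow>\<^sub>M borel"
  unfolding case_prod_beta
  by (intro measurable_coordinatewise_then_product borel_measurable_add
      measurable_compose[OF measurable_fst measurable_product_coordinates] measurable_compose[OF measurable_snd u])

lemma measurable_shift_at:
  fixes u :: "'a \<Rightarrow> nat \<Rightarrow> real"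
  assumes [measurable]: "\<And>j. (\<lambda>v. u v j) \<in> borel_measurable N"
  shows "(\<lambda>v j. x j + u v j) \<in> N \<rightarrow>\<^sub>M borel"
  by (rule measurable_coordinatewise_then_product) measurable

lemma (in prob_space) integrable_bounded:
  fixes f :: "'a \<Rightarrow> real"
  assumes "f \<in> borel_measurable M" "\<And>x. x \<in> space M \<Longrightarrow> \<bar>f x\<bar> \<le> K"
  shows "integrable M f"
  using assms by (intro integrable_const_bound[where B=K]) auto

lemma (in prob_space) abs_integral_le_bound:
  fixes f :: "'a \<Rightarrow> real"
  assumes f: "f \<in> borel_measurable M" "\<And>x. x \<in> space M \<Longrightarrow> \<bar>f x\<bar> \<le> K"
  shows "\<bar>\<integral>x. f x \<partial>M\<bar> \<le> K"
proof -
  have i: "integrable M f" by (rule integrable_bounded[OF f])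
  have "\<bar>\<integral>x. f x \<partial>M\<bar> \<le> (\<integral>x. \<bar>f x\<bar> \<partial>M)" using integral_abs_bound by blast
  also have "\<dots> \<le> (\<integral>x. K \<partial>M)" using f i by (intro integral_mono) auto
  finally show ?thesis by (simp add: prob_space)
qed

lemma shift_average_measurable:
  fixes u :: "'a \<Rightarrow> nat \<Rightarrow> real" and f :: "(nat \<Rightarrow> real) \<Rightarrow> real"
  assumes N: "prob_space N" and [measurable]: "\<And>j. (\<lambda>v. u v j) \<in> borel_measurable N"
    and f[measurable]: "f \<in> borel_measurable borel"
  shows "(\<lambda>x. \<integral>v. f (\<lambda>j. x j + u v j) \<partial>N) \<in> borel_measurable borel"
proof -
  interpret prob_space N by fact
  have "(\<lambda>(x, v). f (\<lambda>j. x j + u v j)) \<in> borel_measurable (borel \<Otimes>\<^sub>M N)"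
    using measurable_compose[OF measurable_shift[of u N] f] by (simp add: case_prod_beta)
  then show ?thesis by (rule borel_measurable_lebesgue_integral)
qed

text \<open>Averaging \<open>f\<close> over a random displacement is an operator on bounded functions; two such operators commute
by Fubini's theorem.\<close>

lemma shift_average_commute:
  fixes u :: "'a \<Rightarrow> nat \<Rightarrow> real" and u' :: "'b \<Rightarrow> nat \<Rightarrow> real" and f :: "(nat \<Rightarrow> real) \<Rightarrow> real"
  assumes N: "prob_space N" and u[measurable]: "\<And>j. (\<lambda>v. u v j) \<in> borel_measurable N"
    and N': "prob_space N'" and u'[measurable]: "\<And>j. (\<lambda>v. u' v j) \<in> borel_measurable N'"
    and f: "f \<in> borel_measurable borel" "\<And>x. \<bar>f x\<bar> \<le> K"
  shows "(\<integral>v. (\<integral>w. f (\<lambda>j. x j + u v j + u' w j) \<partial>N') \<partial>N) = (\<integral>w. (\<integral>v. f (\<lambda>j. x j + u' w j + u v j) \<partial>N) \<partial>N')"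
proof -
  interpret N: prob_space N by fact
  interpret N': prob_space N' by fact
  interpret P: pair_prob_space N N' ..
  have "(\<lambda>p j. x j + u (fst p) j + u' (snd p) j) \<in> N \<Otimes>\<^sub>M N' \<rightarrow>\<^sub>M borel"
    by (intro measurable_coordinatewise_then_product borel_measurable_add borel_measurable_const
      measurable_compose[OF measurable_fst u] measurable_compose[OF measurable_snd u'])
  from measurable_compose[OF this f(1)]
  have "integrable (N \<Otimes>\<^sub>M N') (\<lambda>(v, w). f (\<lambda>j. x j + u v j + u' w j))"
    unfolding case_prod_beta using f(2) by (intro P.P.integrable_bounded[where K=K]) auto
  from P.Fubini_integral[OF this] show ?thesis by (simp add: ac_simps)
qed

lemma iid_sum_integral_Suc:
  fixes u :: "'a \<Rightarrow> nat \<Rightarrow> real" and f :: "(nat \<Rightarrow> real) \<Rightarrow> real"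
  assumes N: "prob_space N" and u[measurable]: "\<And>j. (\<lambda>v. u v j) \<in> borel_measurable N"
    and f: "f \<in> borel_measurable borel" "\<And>x. \<bar>f x\<bar> \<le> K"
  shows "(\<integral>\<omega>. f (\<lambda>j. x j + (\<Sum>i<Suc n. u (\<omega> i) j)) \<partial>PiM {..<Suc n} (\<lambda>_. N))
    = (\<integral>\<omega>. (\<integral>v. f (\<lambda>j. x j + (\<Sum>i<n. u (\<omega> i) j) + u v j) \<partial>N) \<partial>PiM {..<n} (\<lambda>_. N))"
proof -
  interpret P: product_prob_space "\<lambda>_::nat. N" by (intro product_prob_spaceI N)
  interpret Q: prob_space "PiM {..<Suc n} (\<lambda>_. N)" by (intro prob_space_PiM N)
  have "(\<lambda>\<omega> j. x j + (\<Sum>i<Suc n. u (\<omega> i) j)) \<in> PiM {..<Suc n} (\<lambda>_. N) \<rightarrow>\<^sub>M borel"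
    by (rule measurable_coordinatewise_then_product) measurable
  from measurable_compose[OF this f(1)]
  have int: "integrable (PiM (insert n {..<n}) (\<lambda>_. N)) (\<lambda>\<omega>. f (\<lambda>j. x j + (\<Sum>i<Suc n. u (\<omega> i) j)))"
    unfolding lessThan_Suc[symmetric] using f(2) by (intro Q.integrable_bounded[where K=K]) auto
  have eq: "(\<Sum>i<Suc n. u ((fun_upd \<omega> n v) i) j) = (\<Sum>i<n. u (\<omega> i) j) + u v j" for \<omega> v j
    by (simp add: sum.lessThan_Suc)
  show ?thesis
    unfolding lessThan_Suc[of n]
    using P.product_integral_insert[OF finite_lessThan _ int] by (simp add: eq add.assoc lessThan_Suc[symmetric])
qed

text \<open>Let \<open>A\<close> and \<open>A'\<close> be the operators that average over one displacement by \<open>u\<close> and by \<open>u'\<close>. The expectation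
of \<open>f\<close> at a sum of \<open>n\<close> independent displacements is the \<open>n\<close>-th power of the operator applied to \<open>f\<close>. All operators are
contractions for the supremum norm and commute, so replacing the displacements one at a time changes the
result by at most the supremum norm of \<open>A f - A' f\<close> for each of the \<open>n\<close> replacements.\<close>

lemma trotter_comparison:
  fixes u :: "'a \<Rightarrow> nat \<Rightarrow> real" and u' :: "'b \<Rightarrow> nat \<Rightarrow> real" and f :: "(nat \<Rightarrow> real) \<Rightarrow> real"
  assumes N: "prob_space N" and u[measurable]: "\<And>j. (\<lambda>v. u v j) \<in> borel_measurable N"
    and N': "prob_space N'" and u'[measurable]: "\<And>j. (\<lambda>v. u' v j) \<in> borel_measurable N'"
    and f: "f \<in> borel_measurable borel" "\<And>x. \<bar>f x\<bar> \<le> K"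
    and step: "\<And>x. \<bar>(\<integral>v. f (\<lambda>j. x j + u v j) \<partial>N) - (\<integral>v. f (\<lambda>j. x j + u' v j) \<partial>N')\<bar> \<le> \<delta>"
  shows "\<bar>(\<integral>\<omega>. f (\<lambda>j. x j + (\<Sum>i<n. u (\<omega> i) j)) \<partial>PiM {..<n} (\<lambda>_. N))
    - (\<integral>\<omega>. f (\<lambda>j. x j + (\<Sum>i<n. u' (\<omega> i) j)) \<partial>PiM {..<n} (\<lambda>_. N'))\<bar> \<le> real n * \<delta>"
  using f step
proof (induction n arbitrary: f x)
  case 0
  interpret prob_space "PiM {} (\<lambda>_. N)" by (rule prob_space_PiM) simp
  interpret N': prob_space "PiM {} (\<lambda>_. N')" by (rule prob_space_PiM) simp
  show ?case by (simp add: prob_space N'.prob_space)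
next
  case (Suc n)
  note [measurable] = Suc.prems(1)
  interpret N: prob_space N by fact
  interpret N': prob_space N' by fact
  interpret Pn: prob_space "PiM {..<n} (\<lambda>_. N)" by (intro prob_space_PiM N)
  define A where "A g x = (\<integral>v. g (\<lambda>j. x j + u v j) \<partial>N)" for g :: "(nat \<Rightarrow> real) \<Rightarrow> real" and x :: "nat \<Rightarrow> real"
  define A' where "A' g x = (\<integral>v. g (\<lambda>j. x j + u' v j) \<partial>N')" for g :: "(nat \<Rightarrow> real) \<Rightarrow> real" and x :: "nat \<Rightarrow> real"
  define E where "E g x = (\<integral>\<omega>. g (\<lambda>j. x j + (\<Sum>i<n. u (\<omega> i) j)) \<partial>PiM {..<n} (\<lambda>_. N))" for g :: "(nat \<Rightarrow> real) \<Rightarrow> real" and x :: "nat \<Rightarrow> real"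
  define E' where "E' g x = (\<integral>\<omega>. g (\<lambda>j. x j + (\<Sum>i<n. u' (\<omega> i) j)) \<partial>PiM {..<n} (\<lambda>_. N'))" for g :: "(nat \<Rightarrow> real) \<Rightarrow> real" and x :: "nat \<Rightarrow> real"
  have mA[measurable]: "A f \<in> borel_measurable borel" and mA'[measurable]: "A' f \<in> borel_measurable borel"
    unfolding A_def A'_def by (rule shift_average_measurable; fact)+
  have bA: "\<bar>A f x\<bar> \<le> K" and bA': "\<bar>A' f x\<bar> \<le> K" for x
    unfolding A_def A'_def using Suc.prems(2) measurable_compose[OF measurable_shift_at[of u N] Suc.prems(1)]
      measurable_compose[OF measurable_shift_at[of u' N'] Suc.prems(1)]
    by (auto intro!: N.abs_integral_le_bound N'.abs_integral_le_bound)
  have E_Suc: "(\<integral>\<omega>. f (\<lambda>j. x j + (\<Sum>i<Suc n. u (\<omega> i) j)) \<partial>PiM {..<Suc n} (\<lambda>_. N)) = E (A f) x"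
    unfolding E_def A_def by (rule iid_sum_integral_Suc[OF N u Suc.prems(1,2)])
  have E'_Suc: "(\<integral>\<omega>. f (\<lambda>j. x j + (\<Sum>i<Suc n. u' (\<omega> i) j)) \<partial>PiM {..<Suc n} (\<lambda>_. N')) = E' (A' f) x"
    unfolding E'_def A'_def by (rule iid_sum_integral_Suc[OF N' u' Suc.prems(1,2)])
  have 1: "\<bar>E (A f) x - E (A' f) x\<bar> \<le> \<delta>"
  proof -
    have m: "(\<lambda>\<omega> j. x j + (\<Sum>i<n. u (\<omega> i) j)) \<in> PiM {..<n} (\<lambda>_. N) \<rightarrow>\<^sub>M borel"
      by (rule measurable_coordinatewise_then_product) measurable
    note mf = measurable_compose[OF m mA] and mf' = measurable_compose[OF m mA']
    have "E (A f) x - E (A' f) x = (\<integral>\<omega>. A f (\<lambda>j. x j + (\<Sum>i<n. u (\<omega> i) j)) - A' f (\<lambda>j. x j + (\<Sum>i<n. u (\<omega> i) j)) \<partial>PiM {..<n} (\<lambda>_. N))"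
      unfolding E_def using mf mf' bA bA' by (intro Bochner_Integration.integral_diff[symmetric] Pn.integrable_bounded) auto
    also have "\<bar>\<dots>\<bar> \<le> \<delta>"
      using mf mf' Suc.prems(3) by (intro Pn.abs_integral_le_bound) (auto simp: A_def A'_def)
    finally show ?thesis .
  qed
  have 2: "\<bar>E (A' f) x - E' (A' f) x\<bar> \<le> real n * \<delta>"
    unfolding E_def E'_def
  proof (rule Suc.IH[OF mA' bA'])
    fix x
    have m: "(\<lambda>v j. x j + u' v j) \<in> N' \<rightarrow>\<^sub>M borel" by (rule measurable_shift_at) measurable
    note mf = measurable_compose[OF m mA] and mf' = measurable_compose[OF m mA']
    have "(\<integral>v. A' f (\<lambda>j. x j + u v j) \<partial>N) = (\<integral>v. A f (\<lambda>j. x j + u' v j) \<partial>N')"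
      unfolding A_def A'_def by (rule shift_average_commute[OF N u N' u' Suc.prems(1,2)])
    then have "(\<integral>v. A' f (\<lambda>j. x j + u v j) \<partial>N) - (\<integral>v. A' f (\<lambda>j. x j + u' v j) \<partial>N')
        = (\<integral>v. A f (\<lambda>j. x j + u' v j) - A' f (\<lambda>j. x j + u' v j) \<partial>N')"
      using mf mf' bA bA' by (simp, intro Bochner_Integration.integral_diff[symmetric] N'.integrable_bounded) auto
    also have "\<bar>\<dots>\<bar> \<le> \<delta>"
      using mf mf' Suc.prems(3) by (intro N'.abs_integral_le_bound) (auto simp: A_def A'_def)
    finally show "\<bar>(\<integral>v. A' f (\<lambda>j. x j + u v j) \<partial>N) - (\<integral>v. A' f (\<lambda>j. x j + u' v j) \<partial>N')\<bar> \<le> \<delta>" .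
  qed
  from 1 2 show ?case
    unfolding E_Suc E'_Suc by (simp add: algebra_simps)
qed

lemma smooth3_integral_expansion:
  fixes u :: "'a \<Rightarrow> nat \<Rightarrow> real"
  assumes N: "prob_space N" and u[measurable]: "\<And>j. (\<lambda>v. u v j) \<in> borel_measurable N"
    and J: "finite J" and mean: "\<And>j. j \<in> J \<Longrightarrow> (\<integral>v. u v j \<partial>N) = 0"
    and bd: "\<And>v j. v \<in> space N \<Longrightarrow> j \<in> J \<Longrightarrow> \<bar>u v j\<bar> \<le> d" and d: "0 \<le> d" "d \<le> 1"
    and f: "f \<in> borel_measurable borel" "\<And>x. \<bar>f x\<bar> \<le> K"
    and exp: "taylor2 J K f x a b"
  shows "\<bar>(\<integral>v. f (\<lambda>j. x j + u v j) \<partial>N) - (f x + (\<Sum>i\<in>J. \<Sum>j\<in>J. b i j * (\<integral>v. u v i * u v j \<partial>N)))\<bar> \<le> K * d ^ 3"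
proof -
  interpret prob_space N by fact
  have m[measurable]: "(\<lambda>v. f (\<lambda>j. x j + u v j)) \<in> borel_measurable N"
    using measurable_compose[OF measurable_shift_at[of u N] f(1)] by simp
  have i1: "integrable N (\<lambda>v. f (\<lambda>j. x j + u v j))" using f(2) m by (intro integrable_bounded)
  have i2: "integrable N (\<lambda>v. u v j)" if "j \<in> J" for j using bd that by (intro integrable_bounded) auto
  have i3: "integrable N (\<lambda>v. u v i * u v j)" if "i \<in> J" "j \<in> J" for i j
  proof (rule integrable_bounded[where K="d * d"])
    show "\<bar>u v i * u v j\<bar> \<le> d * d" if "v \<in> space N" for v
      using bd[OF that \<open>i \<in> J\<close>] bd[OF that \<open>j \<in> J\<close>] d by (simp add: abs_mult mult_mono)
  qed measurable
  let ?q = "\<lambda>v. f x + (\<Sum>i\<in>J. a i * u v i) + (\<Sum>i\<in>J. \<Sum>j\<in>J. b i j * (u v i * u v j))"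
  have iq: "integrable N ?q" using i2 i3 by (intro Bochner_Integration.integrable_add Bochner_Integration.integrable_sum integrable_mult_right) auto
  have "(\<integral>v. ?q v \<partial>N) = f x + (\<Sum>i\<in>J. a i * (\<integral>v. u v i \<partial>N)) + (\<Sum>i\<in>J. \<Sum>j\<in>J. b i j * (\<integral>v. u v i * u v j \<partial>N))"
    using i2 i3 by (simp add: Bochner_Integration.integral_sum Bochner_Integration.integrable_sum prob_space)
  also have "\<dots> = f x + (\<Sum>i\<in>J. \<Sum>j\<in>J. b i j * (\<integral>v. u v i * u v j \<partial>N))"
    using mean by simp
  finally have "(\<integral>v. f (\<lambda>j. x j + u v j) \<partial>N) - (f x + (\<Sum>i\<in>J. \<Sum>j\<in>J. b i j * (\<integral>v. u v i * u v j \<partial>N)))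
     = (\<integral>v. f (\<lambda>j. x j + u v j) - ?q v \<partial>N)"
    using i1 iq by simp
  also have "\<bar>\<dots>\<bar> \<le> K * d ^ 3"
    using bd d exp unfolding taylor2_def by (intro abs_integral_le_bound) auto
  finally show ?thesis .
qed

text \<open>In the expansion of \<open>f\<close> the linear terms average to 0 and the quadratic terms to covariances, so that
averaging over one displacement of size \<open>d\<close> depends on its law only through the covariances, up to \<open>K d\<^sup>3\<close>.\<close>

lemma lindeberg_comparison:
  fixes u :: "'a \<Rightarrow> nat \<Rightarrow> real" and u' :: "'b \<Rightarrow> nat \<Rightarrow> real" and f :: "(nat \<Rightarrow> real) \<Rightarrow> real"
  assumes N: "prob_space N" and u: "\<And>j. (\<lambda>v. u v j) \<in> borel_measurable N"
    and N': "prob_space N'" and u': "\<And>j. (\<lambda>v. u' v j) \<in> borel_measurable N'"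
    and J: "finite J" and f: "smooth3 J K f" "f \<in> borel_measurable borel"
    and mean: "\<And>j. j \<in> J \<Longrightarrow> (\<integral>v. u v j \<partial>N) = 0" "\<And>j. j \<in> J \<Longrightarrow> (\<integral>v. u' v j \<partial>N') = 0"
    and bd: "\<And>v j. v \<in> space N \<Longrightarrow> j \<in> J \<Longrightarrow> \<bar>u v j\<bar> \<le> d" "\<And>v j. v \<in> space N' \<Longrightarrow> j \<in> J \<Longrightarrow> \<bar>u' v j\<bar> \<le> d"
    and d: "0 \<le> d" "d \<le> 1"
  shows "\<bar>(\<integral>\<omega>. f (\<lambda>j. \<Sum>i<n. u (\<omega> i) j) \<partial>PiM {..<n} (\<lambda>_. N)) - (\<integral>\<omega>. f (\<lambda>j. \<Sum>i<n. u' (\<omega> i) j) \<partial>PiM {..<n} (\<lambda>_. N'))\<bar>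
    \<le> real n * (K * (\<Sum>i\<in>J. \<Sum>j\<in>J. \<bar>(\<integral>v. u v i * u v j \<partial>N) - (\<integral>v. u' v i * u' v j \<partial>N')\<bar>) + 2 * (K * d ^ 3))"
proof -
  have K: "\<bar>f x\<bar> \<le> K" for x by (rule smooth3D(1)[OF f(1)])
  have step: "\<bar>(\<integral>v. f (\<lambda>j. x j + u v j) \<partial>N) - (\<integral>v. f (\<lambda>j. x j + u' v j) \<partial>N')\<bar>
    \<le> K * (\<Sum>i\<in>J. \<Sum>j\<in>J. \<bar>(\<integral>v. u v i * u v j \<partial>N) - (\<integral>v. u' v i * u' v j \<partial>N')\<bar>) + 2 * (K * d ^ 3)" for x
  proof -
    obtain a b where exp: "taylor2 J K f x a b" using smooth3D(2)[OF f(1), of x] by blast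
    then have ab: "\<forall>i\<in>J. \<forall>j\<in>J. \<bar>b i j\<bar> \<le> K" unfolding taylor2_def by blast
    define c where "c i j = (\<integral>v. u v i * u v j \<partial>N)" for i j
    define c' where "c' i j = (\<integral>v. u' v i * u' v j \<partial>N')" for i j
    have 1: "\<bar>(\<integral>v. f (\<lambda>j. x j + u v j) \<partial>N) - (f x + (\<Sum>i\<in>J. \<Sum>j\<in>J. b i j * c i j))\<bar> \<le> K * d ^ 3"
      unfolding c_def by (rule smooth3_integral_expansion[OF N u J mean(1) bd(1) d f(2) K exp])
    have 2: "\<bar>(\<integral>v. f (\<lambda>j. x j + u' v j) \<partial>N') - (f x + (\<Sum>i\<in>J. \<Sum>j\<in>J. b i j * c' i j))\<bar> \<le> K * d ^ 3"
      unfolding c'_def by (rule smooth3_integral_expansion[OF N' u' J mean(2) bd(2) d f(2) K exp])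
    have "\<bar>(\<Sum>i\<in>J. \<Sum>j\<in>J. b i j * c i j) - (\<Sum>i\<in>J. \<Sum>j\<in>J. b i j * c' i j)\<bar> = \<bar>\<Sum>i\<in>J. \<Sum>j\<in>J. b i j * (c i j - c' i j)\<bar>"
      by (simp add: sum_subtractf right_diff_distrib)
    also have "\<dots> \<le> (\<Sum>i\<in>J. \<Sum>j\<in>J. K * \<bar>c i j - c' i j\<bar>)"
      using ab by (intro order_trans[OF sum_abs] sum_mono) (auto simp: abs_mult intro!: mult_right_mono)
    also have "\<dots> = K * (\<Sum>i\<in>J. \<Sum>j\<in>J. \<bar>c i j - c' i j\<bar>)" by (simp add: sum_distrib_left)
    finally show ?thesis using 1 2 unfolding c_def c'_def by linarith
  qed
  from trotter_comparison[OF N u N' u' f(2) K step, where x="\<lambda>_. 0" and n=n] show ?thesis by simp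
qed

section \<open>Normalized sums of random paths\<close>

definition normalized_sum :: "('a \<Rightarrow> real \<Rightarrow> real) \<Rightarrow> nat \<Rightarrow> (nat \<Rightarrow> 'a) \<Rightarrow> real \<Rightarrow> real" where
  "normalized_sum Y n \<omega> t = (\<Sum>i<n. Y (\<omega> i) t) / sqrt (real n)"

abbreviation sample :: "'a measure \<Rightarrow> nat \<Rightarrow> (nat \<Rightarrow> 'a) measure" where
  "sample N n \<equiv> PiM {..<n} (\<lambda>_. N)"

definition sup_cdf :: "'a measure \<Rightarrow> ('a \<Rightarrow> real \<Rightarrow> real) \<Rightarrow> nat \<Rightarrow> real \<Rightarrow> real" where
  "sup_cdf N Y n r = measure (sample N n) {\<omega> \<in> space (sample N n). \<forall>t. \<bar>normalized_sum Y n \<omega> t\<bar> \<le> r}"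

definition path_cov :: "'a measure \<Rightarrow> ('a \<Rightarrow> real \<Rightarrow> real) \<Rightarrow> real \<Rightarrow> real \<Rightarrow> real" where
  "path_cov N Y s t = (\<integral>v. Y v s * Y v t \<partial>N)"

lemma (in prob_space) second_moment_weighted_sum:
  fixes y :: "'a \<Rightarrow> real" and n :: nat
  assumes [measurable]: "y \<in> borel_measurable M" and bd: "\<And>v. v \<in> space M \<Longrightarrow> \<bar>y v\<bar> \<le> K"
    and mean: "(\<integral>v. y v \<partial>M) = 0"
  shows "(\<integral>\<omega>. (\<Sum>i<n. c i * y (\<omega> i))\<^sup>2 \<partial>PiM {..<n} (\<lambda>_. M)) = (\<Sum>i<n. (c i)\<^sup>2) * (\<integral>v. (y v)\<^sup>2 \<partial>M)"
proof (induction n)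
  case 0
  then show ?case by simp
next
  case (Suc n)
  interpret P: product_prob_space "\<lambda>_::nat. M" by (intro product_prob_spaceI prob_space_axioms)
  interpret Pn: prob_space "PiM {..<n} (\<lambda>_. M)" by (intro prob_space_PiM prob_space_axioms)
  interpret Q: prob_space "PiM {..<Suc n} (\<lambda>_. M)" by (intro prob_space_PiM prob_space_axioms)
  have sb: "\<bar>\<Sum>i<m. c i * y (\<omega> i)\<bar> \<le> (\<Sum>i<m. \<bar>c i\<bar> * K)" if "\<omega> \<in> space (PiM {..<m} (\<lambda>_. M))" for m \<omega>
    using that bd by (intro order_trans[OF sum_abs] sum_mono) (auto simp: abs_mult space_PiM PiE_def Pi_def intro!: mult_left_mono)
  have sq: "\<bar>(\<Sum>i<m. c i * y (\<omega> i))\<^sup>2\<bar> \<le> (\<Sum>i<m. \<bar>c i\<bar> * K)\<^sup>2" if "\<omega> \<in> space (PiM {..<m} (\<lambda>_. M))" for m \<omega>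
    using sb[OF that] by (simp add: abs_le_square_iff[symmetric])
  have i0: "integrable (PiM {..<n} (\<lambda>_. M)) (\<lambda>\<omega>. (\<Sum>i<n. c i * y (\<omega> i))\<^sup>2)"
    by (rule Pn.integrable_bounded[OF _ sq]) measurable
  have iy: "integrable M y" using bd by (intro integrable_bounded) auto
  have iy2: "integrable M (\<lambda>v. (y v)\<^sup>2)"
    by (rule integrable_bounded[where K="K\<^sup>2"]) (use bd in \<open>auto simp: abs_le_square_iff[symmetric] intro: order_trans[OF _ abs_ge_self]\<close>)
  have int: "integrable (PiM (insert n {..<n}) (\<lambda>_. M)) (\<lambda>\<omega>. (\<Sum>i<Suc n. c i * y (\<omega> i))\<^sup>2)"
    unfolding lessThan_Suc[symmetric] by (rule Q.integrable_bounded[OF _ sq]) measurable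
  have eq: "(\<Sum>i<Suc n. c i * y ((fun_upd \<omega> n v) i)) = (\<Sum>i<n. c i * y (\<omega> i)) + c n * y v" for \<omega> v
    by (simp add: sum.lessThan_Suc)
  have inner: "(\<integral>v. (a + c n * y v)\<^sup>2 \<partial>M) = a\<^sup>2 + (c n)\<^sup>2 * (\<integral>v. (y v)\<^sup>2 \<partial>M)" for a
    unfolding power2_sum using iy iy2 by (simp add: mean prob_space power_mult_distrib)
  have "(\<integral>\<omega>. (\<Sum>i<Suc n. c i * y (\<omega> i))\<^sup>2 \<partial>PiM {..<Suc n} (\<lambda>_. M))
      = (\<integral>\<omega>. (\<integral>v. ((\<Sum>i<n. c i * y (\<omega> i)) + c n * y v)\<^sup>2 \<partial>M) \<partial>PiM {..<n} (\<lambda>_. M))"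
    unfolding lessThan_Suc[of n] using P.product_integral_insert[OF finite_lessThan _ int] by (simp add: eq lessThan_Suc[symmetric])
  also have "\<dots> = (\<integral>\<omega>. (\<Sum>i<n. c i * y (\<omega> i))\<^sup>2 + (c n)\<^sup>2 * (\<integral>v. (y v)\<^sup>2 \<partial>M) \<partial>PiM {..<n} (\<lambda>_. M))"
    by (simp add: inner)
  also have "\<dots> = (\<Sum>i<n. (c i)\<^sup>2) * (\<integral>v. (y v)\<^sup>2 \<partial>M) + (c n)\<^sup>2 * (\<integral>v. (y v)\<^sup>2 \<partial>M)"
    using i0 Suc.IH by (simp add: Pn.prob_space)
  finally show ?case by (simp add: algebra_simps)
qed

lemma (in prob_space) markov_complement:
  fixes y :: "'a \<Rightarrow> real"
  assumes [measurable]: "y \<in> borel_measurable M" and "integrable M y" and "\<And>v. v \<in> space M \<Longrightarrow> 0 \<le> y v"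
    and "(\<integral>v. y v \<partial>M) \<le> b" and "0 < a"
  shows "prob {v \<in> space M. y v \<le> a} \<ge> 1 - b / a"
proof -
  have "prob {v \<in> space M. y v \<ge> a} \<le> (\<integral>v. y v \<partial>M) / a"
    using assms by (intro integral_Markov_inequality_measure[where A="{}"]) auto
  also have "\<dots> \<le> b / a" using assms by (intro divide_right_mono) auto
  finally have 1: "prob {v \<in> space M. y v \<ge> a} \<le> b / a" .
  have "1 = prob (space M)" by (simp add: prob_space)
  also have "\<dots> \<le> prob ({v \<in> space M. y v \<le> a} \<union> {v \<in> space M. y v \<ge> a})"
    by (intro finite_measure_mono) auto
  also have "\<dots> \<le> prob {v \<in> space M. y v \<le> a} + prob {v \<in> space M. y v \<ge> a}"
    by (intro measure_Un_le) auto
  finally show ?thesis using 1 by simp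
qed

text \<open>The common structure of the data, of the bootstrap given the data, and of the auxiliary log-concave sums.
The Lipschitz constant \<open>C\<close> enters only error terms that vanish as \<open>n\<close> grows, whereas the bound for the
mean square increments is shared by all laws and yields estimates that are uniform over them.\<close>

locale path_law = prob_space N for N :: "'a measure" +
  fixes Y :: "'a \<Rightarrow> real \<Rightarrow> real" and T C :: real
  assumes T_pos: "0 < T"
    and path: "v \<in> space N \<Longrightarrow> lip_path T C (Y v)"
    and path_measurable[measurable]: "(\<lambda>v. Y v t) \<in> borel_measurable N"
    and centered: "(\<integral>v. Y v t \<partial>N) = 0"
    and increments: "(\<integral>v. (Y v s - Y v t)\<^sup>2 \<partial>N) \<le> 4 * (s - t)\<^sup>2"
begin

lemma path_bound: "v \<in> space N \<Longrightarrow> \<bar>Y v t\<bar> \<le> C * T"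
  using lip_path_bound[OF path T_pos] .

lemma prob_space_sample: "prob_space (sample N n)"
  by (intro prob_space_PiM prob_space_axioms)

lemma C_nonneg: "0 \<le> C"
  using lip_path_nonneg[OF path] not_empty by blast

lemma normalized_sum_lip_path:
  assumes \<omega>: "\<omega> \<in> space (sample N n)"
  shows "lip_path T (C * sqrt (real n)) (normalized_sum Y n \<omega>)"
proof -
  have "lip_path T (\<bar>1 / sqrt (real n)\<bar> * (\<Sum>i<n. C)) (\<lambda>t. (1 / sqrt (real n)) * (\<Sum>i<n. Y (\<omega> i) t))"
    using \<omega> by (intro lip_path_cmult lip_path_sum path) (auto simp: space_PiM)
  moreover have "\<bar>1 / sqrt (real n)\<bar> * (\<Sum>i<n. C) = C * sqrt (real n)"
    by (cases "n = 0") (auto simp: field_simps)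
  ultimately show ?thesis by (simp add: normalized_sum_def[abs_def])
qed

lemma normalized_sum_measurable[measurable]:
  "(\<lambda>\<omega>. normalized_sum Y n \<omega> t) \<in> borel_measurable (sample N n)"
  unfolding normalized_sum_def by measurable

lemma sup_event_measurable[measurable]:
  "{\<omega> \<in> space (sample N n). \<forall>t. \<bar>normalized_sum Y n \<omega> t\<bar> \<le> r} \<in> sets (sample N n)"
proof -
  have "{\<omega> \<in> space (sample N n). \<forall>t. \<bar>normalized_sum Y n \<omega> t\<bar> \<le> r}
      = {\<omega> \<in> space (sample N n). \<forall>t\<in>\<rat>. \<bar>normalized_sum Y n \<omega> t\<bar> \<le> r}"
    using lip_path_all_rat[OF normalized_sum_lip_path] by blast
  also have "\<dots> \<in> sets (sample N n)"
    using countable_rat by measurable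
  finally show ?thesis .
qed

lemma sup_cdf_mono: "r \<le> r' \<Longrightarrow> sup_cdf N Y n r \<le> sup_cdf N Y n r'"
  unfolding sup_cdf_def using prob_space_sample[of n]
  by (intro finite_measure.finite_measure_mono) (auto simp: prob_space_def intro: order_trans)

lemma integrable_square_increment:
  "integrable (sample N n) (\<lambda>\<omega>. (normalized_sum Y n \<omega> s - normalized_sum Y n \<omega> t)\<^sup>2)"
proof -
  interpret S: prob_space "sample N n" by (rule prob_space_sample)
  show ?thesis
  proof (rule S.integrable_bounded)
    show "\<bar>(normalized_sum Y n \<omega> s - normalized_sum Y n \<omega> t)\<^sup>2\<bar> \<le> (C * sqrt (real n) * \<bar>s - t\<bar>)\<^sup>2"
      if "\<omega> \<in> space (sample N n)" for \<omega>
      using lip_pathD(1)[OF normalized_sum_lip_path[OF that], of s t] C_nonneg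
      by (simp add: abs_le_square_iff[symmetric] abs_mult)
  qed measurable
qed

lemma square_increment:
  assumes n: "0 < n"
  shows "(\<integral>\<omega>. (normalized_sum Y n \<omega> s - normalized_sum Y n \<omega> t)\<^sup>2 \<partial>sample N n) \<le> 4 * (s - t)\<^sup>2"
proof -
  have i: "integrable N (\<lambda>v. Y v t)" for t using path_bound by (intro integrable_bounded) auto
  have eq: "normalized_sum Y n \<omega> s - normalized_sum Y n \<omega> t = (\<Sum>i<n. (1 / sqrt (real n)) * (Y (\<omega> i) s - Y (\<omega> i) t))" for \<omega>
    by (simp add: normalized_sum_def diff_divide_distrib[symmetric] sum_subtractf[symmetric] sum_divide_distrib[symmetric])
  have "(\<integral>\<omega>. (normalized_sum Y n \<omega> s - normalized_sum Y n \<omega> t)\<^sup>2 \<partial>sample N n)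
     = (\<Sum>i<n. (1 / sqrt (real n))\<^sup>2) * (\<integral>v. (Y v s - Y v t)\<^sup>2 \<partial>N)"
    unfolding eq
  proof (rule second_moment_weighted_sum[where K="C * \<bar>s - t\<bar>"])
    show "\<bar>Y v s - Y v t\<bar> \<le> C * \<bar>s - t\<bar>" if "v \<in> space N" for v by (rule lip_pathD(1)[OF path[OF that]])
    show "(\<integral>v. Y v s - Y v t \<partial>N) = 0" using i by (simp add: centered)
  qed measurable
  also have "\<dots> \<le> 4 * (s - t)\<^sup>2" using n increments by (simp add: power_divide)
  finally show ?thesis .
qed

text \<open>The expected sum of squared increments over a grid of \<open>k p\<close> cells is at most \<open>4 T\<^sup>2 / (k p)\<close>, so \<open>p\<close> times
this sum has expectation at most \<open>4 T\<^sup>2 / k\<close>, independently of \<open>p\<close>. The number \<open>p\<close> may thus be chosen so large,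
depending on \<open>n\<close>, that the Lipschitz constant of the normalized sum is harmless.\<close>

lemma modulus_event:
  assumes n: "0 < n" and k: "0 < k" and \<eta>: "0 < \<eta>"
  obtains E where "E \<in> sets (sample N n)" "measure (sample N n) E \<ge> 1 - 4 * T\<^sup>2 / (real k * \<eta>\<^sup>2)"
    "\<And>\<omega> j t. \<omega> \<in> E \<Longrightarrow> j < k \<Longrightarrow> grid T k j \<le> t \<Longrightarrow> t \<le> grid T k (Suc j) \<Longrightarrow>
      \<bar>normalized_sum Y n \<omega> t - normalized_sum Y n \<omega> (grid T k j)\<bar> \<le> 2 * \<eta>"
proof -
  interpret S: prob_space "sample N n" by (rule prob_space_sample)
  \<comment> \<open>The normalized sum has Lipschitz constant \<open>C sqrt n\<close>; it changes by at most \<open>\<eta>\<close> on a fine cell.\<close>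
  define p where "p = Suc (nat \<lceil>C * sqrt (real n) * T / (real k * \<eta>)\<rceil>)"
  have p: "0 < p" by (simp add: p_def)
  have "C * sqrt (real n) * T / (real k * \<eta>) \<le> real p" unfolding p_def by linarith
  then have fine: "C * sqrt (real n) * T / real (k * p) \<le> \<eta>"
    using k p \<eta> by (simp add: field_simps)
  define Q where "Q \<omega> = real p * (\<Sum>i<k * p. (normalized_sum Y n \<omega> (grid T (k * p) (Suc i)) - normalized_sum Y n \<omega> (grid T (k * p) i))\<^sup>2)" for \<omega>
  have [measurable]: "Q \<in> borel_measurable (sample N n)" unfolding Q_def by measurable
  have Q0: "0 \<le> Q \<omega>" for \<omega> unfolding Q_def by (intro mult_nonneg_nonneg sum_nonneg) auto
  have iQ: "integrable (sample N n) Q"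
    unfolding Q_def by (intro integrable_mult_right Bochner_Integration.integrable_sum integrable_square_increment)
  have "(\<integral>\<omega>. Q \<omega> \<partial>sample N n) = real p * (\<Sum>i<k * p. (\<integral>\<omega>. (normalized_sum Y n \<omega> (grid T (k * p) (Suc i)) - normalized_sum Y n \<omega> (grid T (k * p) i))\<^sup>2 \<partial>sample N n))"
    unfolding Q_def by (simp add: integrable_square_increment Bochner_Integration.integral_sum)
  also have "\<dots> \<le> real p * (\<Sum>i<k * p. 4 * (T / real (k * p))\<^sup>2)"
  proof (intro mult_left_mono sum_mono)
    fix i
    have "grid T (k * p) (Suc i) - grid T (k * p) i = T / real (k * p)"
      by (simp add: grid_def diff_divide_distrib[symmetric] algebra_simps)
    then show "(\<integral>\<omega>. (normalized_sum Y n \<omega> (grid T (k * p) (Suc i)) - normalized_sum Y n \<omega> (grid T (k * p) i))\<^sup>2 \<partial>sample N n) \<le> 4 * (T / real (k * p))\<^sup>2"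
      using square_increment[OF n, of "grid T (k * p) (Suc i)" "grid T (k * p) i"] by simp
  qed simp
  also have "\<dots> = 4 * T\<^sup>2 / real k" using k p by (simp add: power2_eq_square field_simps)
  finally have EQ: "(\<integral>\<omega>. Q \<omega> \<partial>sample N n) \<le> 4 * T\<^sup>2 / real k" .
  show ?thesis
  proof (rule that[of "{\<omega> \<in> space (sample N n). Q \<omega> \<le> \<eta>\<^sup>2}"])
    have "1 - 4 * T\<^sup>2 / real k / \<eta>\<^sup>2 \<le> measure (sample N n) {\<omega> \<in> space (sample N n). Q \<omega> \<le> \<eta>\<^sup>2}"
      using Q0 \<eta> by (intro S.markov_complement[OF _ iQ _ EQ]) simp_all
    then show "1 - 4 * T\<^sup>2 / (real k * \<eta>\<^sup>2) \<le> measure (sample N n) {\<omega> \<in> space (sample N n). Q \<omega> \<le> \<eta>\<^sup>2}" by simp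
    show "\<bar>normalized_sum Y n \<omega> t - normalized_sum Y n \<omega> (grid T k j)\<bar> \<le> 2 * \<eta>"
      if "\<omega> \<in> {\<omega> \<in> space (sample N n). Q \<omega> \<le> \<eta>\<^sup>2}" "j < k" "grid T k j \<le> t" "t \<le> grid T k (Suc j)" for \<omega> j t
      using that by (intro lip_path_modulus[OF normalized_sum_lip_path T_pos k p fine]) (auto simp: Q_def)
  qed measurable
qed

end

definition cov_gap :: "real \<Rightarrow> nat \<Rightarrow> 'a measure \<Rightarrow> ('a \<Rightarrow> real \<Rightarrow> real) \<Rightarrow> 'b measure \<Rightarrow> ('b \<Rightarrow> real \<Rightarrow> real) \<Rightarrow> real" where
  "cov_gap T k N Y N' Y' = (\<Sum>i\<le>k. \<Sum>j\<le>k. \<bar>path_cov N Y (grid T k i) (grid T k j) - path_cov N' Y' (grid T k i) (grid T k j)\<bar>)"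

lemma cov_gap_commute: "cov_gap T k N Y N' Y' = cov_gap T k N' Y' N Y"
  by (simp add: cov_gap_def abs_minus_commute)

text \<open>The precision demanded of each of the \<open>(k + 1)\<^sup>2\<close> covariances for a total error \<open>e\<close>; it has \<open>K + 1\<close>
in place of \<open>K\<close> so that \<open>K = 0\<close> is harmless.\<close>

lemma cov_gap_le:
  assumes K: "0 \<le> K" and e: "0 \<le> e"
    and cov: "\<And>i j. i \<le> k \<Longrightarrow> j \<le> k \<Longrightarrow>
      \<bar>path_cov N Y (grid T k i) (grid T k j) - path_cov N' Y' (grid T k i) (grid T k j)\<bar> \<le> e / (K + 1) / (real k + 1)\<^sup>2"
  shows "K * cov_gap T k N Y N' Y' \<le> e"
proof -
  have "cov_gap T k N Y N' Y' \<le> (\<Sum>i\<le>k. \<Sum>j\<le>k. e / (K + 1) / (real k + 1)\<^sup>2)"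
    unfolding cov_gap_def using cov by (intro sum_mono) auto
  also have "\<dots> = (real k + 1)\<^sup>2 * (e / (K + 1) / (real k + 1)\<^sup>2)" by (simp add: power2_eq_square algebra_simps)
  also have "\<dots> = e / (K + 1)" using K by simp
  finally have "K * cov_gap T k N Y N' Y' \<le> K * (e / (K + 1))" using K by (intro mult_left_mono)
  also have "\<dots> \<le> e" using K e by (simp add: divide_le_eq algebra_simps)
  finally show ?thesis .
qed

text \<open>The smooth bump lies between the indicators of two boxes, so its expectation is at least the
distribution function of the first law at \<open>r\<close> and at most the probability that the second sum is
bounded by \<open>r + 3 \<eta>\<close> on the grid; the modulus of continuity, which costs another \<open>2 \<eta>\<close>, passes from the
grid to all \<open>t\<close>.\<close>

lemma sup_cdf_transfer:
  assumes N: "path_law N Y T C" and N': "path_law N' Y' T C'"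
    and n: "0 < n" and k: "0 < k" and \<eta>: "0 < \<eta>"
    and K: "smooth3 {..k} K (bump {..k} \<eta> r)"
    and B: "C * T \<le> B" "C' * T \<le> B" "B \<le> sqrt (real n)"
  shows "sup_cdf N Y n r \<le> sup_cdf N' Y' n (r + 5 * \<eta>) + 4 * T\<^sup>2 / (real k * \<eta>\<^sup>2)
    + K * cov_gap T k N Y N' Y'
    + 2 * K * B ^ 3 / sqrt (real n)"
proof -
  interpret N: path_law N Y T C by fact
  interpret N': path_law N' Y' T C' by fact
  interpret S: prob_space "sample N n" by (rule N.prob_space_sample)
  interpret S': prob_space "sample N' n" by (rule N'.prob_space_sample)
  define u where "u v j = Y v (grid T k j) / sqrt (real n)" for v j
  define u' where "u' v j = Y' v (grid T k j) / sqrt (real n)" for v j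
  define d where "d = B / sqrt (real n)"
  have B0: "0 \<le> B" using B(1) N.C_nonneg N.T_pos by (meson less_imp_le mult_nonneg_nonneg order_trans)
  have d: "0 \<le> d" "d \<le> 1" using B0 B(3) n by (auto simp: d_def divide_le_eq)
  have K0: "0 \<le> K" using smooth3D(1)[OF K, of undefined] by linarith
  have su: "(\<Sum>i<n. u (\<omega> i) j) = normalized_sum Y n \<omega> (grid T k j)" for \<omega> j
    by (simp add: u_def normalized_sum_def sum_divide_distrib)
  have su': "(\<Sum>i<n. u' (\<omega> i) j) = normalized_sum Y' n \<omega> (grid T k j)" for \<omega> j
    by (simp add: u'_def normalized_sum_def sum_divide_distrib)
  let ?f = "bump {..k} \<eta> r"
  have cu: "(\<integral>v. u v i * u v j \<partial>N) = path_cov N Y (grid T k i) (grid T k j) / real n" for i j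
    by (simp add: u_def path_cov_def)
  have cu': "(\<integral>v. u' v i * u' v j \<partial>N') = path_cov N' Y' (grid T k i) (grid T k j) / real n" for i j
    by (simp add: u'_def path_cov_def)
  have "\<bar>(\<integral>\<omega>. ?f (\<lambda>j. \<Sum>i<n. u (\<omega> i) j) \<partial>sample N n) - (\<integral>\<omega>. ?f (\<lambda>j. \<Sum>i<n. u' (\<omega> i) j) \<partial>sample N' n)\<bar>
    \<le> real n * (K * (\<Sum>i\<in>{..k}. \<Sum>j\<in>{..k}. \<bar>(\<integral>v. u v i * u v j \<partial>N) - (\<integral>v. u' v i * u' v j \<partial>N')\<bar>) + 2 * (K * d ^ 3))"
  proof (rule lindeberg_comparison[OF N.prob_space_axioms _ N'.prob_space_axioms _ _ K bump_measurable])
    show "\<bar>u v j\<bar> \<le> d" if "v \<in> space N" for v j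
      using N.path_bound[OF that, of "grid T k j"] B(1) n by (auto simp: u_def d_def intro: divide_right_mono)
    show "\<bar>u' v j\<bar> \<le> d" if "v \<in> space N'" for v j
      using N'.path_bound[OF that, of "grid T k j"] B(2) n by (auto simp: u'_def d_def intro: divide_right_mono)
  qed (auto simp: u_def u'_def N.centered N'.centered d)
  also have "\<dots> = K * cov_gap T k N Y N' Y' + 2 * K * (real n * d ^ 3)"
    unfolding cu cu' cov_gap_def using n by (simp add: diff_divide_distrib[symmetric] sum_divide_distrib[symmetric] algebra_simps)
  also have "real n * d ^ 3 = B ^ 3 / sqrt (real n)"
    using n by (simp add: d_def power3_eq_cube field_simps)
  finally have lind: "\<bar>(\<integral>\<omega>. ?f (\<lambda>j. normalized_sum Y n \<omega> (grid T k j)) \<partial>sample N n) - (\<integral>\<omega>. ?f (\<lambda>j. normalized_sum Y' n \<omega> (grid T k j)) \<partial>sample N' n)\<bar>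
    \<le> K * cov_gap T k N Y N' Y' + 2 * K * (B ^ 3 / sqrt (real n))"
    unfolding su su' .
  have mf: "(\<lambda>\<omega>. ?f (\<lambda>j. normalized_sum Y n \<omega> (grid T k j))) \<in> borel_measurable (sample N n)"
    by (rule measurable_compose[OF measurable_coordinatewise_then_product bump_measurable]) measurable
  have mf': "(\<lambda>\<omega>. ?f (\<lambda>j. normalized_sum Y' n \<omega> (grid T k j))) \<in> borel_measurable (sample N' n)"
    by (rule measurable_compose[OF measurable_coordinatewise_then_product bump_measurable]) measurable
  have b1: "\<bar>?f x\<bar> \<le> 1" for x using bump_range[of "{..k}" \<eta> r x] by simp
  have "sup_cdf N Y n r = (\<integral>\<omega>. indicator {\<omega> \<in> space (sample N n). \<forall>t. \<bar>normalized_sum Y n \<omega> t\<bar> \<le> r} \<omega> \<partial>sample N n)"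
    unfolding sup_cdf_def by simp
  also have "\<dots> \<le> (\<integral>\<omega>. ?f (\<lambda>j. normalized_sum Y n \<omega> (grid T k j)) \<partial>sample N n)"
  proof (intro integral_mono)
    show "integrable (sample N n) (\<lambda>\<omega>. ?f (\<lambda>j. normalized_sum Y n \<omega> (grid T k j)))"
      using mf b1 by (intro S.integrable_bounded)
    show "indicator {\<omega> \<in> space (sample N n). \<forall>t. \<bar>normalized_sum Y n \<omega> t\<bar> \<le> r} \<omega> \<le> ?f (\<lambda>j. normalized_sum Y n \<omega> (grid T k j))" for \<omega>
      using bump_range[of "{..k}" \<eta> r] bump_1[OF \<eta>, of "{..k}" "\<lambda>j. normalized_sum Y n \<omega> (grid T k j)" r]
      by (auto simp: indicator_def)
  qed (intro integrable_real_indicator; simp add: S.emeasure_finite less_top[symmetric])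
  finally have 1: "sup_cdf N Y n r \<le> (\<integral>\<omega>. ?f (\<lambda>j. normalized_sum Y n \<omega> (grid T k j)) \<partial>sample N n)" .
  define G where "G = {\<omega> \<in> space (sample N' n). \<forall>j\<le>k. \<bar>normalized_sum Y' n \<omega> (grid T k j)\<bar> \<le> r + 3 * \<eta>}"
  have [measurable]: "G \<in> sets (sample N' n)" unfolding G_def by measurable
  have "(\<integral>\<omega>. ?f (\<lambda>j. normalized_sum Y' n \<omega> (grid T k j)) \<partial>sample N' n) \<le> (\<integral>\<omega>. indicator G \<omega> \<partial>sample N' n)"
  proof (intro integral_mono)
    show "integrable (sample N' n) (\<lambda>\<omega>. ?f (\<lambda>j. normalized_sum Y' n \<omega> (grid T k j)))"
      using mf' b1 by (intro S'.integrable_bounded)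
    show "?f (\<lambda>j. normalized_sum Y' n \<omega> (grid T k j)) \<le> indicator G \<omega>" if sp: "\<omega> \<in> space (sample N' n)" for \<omega>
    proof (cases "\<omega> \<in> G")
      case False
      then obtain j where "j \<le> k" "\<not> \<bar>normalized_sum Y' n \<omega> (grid T k j)\<bar> \<le> r + 3 * \<eta>"
        using sp by (auto simp: G_def)
      then have "?f (\<lambda>j. normalized_sum Y' n \<omega> (grid T k j)) = 0"
        using bump_nonzeroD[of "{..k}" \<eta> r "\<lambda>j. normalized_sum Y' n \<omega> (grid T k j)" j] \<eta> by auto
      then show ?thesis by simp
    qed (use bump_range in auto)
  qed (intro integrable_real_indicator; simp add: S'.emeasure_finite less_top[symmetric])
  then have 2: "(\<integral>\<omega>. ?f (\<lambda>j. normalized_sum Y' n \<omega> (grid T k j)) \<partial>sample N' n) \<le> measure (sample N' n) G"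
    by simp
  obtain E where E[measurable]: "E \<in> sets (sample N' n)" and pE: "measure (sample N' n) E \<ge> 1 - 4 * T\<^sup>2 / (real k * \<eta>\<^sup>2)"
    and Em: "\<And>\<omega> j t. \<omega> \<in> E \<Longrightarrow> j < k \<Longrightarrow> grid T k j \<le> t \<Longrightarrow> t \<le> grid T k (Suc j) \<Longrightarrow>
      \<bar>normalized_sum Y' n \<omega> t - normalized_sum Y' n \<omega> (grid T k j)\<bar> \<le> 2 * \<eta>"
    using N'.modulus_event[OF n k \<eta>] by blast
  let ?H = "{\<omega> \<in> space (sample N' n). \<forall>t. \<bar>normalized_sum Y' n \<omega> t\<bar> \<le> r + 5 * \<eta>}"
  have "G \<inter> E \<subseteq> ?H"
  proof
    fix \<omega> assume \<omega>: "\<omega> \<in> G \<inter> E"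
    then have sp: "\<omega> \<in> space (sample N' n)" by (simp add: G_def)
    note lp = N'.normalized_sum_lip_path[OF sp]
    have "\<bar>normalized_sum Y' n \<omega> t\<bar> \<le> r + 5 * \<eta>" for t
    proof (cases "0 \<le> t \<and> t < T")
      case True
      then obtain j where j: "j < k" "grid T k j \<le> t" "t \<le> grid T k (Suc j)"
        using grid_cell[OF N.T_pos k] by blast
      then have "\<bar>normalized_sum Y' n \<omega> (grid T k j)\<bar> \<le> r + 3 * \<eta>" using \<omega> by (auto simp: G_def)
      then show ?thesis using Em[of \<omega> j t] \<omega> j by auto
    next
      case False
      then have "normalized_sum Y' n \<omega> t = 0" using lip_pathD(2,3)[OF lp, of t] by auto
      moreover have "\<bar>normalized_sum Y' n \<omega> (grid T k 0)\<bar> \<le> r + 3 * \<eta>" using \<omega> by (auto simp: G_def)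
      ultimately show ?thesis using \<eta> by simp
    qed
    then show "\<omega> \<in> ?H" using sp by auto
  qed
  then have "measure (sample N' n) G \<le> measure (sample N' n) (?H \<union> (space (sample N' n) - E))"
    by (intro S'.finite_measure_mono) (auto simp: G_def)
  also have "\<dots> \<le> measure (sample N' n) ?H + measure (sample N' n) (space (sample N' n) - E)"
    by (intro measure_Un_le) auto
  also have "\<dots> \<le> sup_cdf N' Y' n (r + 5 * \<eta>) + 4 * T\<^sup>2 / (real k * \<eta>\<^sup>2)"
    using pE by (simp add: sup_cdf_def S'.prob_compl)
  finally show ?thesis
    using 1 2 lind by simp
qed

section \<open>The midpoint Prekopa-Leindler inequality\<close>

text \<open>Half the sum of the sets contains a half-size copy of \<open>K\<close> that ends at the point where a half-size
copy of \<open>L\<close> begins: add the least element of \<open>L\<close> to \<open>K\<close>, and the greatest element of \<open>K\<close> to \<open>L\<close>.\<close>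

lemma brunn_minkowski_midpoint_compact:
  fixes K L C :: "real set"
  assumes K: "compact K" "K \<noteq> {}" and L: "compact L" "L \<noteq> {}" and C: "C \<in> lmeasurable"
    and mid: "\<And>x y. x \<in> K \<Longrightarrow> y \<in> L \<Longrightarrow> (x + y) / 2 \<in> C"
  shows "measure lebesgue K + measure lebesgue L \<le> 2 * measure lebesgue C"
proof -
  define b where "b = Sup K"
  define a where "a = Inf L"
  have b: "b \<in> K" "\<And>x. x \<in> K \<Longrightarrow> x \<le> b"
    using K by (auto simp: b_def compact_imp_bounded bounded_imp_bdd_above compact_imp_closed intro!: closed_contains_Sup cSup_upper)
  have a: "a \<in> L" "\<And>x. x \<in> L \<Longrightarrow> a \<le> x"
    using L by (auto simp: a_def compact_imp_bounded bounded_imp_bdd_below compact_imp_closed intro!: closed_contains_Inf cInf_lower)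
  \<comment> \<open>These half-size copies of \<open>K\<close> and \<open>L\<close> meet at most in the point \<open>(a + b) / 2\<close>.\<close>
  define C1 where "C1 = (\<lambda>x. (1/2) *\<^sub>R x + a/2) ` K"
  define C2 where "C2 = (\<lambda>x. (1/2) *\<^sub>R x + b/2) ` L"
  have comp: "compact C1" "compact C2"
    unfolding C1_def C2_def using K L by (auto intro!: compact_continuous_image continuous_intros)
  then have m: "C1 \<in> lmeasurable" "C2 \<in> lmeasurable" by (auto intro: lmeasurable_compact)
  have m1: "measure lebesgue C1 = measure lebesgue K / 2"
    unfolding C1_def using measure_lebesgue_affine[of "1/2" "a/2" K] by simp
  have m2: "measure lebesgue C2 = measure lebesgue L / 2"
    unfolding C2_def using measure_lebesgue_affine[of "1/2" "b/2" L] by simp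
  have sub: "C1 \<union> C2 \<subseteq> C"
  proof
    fix z assume "z \<in> C1 \<union> C2"
    then consider x where "x \<in> K" "z = (x + a) / 2" | y where "y \<in> L" "z = (b + y) / 2"
      by (auto simp: C1_def C2_def add_divide_distrib)
    then show "z \<in> C" using mid a(1) b(1) by metis
  qed
  have "C1 \<inter> C2 \<subseteq> {(a + b) / 2}"
  proof
    fix z assume "z \<in> C1 \<inter> C2"
    then obtain x y where "x \<in> K" "z = x / 2 + a / 2" "y \<in> L" "z = y / 2 + b / 2"
      by (auto simp: C1_def C2_def)
    with a(2)[of y] b(2)[of x] show "z \<in> {(a + b) / 2}" by (simp add: field_simps)
  qed
  then have "negligible (C1 \<inter> C2)"
    by (metis negligible_sing negligible_subset)
  then have "measure lebesgue (C1 \<union> C2) = measure lebesgue C1 + measure lebesgue C2"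
    using m by (simp add: measure_Un3 negligible_imp_measure0)
  moreover have "measure lebesgue (C1 \<union> C2) \<le> measure lebesgue C"
    using sub m C by (intro measure_mono_fmeasurable) (auto intro: fmeasurableD)
  ultimately show ?thesis using m1 m2 by simp
qed

lemma lebesgue_inner_compact:
  fixes A :: "real set"
  assumes A: "A \<in> lmeasurable" "bounded A" "A \<noteq> {}" and "e > 0"
  obtains K where "compact K" "K \<noteq> {}" "K \<subseteq> A" "measure lebesgue A \<le> measure lebesgue K + e"
proof -
  obtain T where T: "closed T" "T \<subseteq> A" "A - T \<in> lmeasurable" "measure lebesgue (A - T) < e"
    using sets_lebesgue_inner_closed[OF fmeasurableD[OF A(1)] \<open>e > 0\<close>]
    by (metis emeasure_eq_measure2 ennreal_less_iff fmeasurableD measure_nonneg)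
  obtain x where x: "x \<in> A" using A by auto
  have cT: "compact T" using T A(2) by (simp add: bounded_subset compact_eq_bounded_closed)
  have "measure lebesgue A = measure lebesgue T + measure lebesgue (A - T)"
    using measurable_measure_Diff[OF A(1) fmeasurableD[OF lmeasurable_compact[OF cT]] T(2)] by linarith
  moreover have "measure lebesgue T \<le> measure lebesgue (insert x T)"
    using cT by (intro measure_mono_fmeasurable) (auto intro: fmeasurableD lmeasurable_compact)
  ultimately show ?thesis
    using that[of "insert x T"] T(2,4) x cT by (simp add: compact_insert)
qed

lemma brunn_minkowski_midpoint:
  fixes A B C :: "real set"
  assumes A: "A \<in> lmeasurable" "bounded A" "A \<noteq> {}" and B: "B \<in> lmeasurable" "bounded B" "B \<noteq> {}"
    and C: "C \<in> lmeasurable" and mid: "\<And>x y. x \<in> A \<Longrightarrow> y \<in> B \<Longrightarrow> (x + y) / 2 \<in> C"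
  shows "measure lebesgue A + measure lebesgue B \<le> 2 * measure lebesgue C"
proof (rule field_le_epsilon)
  fix e :: real assume e: "e > 0"
  obtain K where K: "compact K" "K \<noteq> {}" "K \<subseteq> A" "measure lebesgue A \<le> measure lebesgue K + e/2"
    using lebesgue_inner_compact[OF A, of "e/2"] e by auto
  obtain L where L: "compact L" "L \<noteq> {}" "L \<subseteq> B" "measure lebesgue B \<le> measure lebesgue L + e/2"
    using lebesgue_inner_compact[OF B, of "e/2"] e by auto
  have "measure lebesgue K + measure lebesgue L \<le> 2 * measure lebesgue C"
    using K L mid by (intro brunn_minkowski_midpoint_compact C) auto
  then show "measure lebesgue A + measure lebesgue B \<le> 2 * measure lebesgue C + e"
    using K L by linarith
qed

text \<open>Integrate \<open>min s (h x)\<close> as the length of the interval of levels below it, and exchange the integrals.\<close>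

lemma layer_cake_truncated:
  fixes h :: "real \<Rightarrow> real"
  assumes [measurable]: "h \<in> borel_measurable borel" and h: "\<And>x. 0 \<le> h x" and s: "s > 0"
  shows "(\<integral>\<^sup>+x. ennreal (min s (h x)) \<partial>lborel) =
    ennreal s * (\<integral>\<^sup>+t. emeasure lborel {x. t * s < h x} * indicator {0<..<1} t \<partial>lborel)"
proof -
  have inner: "(\<integral>\<^sup>+t. indicator {0<..<1} t * indicator {x. t * s < h x} x \<partial>lborel) = ennreal (min s (h x) / s)" for x
  proof -
    have "(\<integral>\<^sup>+t. indicator {0<..<1} t * indicator {x. t * s < h x} x \<partial>lborel)
        = (\<integral>\<^sup>+t. indicator {0<..<min 1 (h x / s)} t \<partial>lborel)"
      using s by (intro nn_integral_cong) (auto simp: indicator_def field_simps)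
    also have "\<dots> = ennreal (min 1 (h x / s))"
      using h[of x] s by simp
    also have "min 1 (h x / s) = min s (h x) / s"
      using s by (auto simp: min_def field_simps)
    finally show ?thesis .
  qed
  have "(\<integral>\<^sup>+x. ennreal (min s (h x)) \<partial>lborel) = (\<integral>\<^sup>+x. ennreal s * ennreal (min s (h x) / s) \<partial>lborel)"
    using s h by (intro nn_integral_cong) (simp add: ennreal_mult'[symmetric])
  also have "\<dots> = ennreal s * (\<integral>\<^sup>+x. ennreal (min s (h x) / s) \<partial>lborel)"
    by (intro nn_integral_cmult) measurable
  also have "(\<integral>\<^sup>+x. ennreal (min s (h x) / s) \<partial>lborel) =
      (\<integral>\<^sup>+x. (\<integral>\<^sup>+t. indicator {0<..<1} t * indicator {x. t * s < h x} x \<partial>lborel) \<partial>lborel)"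
    by (simp add: inner)
  also have "\<dots> = (\<integral>\<^sup>+t. (\<integral>\<^sup>+x. indicator {0<..<1} t * indicator {x. t * s < h x} x \<partial>lborel) \<partial>lborel)"
    by (intro lborel_pair.Fubini') measurable
  also have "\<dots> = (\<integral>\<^sup>+t. emeasure lborel {x. t * s < h x} * indicator {0<..<1} t \<partial>lborel)"
  proof (intro nn_integral_cong)
    fix t :: real
    have [measurable]: "{x. t * s < h x} \<in> sets lborel" by measurable
    show "(\<integral>\<^sup>+x. indicator {0<..<1} t * indicator {x. t * s < h x} x \<partial>lborel)
        = emeasure lborel {x. t * s < h x} * indicator {0<..<1} t"
      by (simp add: nn_integral_cmult mult.commute)
  qed
  finally show ?thesis .
qed

lemma brunn_minkowski_midpoint_superlevel:
  fixes f g h :: "real \<Rightarrow> real"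
  assumes [measurable]: "f \<in> borel_measurable borel" "g \<in> borel_measurable borel" "h \<in> borel_measurable borel"
    and supp: "\<And>x. \<bar>x\<bar> > R \<Longrightarrow> f x = 0 \<and> g x = 0 \<and> h x = 0"
    and nn: "0 \<le> a" "0 \<le> b" "0 \<le> c"
    and ne: "\<exists>x. f x > a" "\<exists>x. g x > b"
    and mid: "\<And>x y. f x > a \<Longrightarrow> g y > b \<Longrightarrow> h ((x + y) / 2) > c"
  shows "emeasure lborel {x. a < f x} + emeasure lborel {x. b < g x} \<le> 2 * emeasure lborel {x. c < h x}"
proof -
  have sub: "{x. u < k x} \<subseteq> {-R..R}" if "0 \<le> u" "k \<in> {f, g, h}" for u k
  proof
    fix x assume "x \<in> {x. u < k x}"
    then have "\<not> \<bar>x\<bar> > R" using supp[of x] that by auto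
    then show "x \<in> {-R..R}" by auto
  qed
  have lm: "{x. u < k x} \<in> lmeasurable" "bounded {x. u < k x}" if "0 \<le> u" "k \<in> {f, g, h}" for u k
  proof -
    have [measurable]: "k \<in> borel_measurable borel" using that by auto
    have "{x. u < k x} \<in> sets lebesgue" by (intro sets_completionI_sets) (simp, measurable)
    moreover show "bounded {x. u < k x}"
      by (rule bounded_subset[OF bounded_closed_interval sub[OF that]])
    ultimately show "{x. u < k x} \<in> lmeasurable"
      by (intro bounded_set_imp_lmeasurable)
  qed
  have eq: "emeasure lborel {x. u < k x} = ennreal (measure lebesgue {x. u < k x})"
    if "0 \<le> u" "k \<in> {f, g, h}" for u k
  proof -
    have [measurable]: "k \<in> borel_measurable borel" using that by auto
    have "{x. u < k x} \<in> sets lborel" by (simp, measurable)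
    then have "emeasure lborel {x. u < k x} = emeasure lebesgue {x. u < k x}" by simp
    also have "\<dots> = ennreal (measure lebesgue {x. u < k x})"
      using lm[OF that] by (simp add: emeasure_eq_measure2)
    finally show ?thesis .
  qed
  have "measure lebesgue {x. a < f x} + measure lebesgue {x. b < g x} \<le> 2 * measure lebesgue {x. c < h x}"
    using ne mid by (intro brunn_minkowski_midpoint lm nn) auto
  then have "ennreal (measure lebesgue {x. a < f x} + measure lebesgue {x. b < g x})
      \<le> ennreal (2 * measure lebesgue {x. c < h x})"
    by (intro ennreal_leI)
  then show ?thesis
    by (simp add: eq nn ennreal_plus ennreal_mult')
qed

text \<open>Normalize \<open>f\<close> and \<open>g\<close> by their suprema \<open>a\<close> and \<open>b\<close>, and \<open>h\<close> by \<open>sqrt (a b)\<close>. Then for every level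
\<open>t < 1\<close> the superlevel sets of \<open>f\<close> and \<open>g\<close> are nonempty and their midpoints belong to the superlevel
set of \<open>h\<close>, so the one-dimensional Brunn-Minkowski inequality compares their lengths. Integrating over
the levels gives a comparison with the arithmetic mean, which is stronger than the geometric mean.\<close>

lemma prekopa_leindler_1d:
  fixes f g h :: "real \<Rightarrow> real"
  assumes meas[measurable]: "f \<in> borel_measurable borel" "g \<in> borel_measurable borel" "h \<in> borel_measurable borel"
    and supp: "\<And>x. \<bar>x\<bar> > R \<Longrightarrow> f x = 0 \<and> g x = 0 \<and> h x = 0"
    and ran: "\<And>x. 0 \<le> f x \<and> f x \<le> 1" "\<And>x. 0 \<le> g x \<and> g x \<le> 1" "\<And>x. 0 \<le> h x \<and> h x \<le> 1"
    and mid: "\<And>x y. f x * g y \<le> (h ((x + y) / 2))\<^sup>2"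
  shows "(\<integral>\<^sup>+x. f x \<partial>lborel) * (\<integral>\<^sup>+x. g x \<partial>lborel) \<le> (\<integral>\<^sup>+x. h x \<partial>lborel)\<^sup>2"
proof (cases "(\<forall>x. f x = 0) \<or> (\<forall>x. g x = 0)")
  case True
  then show ?thesis by auto
next
  case False
  have fin: "(\<integral>\<^sup>+x. k x \<partial>lborel) < \<infinity>" if "k \<in> {f, g, h}" for k
  proof -
    have "(\<integral>\<^sup>+x. k x \<partial>lborel) \<le> (\<integral>\<^sup>+x. indicator {-\<bar>R\<bar>..\<bar>R\<bar>} x \<partial>lborel)"
    proof (intro nn_integral_mono)
      fix x show "ennreal (k x) \<le> indicator {-\<bar>R\<bar>..\<bar>R\<bar>} x"
        using that ran[of x] supp[of x] by (auto simp: indicator_def)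
    qed
    also have "\<dots> < \<infinity>" by simp
    finally show ?thesis .
  qed
  define a where "a = (SUP x. f x)"
  define b where "b = (SUP x. g x)"
  have bdd: "bdd_above (range f)" "bdd_above (range g)" using ran by (auto intro!: bdd_aboveI)
  have le: "f x \<le> a" "g x \<le> b" for x
    using bdd by (auto simp: a_def b_def intro: cSUP_upper)
  obtain x0 y0 where "f x0 \<noteq> 0" "g y0 \<noteq> 0" using False by auto
  then have pos: "a > 0" "b > 0"
    using le[of x0] le[of y0] ran(1)[of x0] ran(2)[of y0] by auto
  define s where "s = sqrt (a * b)"
  have s: "s > 0" "s * s = a * b" using pos by (auto simp: s_def)
  define F where "F = (\<integral>\<^sup>+t. emeasure lborel {x. t * a < f x} * indicator {0<..<1} t \<partial>lborel)"
  define G where "G = (\<integral>\<^sup>+t. emeasure lborel {x. t * b < g x} * indicator {0<..<1} t \<partial>lborel)"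
  define H where "H = (\<integral>\<^sup>+t. emeasure lborel {x. t * s < h x} * indicator {0<..<1} t \<partial>lborel)"
  have lev: "emeasure lborel {x. t * a < f x} + emeasure lborel {x. t * b < g x} \<le> 2 * emeasure lborel {x. t * s < h x}"
    if t: "0 < t" "t < 1" for t
  proof (rule brunn_minkowski_midpoint_superlevel[where R=R])
    show "\<exists>x. f x > t * a" "\<exists>x. g x > t * b"
      using t pos less_cSupD[of "range f" "t * a"] less_cSupD[of "range g" "t * b"]
      by (auto simp: a_def[symmetric] b_def[symmetric])
    fix x y assume xy: "f x > t * a" "g y > t * b"
    have "(t * s)\<^sup>2 = (t * a) * (t * b)" using s by (simp add: power2_eq_square)
    also have "\<dots> < f x * g y" using xy pos t by (intro mult_strict_mono) (auto intro: less_imp_le order_less_trans[rotated])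
    also have "\<dots> \<le> (h ((x + y) / 2))\<^sup>2" by (rule mid)
    finally show "t * s < h ((x + y) / 2)"
      using ran(3)[of "(x + y) / 2"] power2_less_imp_less by blast
  qed (use supp t pos s in \<open>auto intro: mult_nonneg_nonneg\<close>)
  have [measurable]: "(\<lambda>t. emeasure lborel {x. t * u < k x}) \<in> borel_measurable borel"
    if "k \<in> {f, g, h}" for u k
  proof -
    have [measurable]: "k \<in> borel_measurable borel" using that by auto
    have "(\<lambda>t. \<integral>\<^sup>+x. indicator {x. t * u < k x} x \<partial>lborel) \<in> borel_measurable borel" by measurable
    also have "(\<lambda>t. \<integral>\<^sup>+x. indicator {x. t * u < k x} x \<partial>lborel) = (\<lambda>t. emeasure lborel {x. t * u < k x})"
      by (intro ext nn_integral_indicator) (simp, measurable)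
    finally show ?thesis .
  qed
  have "F + G = (\<integral>\<^sup>+t. (emeasure lborel {x. t * a < f x} + emeasure lborel {x. t * b < g x}) * indicator {0<..<1} t \<partial>lborel)"
    unfolding F_def G_def by (subst nn_integral_add[symmetric]) (auto simp: algebra_simps)
  also have "\<dots> \<le> (\<integral>\<^sup>+t. 2 * (emeasure lborel {x. t * s < h x} * indicator {0<..<1} t) \<partial>lborel)"
    using lev by (intro nn_integral_mono) (auto simp: indicator_def)
  also have "\<dots> = 2 * H" unfolding H_def by (intro nn_integral_cmult) auto
  finally have FGH: "F + G \<le> 2 * H" .
  have If: "(\<integral>\<^sup>+x. f x \<partial>lborel) = ennreal a * F"
    using layer_cake_truncated[of f a] ran pos le by (simp add: F_def min_absorb2)
  have Ig: "(\<integral>\<^sup>+x. g x \<partial>lborel) = ennreal b * G"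
    using layer_cake_truncated[of g b] ran pos le by (simp add: G_def min_absorb2)
  have "ennreal s * H = (\<integral>\<^sup>+x. ennreal (min s (h x)) \<partial>lborel)"
    using layer_cake_truncated[of h s] ran s by (simp add: H_def)
  also have "\<dots> \<le> (\<integral>\<^sup>+x. h x \<partial>lborel)"
    by (intro nn_integral_mono ennreal_leI) auto
  finally have Ih: "ennreal s * H \<le> (\<integral>\<^sup>+x. h x \<partial>lborel)" .
  have "ennreal a * F < \<infinity>" "ennreal b * G < \<infinity>"
    using fin[of f] fin[of g] If Ig by auto
  moreover have "ennreal s * H < \<infinity>"
    using Ih fin[of h] by (rule order_le_less_trans) simp
  ultimately have fins: "F < \<infinity>" "G < \<infinity>" "H < \<infinity>" using pos s by (auto simp: ennreal_mult_less_top)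
  then obtain F' G' H' where r: "F = ennreal F'" "G = ennreal G'" "H = ennreal H'" "0 \<le> F'" "0 \<le> G'" "0 \<le> H'"
    by (metis ennreal_cases infinity_ennreal_def less_irrefl)
  have "F' + G' \<le> 2 * H'" using FGH r by (simp flip: ennreal_plus ennreal_numeral ennreal_mult)
  then have "(F' + G')\<^sup>2 \<le> (2 * H')\<^sup>2" using r by (intro power_mono) auto
  moreover have "4 * (F' * G') \<le> (F' + G')\<^sup>2"
    using sum_squares_bound[of F' G'] by (simp add: power2_sum)
  ultimately have "F' * G' \<le> H'\<^sup>2" by (simp add: power_mult_distrib)
  then have "(a * b) * (F' * G') \<le> (s * s) * H'\<^sup>2" unfolding s(2) using pos by (intro mult_left_mono) auto
  then have "ennreal ((a * F') * (b * G')) \<le> ennreal ((s * H')\<^sup>2)"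
    by (intro ennreal_leI) (simp add: power2_eq_square algebra_simps)
  then have "(ennreal a * F) * (ennreal b * G) \<le> (ennreal s * H)\<^sup>2"
    using r pos s by (simp add: ennreal_mult ennreal_power[symmetric] power2_eq_square)
  also have "\<dots> \<le> (\<integral>\<^sup>+x. h x \<partial>lborel)\<^sup>2"
    by (intro power_mono Ih) auto
  finally show ?thesis by (simp add: If Ig)
qed

text \<open>The midpoint form of the Prekopa-Leindler inequality as a property of a measure on a space with a
midpoint operation. Functions with values in \<open>[0, 1]\<close> suffice for probabilities of events, and the integrals
of such functions over one factor of a product are again of this kind, as the induction over products needs.\<close>

definition midpoint_log_concave :: "('a \<Rightarrow> 'a \<Rightarrow> 'a) \<Rightarrow> 'a measure \<Rightarrow> bool" where
  "midpoint_log_concave mid N \<longleftrightarrow> (\<forall>f g h :: 'a \<Rightarrow> ennreal.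
     f \<in> borel_measurable N \<longrightarrow> g \<in> borel_measurable N \<longrightarrow> h \<in> borel_measurable N \<longrightarrow>
     (\<forall>x\<in>space N. f x \<le> 1 \<and> g x \<le> 1 \<and> h x \<le> 1) \<longrightarrow>
     (\<forall>x\<in>space N. \<forall>y\<in>space N. f x * g y \<le> (h (mid x y))\<^sup>2) \<longrightarrow>
     (\<integral>\<^sup>+x. f x \<partial>N) * (\<integral>\<^sup>+x. g x \<partial>N) \<le> (\<integral>\<^sup>+x. h x \<partial>N)\<^sup>2)"

text \<open>The interval is chosen such that the variance is 1.\<close>

definition uniform_unit_var :: "real measure" where
  "uniform_unit_var = uniform_measure lborel {-sqrt 3..sqrt 3}"

lemma midpoint_log_concave_uniform: "midpoint_log_concave (\<lambda>x y. (x + y) / 2) uniform_unit_var"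
  unfolding midpoint_log_concave_def
proof (intro allI impI)
  fix f g h :: "real \<Rightarrow> ennreal"
  assume fgh: "f \<in> borel_measurable uniform_unit_var" "g \<in> borel_measurable uniform_unit_var"
    "h \<in> borel_measurable uniform_unit_var"
    and le: "\<forall>x\<in>space uniform_unit_var. f x \<le> 1 \<and> g x \<le> 1 \<and> h x \<le> 1"
    and mid: "\<forall>x\<in>space uniform_unit_var. \<forall>y\<in>space uniform_unit_var. f x * g y \<le> (h ((x + y) / 2))\<^sup>2"
  have [measurable]: "f \<in> borel_measurable borel" "g \<in> borel_measurable borel" "h \<in> borel_measurable borel"
    using fgh by (auto simp: uniform_unit_var_def measurable_def)
  let ?I = "{-sqrt 3..sqrt 3 :: real}"
  define tr where "tr k x = enn2real (k x * indicator ?I x)" for k :: "real \<Rightarrow> ennreal" and x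
  have tr: "ennreal (tr k x) = k x * indicator ?I x" if "k \<in> {f, g, h}" for k x
  proof -
    have "k x \<le> 1" using le that by (auto simp: uniform_unit_var_def)
    then have "k x * indicator ?I x < \<infinity>"
      by (auto simp: indicator_def intro: order_le_less_trans)
    then show ?thesis by (simp add: tr_def)
  qed
  have [measurable]: "tr k \<in> borel_measurable borel" if "k \<in> {f, g, h}" for k
    using that unfolding tr_def by auto
  have tr1: "0 \<le> tr k x" "tr k x \<le> 1" if "k \<in> {f, g, h}" for k x
  proof -
    show "0 \<le> tr k x" by (simp add: tr_def)
    have "k x \<le> 1" using le that by (auto simp: uniform_unit_var_def)
    then have "ennreal (tr k x) \<le> ennreal 1"
      unfolding tr[OF that] by (auto simp: indicator_def)
    then show "tr k x \<le> 1" by simp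
  qed
  have int: "(\<integral>\<^sup>+x. k x \<partial>uniform_unit_var) = (\<integral>\<^sup>+x. tr k x \<partial>lborel) / ennreal (2 * sqrt 3)" if "k \<in> {f, g, h}" for k
  proof -
    have [measurable]: "k \<in> borel_measurable borel" using that by auto
    show ?thesis
      unfolding uniform_unit_var_def
      by (subst nn_integral_uniform_measure) (auto simp: tr[OF that])
  qed
  have "(\<integral>\<^sup>+x. tr f x \<partial>lborel) * (\<integral>\<^sup>+x. tr g x \<partial>lborel) \<le> (\<integral>\<^sup>+x. tr h x \<partial>lborel)\<^sup>2"
  proof (rule prekopa_leindler_1d[where R="sqrt 3"])
    fix x :: real assume "\<bar>x\<bar> > sqrt 3"
    then show "tr f x = 0 \<and> tr g x = 0 \<and> tr h x = 0" by (auto simp: tr_def indicator_def)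
  next
    fix x y :: real
    have "ennreal (tr f x * tr g y) = (f x * indicator ?I x) * (g y * indicator ?I y)"
      using tr1 by (simp add: ennreal_mult tr)
    also have "\<dots> \<le> (h ((x + y) / 2) * indicator ?I ((x + y) / 2))\<^sup>2"
      using mid by (auto simp: indicator_def uniform_unit_var_def field_simps)
    also have "\<dots> = ennreal ((tr h ((x + y) / 2))\<^sup>2)"
      using tr1 by (simp add: ennreal_power[symmetric] tr)
    finally show "tr f x * tr g y \<le> (tr h ((x + y) / 2))\<^sup>2"
      by simp
  qed (use tr1 in auto)
  then have "(\<integral>\<^sup>+x. tr f x \<partial>lborel) * (\<integral>\<^sup>+x. tr g x \<partial>lborel) * (inverse (ennreal (2 * sqrt 3)))\<^sup>2
    \<le> (\<integral>\<^sup>+x. tr h x \<partial>lborel)\<^sup>2 * (inverse (ennreal (2 * sqrt 3)))\<^sup>2"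
    by (intro mult_right_mono) auto
  then show "(\<integral>\<^sup>+x. f x \<partial>uniform_unit_var) * (\<integral>\<^sup>+x. g x \<partial>uniform_unit_var) \<le> (\<integral>\<^sup>+x. h x \<partial>uniform_unit_var)\<^sup>2"
    by (simp add: int divide_ennreal_def power2_eq_square ac_simps)
qed

text \<open>Tensorization: by the inequality for the added factor, the integrals of the three functions over this
factor satisfy the hypothesis of the inequality for the remaining factors.\<close>

lemma midpoint_log_concave_PiM:
  fixes I :: "'i set" and N :: "'a measure"
  assumes N: "prob_space N" and lc: "midpoint_log_concave mid N" and I: "finite I"
    and cl: "\<And>x y. x \<in> space N \<Longrightarrow> y \<in> space N \<Longrightarrow> mid x y \<in> space N"
  shows "midpoint_log_concave (\<lambda>x y. \<lambda>i\<in>I. mid (x i) (y i)) (PiM I (\<lambda>_. N))"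
  using I
proof induction
  case empty
  interpret product_prob_space "\<lambda>_. N" by (simp add: product_prob_space_def product_prob_space_axioms_def product_sigma_finite_def N prob_space_imp_sigma_finite)
  have "integral\<^sup>N (PiM {} (\<lambda>_. N)) f = f (\<lambda>_. undefined)" for f :: "('i \<Rightarrow> 'a) \<Rightarrow> ennreal"
    by (simp add: PiM_empty nn_integral_count_space_finite)
  then show ?case
    by (auto simp: midpoint_log_concave_def restrict_def space_PiM_empty)
next
  case (insert i I)
  interpret N: prob_space N by fact
  interpret product_prob_space "\<lambda>_. N" by (simp add: product_prob_space_def product_prob_space_axioms_def product_sigma_finite_def N prob_space_imp_sigma_finite)
  show ?case
    unfolding midpoint_log_concave_def
  proof (intro allI impI)
    let ?P = "PiM I (\<lambda>_. N)" and ?Q = "PiM (insert i I) (\<lambda>_. N)"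
    fix f g h :: "_ \<Rightarrow> ennreal"
    assume [measurable]: "f \<in> borel_measurable ?Q" "g \<in> borel_measurable ?Q" "h \<in> borel_measurable ?Q"
      and le: "\<forall>x\<in>space ?Q. f x \<le> 1 \<and> g x \<le> 1 \<and> h x \<le> 1"
      and mid: "\<forall>x\<in>space ?Q. \<forall>y\<in>space ?Q. f x * g y \<le> (h (\<lambda>j\<in>insert i I. mid (x j) (y j)))\<^sup>2"
    have sp: "x(i := y) \<in> space ?Q" if "x \<in> space ?P" "y \<in> space N" for x y
      using that by (auto simp: space_PiM PiE_def extensional_def)
    have upd[measurable]: "(\<lambda>(x, y). x(i := y)) \<in> ?P \<Otimes>\<^sub>M N \<rightarrow>\<^sub>M ?Q"
      by (rule measurable_add_dim)
    have upd'[measurable]: "(\<lambda>y. x(i := y)) \<in> N \<rightarrow>\<^sub>M ?Q" if "x \<in> space ?P" for x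
      using measurable_compose[OF measurable_Pair1'[OF that, of N] upd] by simp
    define J where "J k x = (\<integral>\<^sup>+y. k (x(i := y)) \<partial>N)" for k :: "_ \<Rightarrow> ennreal" and x
    have J[measurable]: "J k \<in> borel_measurable ?P" if [measurable]: "k \<in> borel_measurable ?Q" for k
    proof -
      have "(\<lambda>p. k ((fst p)(i := snd p))) \<in> borel_measurable (?P \<Otimes>\<^sub>M N)"
        using measurable_compose[OF upd that] by (simp add: case_prod_beta)
      then show ?thesis
        unfolding J_def by (intro N.borel_measurable_nn_integral) (simp add: case_prod_beta)
    qed
    have J1: "J k x \<le> 1" if "k \<in> {f, g, h}" "x \<in> space ?P" for k x
    proof -
      have "J k x \<le> (\<integral>\<^sup>+y. 1 \<partial>N)"
        unfolding J_def using that le sp by (intro nn_integral_mono) blast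
      then show ?thesis by (simp add: N.emeasure_space_1)
    qed
    have JJ: "J f x * J g y \<le> (J h (\<lambda>j\<in>I. mid (x j) (y j)))\<^sup>2" if xy: "x \<in> space ?P" "y \<in> space ?P" for x y
    proof -
      have m: "(\<lambda>j\<in>I. mid (x j) (y j)) \<in> space ?P"
        using xy cl by (auto simp: space_PiM PiE_def Pi_def)
      have eq: "(\<lambda>j\<in>insert i I. mid ((x(i := a)) j) ((y(i := b)) j)) = (\<lambda>j\<in>I. mid (x j) (y j))(i := mid a b)" for a b
        using insert.hyps by (auto simp: fun_eq_iff)
      have "f (x(i := a)) * g (y(i := b)) \<le> (h ((\<lambda>j\<in>I. mid (x j) (y j))(i := mid a b)))\<^sup>2"
        if "a \<in> space N" "b \<in> space N" for a b
        using mid sp[OF xy(1) that(1)] sp[OF xy(2) that(2)] by (metis eq)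
      then show ?thesis
        unfolding J_def using lc[unfolded midpoint_log_concave_def, rule_format,
          of "\<lambda>a. f (x(i := a))" "\<lambda>a. g (y(i := a))" "\<lambda>a. h ((\<lambda>j\<in>I. mid (x j) (y j))(i := a))"]
          le sp[OF xy(1)] sp[OF xy(2)] sp[OF m] xy m by simp
    qed
    have "(\<integral>\<^sup>+x. J f x \<partial>?P) * (\<integral>\<^sup>+x. J g x \<partial>?P) \<le> (\<integral>\<^sup>+x. J h x \<partial>?P)\<^sup>2"
      using insert.IH[unfolded midpoint_log_concave_def, rule_format, of "J f" "J g" "J h"] J1 JJ by simp
    then show "(\<integral>\<^sup>+x. f x \<partial>?Q) * (\<integral>\<^sup>+x. g x \<partial>?Q) \<le> (\<integral>\<^sup>+x. h x \<partial>?Q)\<^sup>2"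
      unfolding J_def by (simp add: product_nn_integral_insert insert.hyps)
  qed
qed

lemma prob_space_uniform_unit_var: "prob_space uniform_unit_var"
  unfolding uniform_unit_var_def by (intro prob_space_uniform_measure) auto

lemma distr_uminus_uniform_unit_var: "distr uniform_unit_var uniform_unit_var uminus = uniform_unit_var"
proof (rule measure_eqI)
  fix A assume "A \<in> sets (distr uniform_unit_var uniform_unit_var uminus)"
  then have [measurable]: "A \<in> sets borel" by (simp add: uniform_unit_var_def)
  have [measurable]: "uminus -` A \<in> sets (borel :: real measure)"
    using measurable_sets[OF borel_measurable_uminus[OF measurable_ident_sets[of borel borel]], of A] by simp
  have "emeasure lborel ({-sqrt 3..sqrt 3} \<inter> uminus -` A) = (\<integral>\<^sup>+x. indicator ({-sqrt 3..sqrt 3} \<inter> A) (- x) \<partial>lborel)"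
  proof -
    have "indicator ({-sqrt 3..sqrt 3} \<inter> A) (- x) = (indicator ({-sqrt 3..sqrt 3} \<inter> uminus -` A) x :: ennreal)" for x
      by (auto simp: indicator_def)
    then show ?thesis by simp
  qed
  also have "\<dots> = emeasure lborel ({-sqrt 3..sqrt 3} \<inter> A)"
    using nn_integral_real_affine[of "indicator ({-sqrt 3..sqrt 3} \<inter> A)" "-1" 0] by simp
  finally show "emeasure (distr uniform_unit_var uniform_unit_var uminus) A = emeasure uniform_unit_var A"
    unfolding uniform_unit_var_def
    by (subst emeasure_distr) (auto simp: emeasure_uniform_measure)
qed simp

lemma distr_PiM_componentwise:
  assumes "prob_space N" "finite I" and neg[measurable]: "neg \<in> N \<rightarrow>\<^sub>M N" and "distr N N neg = N"
  shows "distr (PiM I (\<lambda>_. N)) (PiM I (\<lambda>_. N)) (\<lambda>\<omega>. \<lambda>i\<in>I. neg (\<omega> i)) = PiM I (\<lambda>_. N)"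
  using distr_PiM_finite_prob_space'[of I "\<lambda>_. N" "\<lambda>_. N" neg] assms by (simp add: compose_def[abs_def])

section \<open>Log-concave path laws do not concentrate\<close>

text \<open>Log-concavity makes the ratios \<open>F (r - i \<delta>) / F (r - (i + 1) \<delta>)\<close> increase with \<open>i\<close>. The \<open>p\<close> ratios to the left
of \<open>r\<close> multiply to at most \<open>1 / c\<close>, and each of them is at least \<open>q = F (r + \<delta>) / F r\<close>. Hence
\<open>q ^ p \<le> 1 / c\<close>, and Bernoulli's inequality bounds \<open>q - 1\<close>.\<close>

lemma log_concave_increment_bound:
  fixes F :: "real \<Rightarrow> real"
  assumes mono: "\<And>a b. a \<le> b \<Longrightarrow> F a \<le> F b" and le1: "\<And>a. F a \<le> 1"
    and lc: "\<And>a b. F a * F b \<le> (F ((a + b) / 2))\<^sup>2"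
    and c: "0 < c" "c \<le> F (r - real p * \<delta>)" and p: "0 < p" and \<delta>: "0 \<le> \<delta>"
  shows "F (r + \<delta>) - F r \<le> 1 / (real p * c)"
proof -
  have pos: "0 < F (r - real i * \<delta>)" if "i \<le> p" for i
  proof -
    have "c \<le> F (r - real i * \<delta>)"
      using c(2) mono[of "r - real p * \<delta>" "r - real i * \<delta>"] that \<delta> by (simp add: mult_right_mono)
    then show ?thesis using c(1) by simp
  qed
  have F0: "0 < F r" using pos[of 0] by simp
  define q where "q = F (r + \<delta>) / F r"
  have q1: "1 \<le> q" using mono[of r "r + \<delta>"] \<delta> F0 by (simp add: q_def)
  have ratio: "F (r - real (Suc i) * \<delta>) * q \<le> F (r - real i * \<delta>)" if "i < p" for i
    using that
  proof (induction i)
    case 0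
    have "F (r - \<delta>) * F (r + \<delta>) \<le> (F r)\<^sup>2" using lc[of "r - \<delta>" "r + \<delta>"] by simp
    then show ?case using F0 by (simp add: q_def field_simps power2_eq_square)
  next
    case (Suc i)
    let ?a = "F (r - real i * \<delta>)" and ?b = "F (r - real (Suc i) * \<delta>)" and ?c = "F (r - real (Suc (Suc i)) * \<delta>)"
    have b: "0 < ?b" and c': "0 < ?c" using Suc.prems pos[of "Suc i"] pos[of "Suc (Suc i)"] by simp_all
    have IH: "?b * q \<le> ?a" using Suc by simp
    have "(r - real i * \<delta> + (r - real (Suc (Suc i)) * \<delta>)) / 2 = r - real (Suc i) * \<delta>" by (simp add: field_simps)
    then have "?a * ?c \<le> ?b\<^sup>2" using lc[of "r - real i * \<delta>" "r - real (Suc (Suc i)) * \<delta>"] by (simp only:)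
    moreover have "(?b * q) * ?c \<le> ?a * ?c" using IH c' by (intro mult_right_mono) auto
    ultimately have "?b * (?c * q) \<le> ?b * ?b" by (simp add: power2_eq_square mult_ac)
    then show ?case using b by simp
  qed
  have "F (r - real i * \<delta>) * q ^ i \<le> F r" if "i \<le> p" for i
    using that
  proof (induction i)
    case (Suc i)
    have "F (r - real (Suc i) * \<delta>) * q ^ Suc i = (F (r - real (Suc i) * \<delta>) * q) * q ^ i" by simp
    also have "\<dots> \<le> F (r - real i * \<delta>) * q ^ i" using ratio[of i] Suc.prems q1 by (intro mult_right_mono) auto
    also have "\<dots> \<le> F r" using Suc by simp
    finally show ?case .
  qed simp
  from this[of p] have "F (r - real p * \<delta>) * q ^ p \<le> 1" using le1[of r] by simp
  then have "c * q ^ p \<le> 1" using c(2) q1 by (meson mult_right_mono order_trans zero_le_power order.trans zero_le_one)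
  moreover have "1 + real p * (q - 1) \<le> q ^ p" using Bernoulli_inequality[of "q - 1" p] q1 by simp
  ultimately have "c * (1 + real p * (q - 1)) \<le> 1" using c(1) by (meson mult_left_mono less_imp_le order_trans)
  then have "c * (real p * (q - 1)) \<le> 1" using c(1) by (simp add: distrib_left)
  then have "q - 1 \<le> 1 / (real p * c)" using c(1) p by (simp add: field_simps)
  moreover have "F (r + \<delta>) - F r = F r * (q - 1)" using F0 by (simp add: q_def field_simps)
  moreover have "F r * (q - 1) \<le> 1 * (q - 1)" using le1 q1 by (intro mult_right_mono) auto
  ultimately show ?thesis by simp
qed

text \<open>The path depends on the sample point linearly, as far as midpoints and sign changes are concerned, so
that sublevel sets of the supremum behave like symmetric convex sets.\<close>

locale log_concave_path_law = path_law N Y T C for N :: "'a measure" and Y :: "'a \<Rightarrow> real \<Rightarrow> real" and T C +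
  fixes mid :: "'a \<Rightarrow> 'a \<Rightarrow> 'a" and neg :: "'a \<Rightarrow> 'a"
  assumes log_concave: "midpoint_log_concave mid N"
    and mid_closed: "v \<in> space N \<Longrightarrow> w \<in> space N \<Longrightarrow> mid v w \<in> space N"
    and path_mid: "v \<in> space N \<Longrightarrow> w \<in> space N \<Longrightarrow> Y (mid v w) t = (Y v t + Y w t) / 2"
    and neg_measurable[measurable]: "neg \<in> N \<rightarrow>\<^sub>M N"
    and neg_invariant: "distr N N neg = N"
    and path_neg: "v \<in> space N \<Longrightarrow> Y (neg v) t = - Y v t"
begin

definition sample_mid :: "nat \<Rightarrow> (nat \<Rightarrow> 'a) \<Rightarrow> (nat \<Rightarrow> 'a) \<Rightarrow> nat \<Rightarrow> 'a" where
  "sample_mid n x y = (\<lambda>i\<in>{..<n}. mid (x i) (y i))"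

definition sample_neg :: "nat \<Rightarrow> (nat \<Rightarrow> 'a) \<Rightarrow> nat \<Rightarrow> 'a" where
  "sample_neg n x = (\<lambda>i\<in>{..<n}. neg (x i))"

lemma normalized_sum_mid:
  assumes "x \<in> space (sample N n)" "y \<in> space (sample N n)"
  shows "normalized_sum Y n (sample_mid n x y) t = (normalized_sum Y n x t + normalized_sum Y n y t) / 2"
proof -
  have "(\<Sum>i<n. Y (sample_mid n x y i) t) = (\<Sum>i<n. (Y (x i) t + Y (y i) t) / 2)"
    using assms by (intro sum.cong) (auto simp: sample_mid_def space_PiM PiE_def Pi_def path_mid)
  also have "\<dots> = ((\<Sum>i<n. Y (x i) t) + (\<Sum>i<n. Y (y i) t)) / 2"
    by (simp add: sum_divide_distrib[symmetric] sum.distrib)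
  finally show ?thesis by (simp add: normalized_sum_def add_divide_distrib)
qed

lemma normalized_sum_neg:
  assumes "x \<in> space (sample N n)"
  shows "normalized_sum Y n (sample_neg n x) t = - normalized_sum Y n x t"
proof -
  have "(\<Sum>i<n. Y (sample_neg n x i) t) = (\<Sum>i<n. - Y (x i) t)"
    using assms by (intro sum.cong) (auto simp: sample_neg_def space_PiM PiE_def Pi_def path_neg)
  then show ?thesis by (simp add: normalized_sum_def sum_negf)
qed

lemma sample_midpoint_inequality:
  assumes [measurable]: "A \<in> sets (sample N n)" "B \<in> sets (sample N n)" "D \<in> sets (sample N n)"
    and mid: "\<And>x y. x \<in> A \<Longrightarrow> y \<in> B \<Longrightarrow> x \<in> space (sample N n) \<Longrightarrow> y \<in> space (sample N n) \<Longrightarrow> sample_mid n x y \<in> D"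
  shows "measure (sample N n) A * measure (sample N n) B \<le> (measure (sample N n) D)\<^sup>2"
proof -
  interpret S: prob_space "sample N n" by (rule prob_space_sample)
  have lc: "midpoint_log_concave (sample_mid n) (sample N n)"
    unfolding sample_mid_def[abs_def]
    by (rule midpoint_log_concave_PiM[OF prob_space_axioms log_concave finite_lessThan mid_closed])
  have ind: "indicator A x * indicator B y \<le> (indicator D (sample_mid n x y) :: ennreal)\<^sup>2"
    if "x \<in> space (sample N n)" "y \<in> space (sample N n)" for x y
    using mid[OF _ _ that] by (auto simp: indicator_def)
  have ind1: "indicator Z x \<le> (1 :: ennreal)" for Z and x :: "nat \<Rightarrow> 'a" by (auto simp: indicator_def)
  have "(\<integral>\<^sup>+x. indicator A x \<partial>sample N n) * (\<integral>\<^sup>+x. indicator B x \<partial>sample N n) \<le> (\<integral>\<^sup>+x. indicator D x \<partial>sample N n)\<^sup>2"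
    using lc[unfolded midpoint_log_concave_def, rule_format, of "indicator A" "indicator B" "indicator D"] ind
    by (simp add: ind1)
  then have "ennreal (measure (sample N n) A * measure (sample N n) B) \<le> ennreal ((measure (sample N n) D)\<^sup>2)"
    by (simp add: S.emeasure_eq_measure ennreal_mult ennreal_power)
  then show ?thesis by simp
qed

lemma sup_cdf_log_concave: "sup_cdf N Y n a * sup_cdf N Y n b \<le> (sup_cdf N Y n ((a + b) / 2))\<^sup>2"
  unfolding sup_cdf_def
proof (rule sample_midpoint_inequality)
  fix x y
  assume sp: "x \<in> space (sample N n)" "y \<in> space (sample N n)"
    and xy: "x \<in> {\<omega> \<in> space (sample N n). \<forall>t. \<bar>normalized_sum Y n \<omega> t\<bar> \<le> a}"
    "y \<in> {\<omega> \<in> space (sample N n). \<forall>t. \<bar>normalized_sum Y n \<omega> t\<bar> \<le> b}"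
  have "\<bar>normalized_sum Y n (sample_mid n x y) t\<bar> \<le> (a + b) / 2" for t
  proof -
    have "\<bar>normalized_sum Y n x t\<bar> \<le> a" "\<bar>normalized_sum Y n y t\<bar> \<le> b" using xy by auto
    then show ?thesis unfolding normalized_sum_mid[OF sp] by (simp add: abs_le_iff)
  qed
  moreover have "sample_mid n x y \<in> space (sample N n)"
    using sp mid_closed by (auto simp: sample_mid_def space_PiM PiE_def Pi_def)
  ultimately show "sample_mid n x y \<in> {\<omega> \<in> space (sample N n). \<forall>t. \<bar>normalized_sum Y n \<omega> t\<bar> \<le> (a + b) / 2}"
    by simp
qed (rule sup_event_measurable)+

text \<open>With probability at least 1/2, the path is bounded by \<open>L \<eta>\<close> on the grid and oscillates by at most \<open>2 \<eta>\<close> on each cell.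
It is then within \<open>3 \<eta>\<close> of a step function with values in \<open>\<eta> \<int>\<close>. There are \<open>(2 L + 1) ^ k\<close> such step functions, and
no neighbourhood of a step function is more likely than the one of the zero function. This
is Anderson's inequality: the neighbourhoods of \<open>c\<close> and of \<open>- c\<close> are equally likely, and their midpoints lie in the
neighbourhood of 0.\<close>

lemma small_ball:
  assumes n: "0 < n" and k: "0 < k" and \<eta>: "0 < \<eta>"
    and k1: "16 * T\<^sup>2 \<le> real k * \<eta>\<^sup>2" and L: "0 < L" "16 * real k * T\<^sup>2 \<le> (real L * \<eta>)\<^sup>2"
  shows "1 / (2 * (2 * real L + 1) ^ k) \<le> sup_cdf N Y n (3 * \<eta>)"
proof -
  interpret S: prob_space "sample N n" by (rule prob_space_sample)
  let ?S = "normalized_sum Y n"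
  obtain E where E[measurable]: "E \<in> sets (sample N n)" and pE: "measure (sample N n) E \<ge> 1 - 4 * T\<^sup>2 / (real k * \<eta>\<^sup>2)"
    and Em: "\<And>\<omega> j t. \<omega> \<in> E \<Longrightarrow> j < k \<Longrightarrow> grid T k j \<le> t \<Longrightarrow> t \<le> grid T k (Suc j) \<Longrightarrow>
      \<bar>?S \<omega> t - ?S \<omega> (grid T k j)\<bar> \<le> 2 * \<eta>"
    using modulus_event[OF n k \<eta>] by blast
  have Esp: "E \<subseteq> space (sample N n)" by (rule sets.sets_into_space) measurable
  have "4 * T\<^sup>2 / (real k * \<eta>\<^sup>2) \<le> 1/4" using k1 k \<eta> by (simp add: divide_le_eq)
  then have pE': "3/4 \<le> measure (sample N n) E" using pE by simp
  define V where "V j = {\<omega> \<in> space (sample N n). (?S \<omega> (grid T k j) - ?S \<omega> 0)\<^sup>2 \<le> (real L * \<eta>)\<^sup>2}" for j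
  have V[measurable]: "V j \<in> sets (sample N n)" for j unfolding V_def by measurable
  have pV: "measure (sample N n) (space (sample N n) - V j) \<le> 1 / (4 * real k)" if "j < k" for j
  proof -
    have g: "0 \<le> grid T k j" "grid T k j \<le> T" using that T_pos k by (auto simp: grid_def field_simps)
    have "(\<integral>\<omega>. (?S \<omega> (grid T k j) - ?S \<omega> 0)\<^sup>2 \<partial>sample N n) \<le> 4 * (grid T k j - 0)\<^sup>2"
      by (rule square_increment[OF n])
    also have "\<dots> \<le> 4 * T\<^sup>2" using g by (simp add: power_mono)
    finally have "1 - 4 * T\<^sup>2 / (real L * \<eta>)\<^sup>2 \<le> measure (sample N n) (V j)"
      unfolding V_def using L \<eta> by (intro S.markov_complement integrable_square_increment) auto
    moreover have "4 * T\<^sup>2 / (real L * \<eta>)\<^sup>2 \<le> 1 / (4 * real k)"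
      using L k \<eta> by (simp add: divide_le_eq le_divide_eq field_simps)
    ultimately show ?thesis by (simp add: S.prob_compl)
  qed
  define U where "U = (\<Union>j<k. space (sample N n) - V j)"
  have [measurable]: "U \<in> sets (sample N n)" unfolding U_def by measurable
  define G where "G = E - U"
  have [measurable]: "G \<in> sets (sample N n)" unfolding G_def by measurable
  have "measure (sample N n) U \<le> (\<Sum>j<k. measure (sample N n) (space (sample N n) - V j))"
    unfolding U_def by (intro S.finite_measure_subadditive_finite) auto
  also have "\<dots> \<le> (\<Sum>j<k. 1 / (4 * real k))" using pV by (intro sum_mono) auto
  also have "\<dots> = 1/4" using k by simp
  finally have pU: "measure (sample N n) U \<le> 1/4" .
  have "measure (sample N n) E \<le> measure (sample N n) (G \<union> U)"
    by (intro S.finite_measure_mono) (auto simp: G_def)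
  also have "\<dots> \<le> measure (sample N n) G + measure (sample N n) U"
    by (intro measure_Un_le) auto
  finally have pG: "1/2 \<le> measure (sample N n) G" using pE' pU by simp
  define Cs where "Cs = PiE {..<k} (\<lambda>_. {- int L..int L})"
  define A where "A c = {\<omega> \<in> E. \<forall>j<k. \<bar>?S \<omega> (grid T k j) - \<eta> * of_int (c j)\<bar> \<le> \<eta>}" for c :: "nat \<Rightarrow> int"
  have A[measurable]: "A c \<in> sets (sample N n)" for c
  proof -
    have "A c = E \<inter> {\<omega> \<in> space (sample N n). \<forall>j<k. \<bar>?S \<omega> (grid T k j) - \<eta> * of_int (c j)\<bar> \<le> \<eta>}"
      using Esp by (auto simp: A_def)
    also have "\<dots> \<in> sets (sample N n)" by measurable
    finally show ?thesis .
  qed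
  have Ct: "\<bar>?S \<omega> t - \<eta> * of_int (c j)\<bar> \<le> 3 * \<eta>" if "\<omega> \<in> A c" "j < k" "grid T k j \<le> t" "t \<le> grid T k (Suc j)" for \<omega> c j t
    using that Em[of \<omega> j t] by (fastforce simp: A_def)
  have cover: "G \<subseteq> (\<Union>c\<in>Cs. A c)"
  proof
    fix \<omega> assume \<omega>: "\<omega> \<in> G"
    then have sp: "\<omega> \<in> space (sample N n)" and EE: "\<omega> \<in> E" using Esp by (auto simp: G_def)
    have S0: "?S \<omega> 0 = 0" using lip_pathD(2)[OF normalized_sum_lip_path[OF sp], of 0] by simp
    define c where "c = (\<lambda>j\<in>{..<k}. \<lfloor>?S \<omega> (grid T k j) / \<eta>\<rfloor>)"
    have "- int L \<le> c j \<and> c j \<le> int L \<and> \<bar>?S \<omega> (grid T k j) - \<eta> * of_int (c j)\<bar> \<le> \<eta>" if j: "j < k" for j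
    proof -
      have "\<omega> \<in> V j" using \<omega> j sp by (auto simp: G_def U_def)
      then have "\<bar>?S \<omega> (grid T k j)\<bar> \<le> \<bar>real L * \<eta>\<bar>" using S0 by (simp add: V_def abs_le_square_iff)
      then have b: "\<bar>?S \<omega> (grid T k j)\<bar> \<le> real L * \<eta>" using \<eta> by simp
      then have "- real L \<le> ?S \<omega> (grid T k j) / \<eta>" "?S \<omega> (grid T k j) / \<eta> \<le> real L"
        using \<eta> by (auto simp: field_simps abs_le_iff)
      moreover have "of_int (c j) \<le> ?S \<omega> (grid T k j) / \<eta>" "?S \<omega> (grid T k j) / \<eta> < of_int (c j) + 1"
        using j by (simp_all add: c_def)
      ultimately have "of_int (c j) \<le> real L" "- real L < of_int (c j) + 1" by linarith+
      then have "c j \<le> int L" "- int L \<le> c j" by linarith+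
      moreover have "\<eta> * of_int (c j) \<le> ?S \<omega> (grid T k j)" "?S \<omega> (grid T k j) \<le> \<eta> * of_int (c j) + \<eta>"
        using \<open>of_int (c j) \<le> ?S \<omega> (grid T k j) / \<eta>\<close> \<open>?S \<omega> (grid T k j) / \<eta> < of_int (c j) + 1\<close> \<eta>
        by (auto simp: field_simps)
      ultimately show ?thesis by (auto simp: abs_le_iff)
    qed
    then have "c \<in> Cs" "\<omega> \<in> A c" using EE by (auto simp: Cs_def A_def c_def)
    then show "\<omega> \<in> (\<Union>c\<in>Cs. A c)" by blast
  qed
  have each: "measure (sample N n) (A c) \<le> sup_cdf N Y n (3 * \<eta>)" for c
  proof -
    have neg: "sample_neg n \<in> sample N n \<rightarrow>\<^sub>M sample N n"
      unfolding sample_neg_def[abs_def] by measurable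
    define B where "B = sample_neg n -` A c \<inter> space (sample N n)"
    have B: "B \<in> sets (sample N n)" unfolding B_def using neg A by (rule measurable_sets)
    have inv: "distr (sample N n) (sample N n) (sample_neg n) = sample N n"
      unfolding sample_neg_def[abs_def]
      by (rule distr_PiM_componentwise[OF prob_space_axioms finite_lessThan neg_measurable neg_invariant])
    have "measure (sample N n) (A c) = measure (distr (sample N n) (sample N n) (sample_neg n)) (A c)"
      by (simp only: inv)
    also have "\<dots> = measure (sample N n) B"
      unfolding B_def by (rule measure_distr[OF neg A])
    finally have "measure (sample N n) (A c) * measure (sample N n) (A c) = measure (sample N n) (A c) * measure (sample N n) B" by simp
    also have "\<dots> \<le> (sup_cdf N Y n (3 * \<eta>))\<^sup>2"
      unfolding sup_cdf_def
    proof (rule sample_midpoint_inequality[OF A B sup_event_measurable])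
      fix x y assume sp: "x \<in> space (sample N n)" "y \<in> space (sample N n)" and xy: "x \<in> A c" "y \<in> B"
      have yA: "sample_neg n y \<in> A c" using xy(2) by (simp add: B_def)
      have m: "sample_mid n x y \<in> space (sample N n)"
        using sp mid_closed by (auto simp: sample_mid_def space_PiM PiE_def Pi_def)
      have "\<bar>?S (sample_mid n x y) t\<bar> \<le> 3 * \<eta>" for t
      proof (cases "0 \<le> t \<and> t < T")
        case True
        then obtain j where j: "j < k" "grid T k j \<le> t" "t \<le> grid T k (Suc j)"
          using grid_cell[OF T_pos k] by blast
        have "\<bar>?S x t - \<eta> * of_int (c j)\<bar> \<le> 3 * \<eta>" "\<bar>- ?S y t - \<eta> * of_int (c j)\<bar> \<le> 3 * \<eta>"
          using Ct[OF xy(1) j] Ct[OF yA j] normalized_sum_neg[OF sp(2)] by simp_all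
        then have "\<bar>?S x t + ?S y t\<bar> \<le> 6 * \<eta>" by linarith
        then show ?thesis unfolding normalized_sum_mid[OF sp] by simp
      next
        case False
        then have "?S (sample_mid n x y) t = 0" using lip_pathD(2,3)[OF normalized_sum_lip_path[OF m], of t] by auto
        then show ?thesis using \<eta> by simp
      qed
      then show "sample_mid n x y \<in> {\<omega> \<in> space (sample N n). \<forall>t. \<bar>?S \<omega> t\<bar> \<le> 3 * \<eta>}" using m by simp
    qed
    finally have "(measure (sample N n) (A c))\<^sup>2 \<le> (sup_cdf N Y n (3 * \<eta>))\<^sup>2" by (simp add: power2_eq_square)
    then show ?thesis by (rule power2_le_imp_le) (simp add: sup_cdf_def)
  qed
  have fin: "finite Cs" unfolding Cs_def by (intro finite_PiE) auto
  have card: "real (card Cs) = (2 * real L + 1) ^ k"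
    unfolding Cs_def by (simp add: card_PiE)
  have "1/2 \<le> measure (sample N n) (\<Union>c\<in>Cs. A c)"
  proof -
    have "measure (sample N n) G \<le> measure (sample N n) (\<Union>c\<in>Cs. A c)"
      using cover fin by (intro S.finite_measure_mono) auto
    then show ?thesis using pG by simp
  qed
  also have "\<dots> \<le> (\<Sum>c\<in>Cs. measure (sample N n) (A c))"
    using fin by (intro S.finite_measure_subadditive_finite) auto
  also have "\<dots> \<le> (\<Sum>c\<in>Cs. sup_cdf N Y n (3 * \<eta>))" by (intro sum_mono each)
  also have "\<dots> = (2 * real L + 1) ^ k * sup_cdf N Y n (3 * \<eta>)" using card by simp
  finally show ?thesis
    by (simp add: divide_le_eq mult_ac)
qed

lemma sup_cdf_le_1: "sup_cdf N Y n r \<le> 1"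
  unfolding sup_cdf_def using prob_space_sample by (rule prob_space.prob_le_1)

text \<open>The bound depends on the law only through the lower bound \<open>c\<close> for the distribution function to
the left of \<open>r\<close>, which \<open>small_ball\<close> supplies uniformly.\<close>

lemma anti_concentration:
  assumes c: "0 < c" "c \<le> sup_cdf N Y n (r - real p * \<delta>)" and p: "0 < p" and \<delta>: "0 \<le> \<delta>"
  shows "sup_cdf N Y n (r + \<delta>) - sup_cdf N Y n r \<le> 1 / (real p * c)"
  using sup_cdf_mono sup_cdf_le_1 sup_cdf_log_concave assms by (rule log_concave_increment_bound)

end

section \<open>Log-concave path laws with prescribed covariances\<close>

lemma integral_PiM_component:
  fixes y :: "'a \<Rightarrow> real"
  assumes "prob_space N" and i: "i < n" and [measurable]: "y \<in> borel_measurable N"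
  shows "(\<integral>\<omega>. y (\<omega> i) \<partial>PiM {..<n} (\<lambda>_. N)) = (\<integral>v. y v \<partial>N)"
proof -
  have "distr (PiM {..<n} (\<lambda>_. N)) N (\<lambda>\<omega>. \<omega> i) = N"
    using assms by (intro distr_PiM_component) auto
  then have "(\<integral>v. y v \<partial>N) = (\<integral>v. y v \<partial>distr (PiM {..<n} (\<lambda>_. N)) N (\<lambda>\<omega>. \<omega> i))" by simp
  also have "\<dots> = (\<integral>\<omega>. y (\<omega> i) \<partial>PiM {..<n} (\<lambda>_. N))"
    using i by (intro integral_distr) auto
  finally show ?thesis ..
qed

text \<open>Chebyshev's inequality; a deviation from the mean is at most \<open>2 K\<close>.\<close>

lemma (in prob_space) weak_law:
  fixes y :: "'a \<Rightarrow> real"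
  assumes [measurable]: "y \<in> borel_measurable M" and bd: "\<And>v. v \<in> space M \<Longrightarrow> \<bar>y v\<bar> \<le> K"
    and mean: "(\<integral>v. y v \<partial>M) = a" and n: "0 < n" and \<epsilon>: "0 < \<epsilon>"
  shows "measure (PiM {..<n} (\<lambda>_. M)) {\<omega> \<in> space (PiM {..<n} (\<lambda>_. M)). \<bar>(\<Sum>i<n. y (\<omega> i)) / real n - a\<bar> \<le> \<epsilon>}
    \<ge> 1 - (2 * K)\<^sup>2 / \<epsilon>\<^sup>2 / real n"
proof -
  let ?S = "PiM {..<n} (\<lambda>_. M)"
  interpret S: prob_space ?S by (intro prob_space_PiM prob_space_axioms)
  have iy: "integrable M y" using bd by (intro integrable_bounded) auto
  have "\<bar>a\<bar> \<le> K" unfolding mean[symmetric] using bd by (intro abs_integral_le_bound) auto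
  then have bd': "\<bar>y v - a\<bar> \<le> 2 * K" if "v \<in> space M" for v using bd[OF that] by linarith
  have bd2: "(y v - a)\<^sup>2 \<le> (2 * K)\<^sup>2" if "v \<in> space M" for v
    using power_mono[OF bd'[OF that], of 2] by simp
  have iy2: "integrable M (\<lambda>v. (y v - a)\<^sup>2)" using bd2 by (intro integrable_bounded[where K="(2 * K)\<^sup>2"]) auto
  have eq: "(\<Sum>i<n. y (\<omega> i)) / real n - a = (\<Sum>i<n. (1 / real n) * (y (\<omega> i) - a))" for \<omega>
    using n by (simp add: sum_subtractf sum_divide_distrib[symmetric] diff_divide_distrib)
  have "(\<integral>\<omega>. ((\<Sum>i<n. y (\<omega> i)) / real n - a)\<^sup>2 \<partial>?S) = (\<Sum>i<n. (1 / real n)\<^sup>2) * (\<integral>v. (y v - a)\<^sup>2 \<partial>M)"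
    unfolding eq using iy mean by (intro second_moment_weighted_sum[OF _ bd']) (auto simp: prob_space)
  also have "\<dots> = (1 / real n) * (\<integral>v. (y v - a)\<^sup>2 \<partial>M)" using n by (simp add: power2_eq_square)
  also have "(\<integral>v. (y v - a)\<^sup>2 \<partial>M) \<le> (\<integral>v. (2 * K)\<^sup>2 \<partial>M)"
    using iy2 bd2 by (intro integral_mono) auto
  also have "(\<integral>v. (2 * K)\<^sup>2 \<partial>M) = (2 * K)\<^sup>2" by (simp add: prob_space)
  finally have le: "(\<integral>\<omega>. ((\<Sum>i<n. y (\<omega> i)) / real n - a)\<^sup>2 \<partial>?S) \<le> (1 / real n) * (2 * K)\<^sup>2" using n by (simp add: divide_right_mono)
  have b3: "\<bar>((\<Sum>i<n. y (\<omega> i)) / real n - a)\<^sup>2\<bar> \<le> (2 * K)\<^sup>2" if "\<omega> \<in> space ?S" for \<omega>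
  proof -
    have "\<bar>(\<Sum>i<n. y (\<omega> i)) / real n - a\<bar> \<le> (\<Sum>i<n. (1 / real n) * (2 * K))"
      unfolding eq using that bd' by (intro order_trans[OF sum_abs] sum_mono) (auto simp: abs_mult space_PiM PiE_def Pi_def intro!: divide_right_mono)
    also have "\<dots> = 2 * K" using n by simp
    finally show ?thesis using power_mono[of "\<bar>(\<Sum>i<n. y (\<omega> i)) / real n - a\<bar>" "2 * K" 2] by simp
  qed
  have int: "integrable ?S (\<lambda>\<omega>. ((\<Sum>i<n. y (\<omega> i)) / real n - a)\<^sup>2)"
    by (rule S.integrable_bounded[OF _ b3]) measurable
  have "1 - (1 / real n) * (2 * K)\<^sup>2 / \<epsilon>\<^sup>2 \<le> measure ?S {\<omega> \<in> space ?S. ((\<Sum>i<n. y (\<omega> i)) / real n - a)\<^sup>2 \<le> \<epsilon>\<^sup>2}"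
    using \<epsilon> by (intro S.markov_complement[OF _ int _ le]) auto
  also have "{\<omega> \<in> space ?S. ((\<Sum>i<n. y (\<omega> i)) / real n - a)\<^sup>2 \<le> \<epsilon>\<^sup>2} = {\<omega> \<in> space ?S. \<bar>(\<Sum>i<n. y (\<omega> i)) / real n - a\<bar> \<le> \<epsilon>}"
    using \<epsilon> by (simp add: abs_le_square_iff[symmetric])
  finally show ?thesis by (simp add: field_simps)
qed

lemma uniform_unit_var_moments:
  "(\<integral>x. x \<partial>uniform_unit_var) = 0" "(\<integral>x. x\<^sup>2 \<partial>uniform_unit_var) = 1"
proof -
  interpret U: prob_space uniform_unit_var by (rule prob_space_uniform_unit_var)
  have m: "measure lborel {- sqrt 3..sqrt 3} = 2 * sqrt 3" by (simp add: measure_def)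
  have d: "distributed uniform_unit_var lborel (\<lambda>x. x) (\<lambda>x. indicator {- sqrt 3..sqrt 3} x / measure lborel {- sqrt 3..sqrt 3})"
    unfolding distributed_def
  proof (intro conjI)
    have "distr uniform_unit_var lborel (\<lambda>x. x) = uniform_unit_var"
      by (rule measure_eqI) (auto simp: uniform_unit_var_def emeasure_distr)
    moreover have "uniform_unit_var = density lborel (\<lambda>x. indicator {- sqrt 3..sqrt 3} x / measure lborel {- sqrt 3..sqrt 3})"
      unfolding uniform_unit_var_def uniform_measure_def m
      by (intro density_cong) (auto simp: indicator_def divide_ennreal[symmetric])
    ultimately show "distr uniform_unit_var lborel (\<lambda>x. x) = density lborel (\<lambda>x. ennreal (indicator {- sqrt 3..sqrt 3} x / measure lborel {- sqrt 3..sqrt 3}))"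
      by simp
  qed (auto simp: uniform_unit_var_def)
  show e: "(\<integral>x. x \<partial>uniform_unit_var) = 0"
    using U.uniform_distributed_expectation[OF d] by simp
  have "(\<integral>x. (x - (\<integral>x. x \<partial>uniform_unit_var))\<^sup>2 \<partial>uniform_unit_var) = (sqrt 3 - - sqrt 3)\<^sup>2 / 12"
    using U.uniform_distributed_variance[OF d] by simp
  then show "(\<integral>x. x\<^sup>2 \<partial>uniform_unit_var) = 1" unfolding e by (simp add: power_mult_distrib)
qed

text \<open>The uniform law is restricted to the interval that carries it, so that the paths below are
bounded at every point of the sample space.\<close>

definition unit_var_interval :: "real measure" where
  "unit_var_interval = restrict_space uniform_unit_var {-sqrt 3..sqrt 3}"

lemma space_unit_var_interval: "space unit_var_interval = {-sqrt 3..sqrt 3}"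
  by (simp add: unit_var_interval_def space_restrict_space uniform_unit_var_def)

lemma uniform_unit_var_interval_events [measurable]: "{-sqrt 3..sqrt 3} \<in> sets uniform_unit_var"
  by (simp add: uniform_unit_var_def)

lemma AE_uniform_unit_var: "AE x in uniform_unit_var. x \<in> {-sqrt 3..sqrt 3}"
  unfolding uniform_unit_var_def by (rule AE_uniform_measureI) auto

lemma prob_space_unit_var_interval: "prob_space unit_var_interval"
proof -
  interpret U: prob_space uniform_unit_var by (rule prob_space_uniform_unit_var)
  have "U.prob {-sqrt 3..sqrt 3} = 1"
    using AE_uniform_unit_var by (subst U.prob_eq_1) auto
  then show ?thesis
    unfolding unit_var_interval_def
    by (intro prob_space_restrict_space) (auto simp: U.emeasure_eq_measure)
qed

lemma integral_unit_var_interval: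
  fixes f :: "real \<Rightarrow> real"
  assumes [measurable]: "f \<in> borel_measurable borel"
  shows "(\<integral>x. f x \<partial>unit_var_interval) = (\<integral>x. f x \<partial>uniform_unit_var)"
proof -
  have [measurable]: "f \<in> borel_measurable uniform_unit_var" using assms by (simp add: uniform_unit_var_def)
  have "(\<integral>x. f x \<partial>unit_var_interval) = (\<integral>x. indicator {-sqrt 3..sqrt 3} x *\<^sub>R f x \<partial>uniform_unit_var)"
    unfolding unit_var_interval_def by (rule integral_restrict_space) simp
  also have "\<dots> = (\<integral>x. f x \<partial>uniform_unit_var)"
    using AE_uniform_unit_var by (intro integral_cong_AE) auto
  finally show ?thesis .
qed

lemma measurable_unit_var_interval: "f \<in> borel_measurable borel \<Longrightarrow> f \<in> borel_measurable unit_var_interval"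
  unfolding unit_var_interval_def by (intro measurable_restrict_space1) (simp add: uniform_unit_var_def)

lemma midpoint_log_concave_unit_var_interval: "midpoint_log_concave (\<lambda>x y. (x + y) / 2) unit_var_interval"
  unfolding midpoint_log_concave_def
proof (intro allI impI)
  let ?I = "{-sqrt 3..sqrt 3 :: real}"
  fix f g h :: "real \<Rightarrow> ennreal"
  assume fgh: "f \<in> borel_measurable unit_var_interval" "g \<in> borel_measurable unit_var_interval" "h \<in> borel_measurable unit_var_interval"
    and le: "\<forall>x\<in>space unit_var_interval. f x \<le> 1 \<and> g x \<le> 1 \<and> h x \<le> 1"
    and mid: "\<forall>x\<in>space unit_var_interval. \<forall>y\<in>space unit_var_interval. f x * g y \<le> (h ((x + y) / 2))\<^sup>2"
  have meas: "(\<lambda>x. k x * indicator ?I x) \<in> borel_measurable uniform_unit_var" if "k \<in> borel_measurable unit_var_interval" for k :: "real \<Rightarrow> ennreal"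
    using that unfolding unit_var_interval_def by (subst (asm) borel_measurable_restrict_space_iff_ennreal) auto
  have int: "(\<integral>\<^sup>+x. k x \<partial>unit_var_interval) = (\<integral>\<^sup>+x. k x * indicator ?I x \<partial>uniform_unit_var)" for k :: "real \<Rightarrow> ennreal"
    unfolding unit_var_interval_def by (rule nn_integral_restrict_space) simp
  have "(\<integral>\<^sup>+x. f x * indicator ?I x \<partial>uniform_unit_var) * (\<integral>\<^sup>+x. g x * indicator ?I x \<partial>uniform_unit_var)
    \<le> (\<integral>\<^sup>+x. h x * indicator ?I x \<partial>uniform_unit_var)\<^sup>2"
  proof (rule midpoint_log_concave_uniform[unfolded midpoint_log_concave_def, rule_format, OF meas[OF fgh(1)] meas[OF fgh(2)] meas[OF fgh(3)]])
    show "f x * indicator ?I x \<le> 1 \<and> g x * indicator ?I x \<le> 1 \<and> h x * indicator ?I x \<le> 1" for x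
      using le by (auto simp: indicator_def space_unit_var_interval)
    show "f x * indicator ?I x * (g y * indicator ?I y) \<le> (h ((x + y) / 2) * indicator ?I ((x + y) / 2))\<^sup>2" for x y
      using mid by (auto simp: indicator_def space_unit_var_interval field_simps)
  qed
  then show "(\<integral>\<^sup>+x. f x \<partial>unit_var_interval) * (\<integral>\<^sup>+x. g x \<partial>unit_var_interval) \<le> (\<integral>\<^sup>+x. h x \<partial>unit_var_interval)\<^sup>2"
    unfolding int .
qed

lemma uminus_unit_var_interval_measurable: "uminus \<in> unit_var_interval \<rightarrow>\<^sub>M unit_var_interval"
  unfolding unit_var_interval_def
  by (intro measurable_restrict_space2 measurable_restrict_space1) (auto simp: space_restrict_space uniform_unit_var_def)

lemma distr_uminus_unit_var_interval: "distr unit_var_interval unit_var_interval uminus = unit_var_interval"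
proof (rule measure_eqI)
  fix A assume "A \<in> sets (distr unit_var_interval unit_var_interval uminus)"
  then have A: "A \<in> sets uniform_unit_var" "A \<subseteq> {-sqrt 3..sqrt 3}"
    by (auto simp: unit_var_interval_def sets_restrict_space_iff)
  have sub: "uminus -` A \<subseteq> {-sqrt 3..sqrt 3}" using A(2) by auto
  have "emeasure (distr unit_var_interval unit_var_interval uminus) A = emeasure unit_var_interval (uminus -` A \<inter> space unit_var_interval)"
    using A by (intro emeasure_distr uminus_unit_var_interval_measurable) (auto simp: unit_var_interval_def sets_restrict_space_iff)
  also have "\<dots> = emeasure unit_var_interval (uminus -` A)"
    using sub by (simp add: space_unit_var_interval Int_absorb2)
  also have "\<dots> = emeasure uniform_unit_var (uminus -` A \<inter> space uniform_unit_var)"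
    unfolding unit_var_interval_def using sub by (subst emeasure_restrict_space) (auto simp: uniform_unit_var_def)
  also have "\<dots> = emeasure (distr uniform_unit_var uniform_unit_var uminus) A"
    using A by (intro emeasure_distr[symmetric]) (auto simp: uniform_unit_var_def)
  also have "\<dots> = emeasure unit_var_interval A"
    unfolding distr_uminus_uniform_unit_var unit_var_interval_def using A by (subst emeasure_restrict_space) auto
  finally show "emeasure (distr unit_var_interval unit_var_interval uminus) A = emeasure unit_var_interval A" .
qed simp

abbreviation cube :: "nat \<Rightarrow> (nat \<Rightarrow> real) measure" where
  "cube m \<equiv> sample unit_var_interval m"

text \<open>A random combination of fixed paths \<open>y 0, \<dots>, y (m - 1)\<close> with independent coefficients of mean 0 and
variance 1. Its covariance is the empirical covariance of the fixed paths.\<close>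

definition combination :: "nat \<Rightarrow> (nat \<Rightarrow> real \<Rightarrow> real) \<Rightarrow> (nat \<Rightarrow> real) \<Rightarrow> real \<Rightarrow> real" where
  "combination m y v t = (\<Sum>j<m. v j * y j t) / sqrt (real m)"

context
  fixes m :: nat and y :: "nat \<Rightarrow> real \<Rightarrow> real" and T :: real
  assumes m: "0 < m" and T: "0 < T" and y: "\<And>j. j < m \<Longrightarrow> lip_path T 2 (y j)"
begin

interpretation U: prob_space unit_var_interval by (rule prob_space_unit_var_interval)
interpretation W: prob_space "cube m" by (intro prob_space_PiM prob_space_unit_var_interval)

lemma unit_var_component:
  assumes "v \<in> space (cube m)" "j < m"
  shows "\<bar>v j\<bar> \<le> sqrt 3"
proof -
  have "v j \<in> space unit_var_interval" using assms by (auto simp: space_PiM)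
  then show ?thesis by (auto simp: space_unit_var_interval abs_le_iff)
qed

lemma measurable_unit_var_component: "j < m \<Longrightarrow> (\<lambda>v. v j) \<in> borel_measurable (cube m)"
  using measurable_compose[OF measurable_component_singleton[of j "{..<m}" "\<lambda>_. unit_var_interval"]
    measurable_unit_var_interval[of "\<lambda>x. x"]] by simp

lemma linear_form_measurable: "(\<lambda>v. \<Sum>j<m. c j * v j) \<in> borel_measurable (cube m)"
  by (intro borel_measurable_sum borel_measurable_times borel_measurable_const measurable_unit_var_component) auto

lemma linear_form_bound:
  assumes "v \<in> space (cube m)"
  shows "\<bar>\<Sum>j<m. c j * v j\<bar> \<le> (\<Sum>j<m. \<bar>c j\<bar> * sqrt 3)"
  using unit_var_component[OF assms]
  by (intro order_trans[OF sum_abs] sum_mono) (auto simp: abs_mult intro!: mult_left_mono)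

lemma linear_form_second_moment:
  "(\<integral>v. (\<Sum>j<m. c j * v j)\<^sup>2 \<partial>cube m) = (\<Sum>j<m. (c j)\<^sup>2)"
proof -
  have "(\<integral>v. (\<Sum>j<m. c j * v j)\<^sup>2 \<partial>cube m) = (\<Sum>j<m. (c j)\<^sup>2) * (\<integral>x. x\<^sup>2 \<partial>unit_var_interval)"
    by (rule U.second_moment_weighted_sum[where K="sqrt 3"])
      (auto simp: measurable_unit_var_interval integral_unit_var_interval uniform_unit_var_moments space_unit_var_interval abs_le_iff)
  then show ?thesis by (simp add: integral_unit_var_interval uniform_unit_var_moments)
qed

text \<open>Polarization of the second moment.\<close>

lemma linear_form_product_moment:
  "(\<integral>v. (\<Sum>j<m. a j * v j) * (\<Sum>j<m. b j * v j) \<partial>cube m) = (\<Sum>j<m. a j * b j)"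
proof -
  have int: "integrable (cube m) (\<lambda>v. (\<Sum>j<m. c j * v j)\<^sup>2)" for c
  proof (rule W.integrable_bounded)
    show "\<bar>(\<Sum>j<m. c j * v j)\<^sup>2\<bar> \<le> (\<Sum>j<m. \<bar>c j\<bar> * sqrt 3)\<^sup>2" if "v \<in> space (cube m)" for v
      using linear_form_bound[OF that, of c] by (simp add: abs_le_square_iff[symmetric])
  qed (intro borel_measurable_power linear_form_measurable)
  have eq: "(\<Sum>j<m. a j * v j) * (\<Sum>j<m. b j * v j)
    = (1/4) * ((\<Sum>j<m. (a j + b j) * v j)\<^sup>2 - (\<Sum>j<m. (a j - b j) * v j)\<^sup>2)" for v :: "nat \<Rightarrow> real"
    unfolding distrib_right left_diff_distrib sum.distrib sum_subtractf by (simp add: power2_eq_square algebra_simps)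
  have "(\<integral>v. (\<Sum>j<m. a j * v j) * (\<Sum>j<m. b j * v j) \<partial>cube m)
    = (1/4) * ((\<Sum>j<m. (a j + b j)\<^sup>2) - (\<Sum>j<m. (a j - b j)\<^sup>2))"
    unfolding eq using int[of "\<lambda>j. a j + b j"] int[of "\<lambda>j. a j - b j"] by (simp add: linear_form_second_moment)
  also have "\<dots> = (1/4) * (\<Sum>j<m. 4 * (a j * b j))"
    unfolding sum_subtractf[symmetric] by (intro arg_cong[where f="\<lambda>z. (1/4) * z"] sum.cong refl) (simp add: power2_eq_square algebra_simps)
  finally show ?thesis by (simp add: sum_distrib_left)
qed

lemma combination_eq: "combination m y v t = (\<Sum>j<m. (y j t / sqrt (real m)) * v j)"
  by (simp add: combination_def sum_divide_distrib mult.commute)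

lemma combination_cov:
  "path_cov (cube m) (combination m y) s t = (\<Sum>j<m. y j s * y j t) / real m"
  unfolding path_cov_def combination_eq linear_form_product_moment
  by (simp add: sum_divide_distrib)

lemma combination_log_concave_path_law:
  "log_concave_path_law (cube m) (combination m y) T (2 * sqrt 3 * sqrt (real m))
     (\<lambda>v w. \<lambda>j\<in>{..<m}. (v j + w j) / 2) (\<lambda>v. \<lambda>j\<in>{..<m}. - v j)"
proof
  show "lip_path T (2 * sqrt 3 * sqrt (real m)) (combination m y v)" if v: "v \<in> space (cube m)" for v
  proof -
    have "lip_path T (\<bar>1 / sqrt (real m)\<bar> * (\<Sum>j<m. \<bar>v j\<bar> * 2)) (\<lambda>t. (1 / sqrt (real m)) * (\<Sum>j<m. v j * y j t))"
      using y by (intro lip_path_cmult lip_path_sum) auto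
    moreover have "\<bar>1 / sqrt (real m)\<bar> * (\<Sum>j<m. \<bar>v j\<bar> * 2) \<le> 2 * sqrt 3 * sqrt (real m)"
    proof -
      have "(\<Sum>j<m. \<bar>v j\<bar> * 2) \<le> (\<Sum>j<m. sqrt 3 * 2)" using unit_var_component[OF v] by (intro sum_mono) auto
      then have "\<bar>1 / sqrt (real m)\<bar> * (\<Sum>j<m. \<bar>v j\<bar> * 2) \<le> \<bar>1 / sqrt (real m)\<bar> * (real m * (sqrt 3 * 2))"
        by (intro mult_left_mono) auto
      also have "\<dots> = 2 * sqrt 3 * sqrt (real m)" using m by (simp add: field_simps)
      finally show ?thesis .
    qed
    ultimately show ?thesis unfolding combination_def[abs_def] by (auto intro: lip_path_mono)
  qed
  show "(\<lambda>v. combination m y v t) \<in> borel_measurable (cube m)" for t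
    unfolding combination_eq by (rule linear_form_measurable)
  show "(\<integral>v. combination m y v t \<partial>cube m) = 0" for t
  proof -
    have "(\<integral>v. v j \<partial>cube m) = 0" if "j < m" for j
      using integral_PiM_component[OF prob_space_unit_var_interval that measurable_unit_var_interval, of "\<lambda>x. x"]
      by (simp add: integral_unit_var_interval uniform_unit_var_moments)
    moreover have "integrable (cube m) (\<lambda>v. v j)" if "j < m" for j
      using unit_var_component that by (intro W.integrable_bounded[where K="sqrt 3"] measurable_unit_var_component) auto
    ultimately show ?thesis
      unfolding combination_eq by (subst Bochner_Integration.integral_sum) auto
  qed
  show "(\<integral>v. (combination m y v s - combination m y v t)\<^sup>2 \<partial>cube m) \<le> 4 * (s - t)\<^sup>2" for s t
  proof -
    have "combination m y v s - combination m y v t = (\<Sum>j<m. ((y j s - y j t) / sqrt (real m)) * v j)" for v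
      unfolding combination_eq by (simp add: sum_subtractf[symmetric] diff_divide_distrib algebra_simps)
    then have "(\<integral>v. (combination m y v s - combination m y v t)\<^sup>2 \<partial>cube m) = (\<Sum>j<m. ((y j s - y j t) / sqrt (real m))\<^sup>2)"
      by (simp only: linear_form_second_moment)
    also have "\<dots> \<le> (\<Sum>j<m. (2 * \<bar>s - t\<bar>)\<^sup>2 / real m)"
    proof (intro sum_mono)
      fix j assume "j \<in> {..<m}"
      then have "\<bar>y j s - y j t\<bar> \<le> 2 * \<bar>s - t\<bar>" using lip_pathD(1)[OF y] by auto
      then have "(y j s - y j t)\<^sup>2 \<le> (2 * \<bar>s - t\<bar>)\<^sup>2" using power_mono[of "\<bar>y j s - y j t\<bar>" "2 * \<bar>s - t\<bar>" 2] by simp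
      then show "((y j s - y j t) / sqrt (real m))\<^sup>2 \<le> (2 * \<bar>s - t\<bar>)\<^sup>2 / real m"
        by (simp add: power_divide divide_right_mono)
    qed
    also have "\<dots> = 4 * (s - t)\<^sup>2" using m by (simp add: power_mult_distrib)
    finally show ?thesis .
  qed
  show "midpoint_log_concave (\<lambda>v w. \<lambda>j\<in>{..<m}. (v j + w j) / 2) (cube m)"
    by (rule midpoint_log_concave_PiM[OF prob_space_unit_var_interval midpoint_log_concave_unit_var_interval finite_lessThan])
      (auto simp: space_unit_var_interval field_simps)
  show "(\<lambda>j\<in>{..<m}. (v j + w j) / 2) \<in> space (cube m)"
    if "v \<in> space (cube m)" "w \<in> space (cube m)" for v w
    using that by (fastforce simp: space_PiM PiE_def Pi_def space_unit_var_interval field_simps)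
  show "combination m y (\<lambda>j\<in>{..<m}. (v j + w j) / 2) t = (combination m y v t + combination m y w t) / 2" for v w t
    unfolding combination_eq by (simp add: sum_divide_distrib sum.distrib[symmetric] distrib_left)
  show "(\<lambda>v. \<lambda>j\<in>{..<m}. - v j) \<in> cube m \<rightarrow>\<^sub>M cube m"
  proof (rule measurable_restrict)
    fix j assume "j \<in> {..<m}"
    then have "(\<lambda>v. v j) \<in> cube m \<rightarrow>\<^sub>M unit_var_interval"
      by (rule measurable_component_singleton)
    then show "(\<lambda>v. - v j) \<in> cube m \<rightarrow>\<^sub>M unit_var_interval"
      by (rule measurable_compose[OF _ uminus_unit_var_interval_measurable])
  qed
  show "distr (cube m) (cube m) (\<lambda>v. \<lambda>j\<in>{..<m}. - v j) = cube m"
    by (rule distr_PiM_componentwise[OF prob_space_unit_var_interval finite_lessThan uminus_unit_var_interval_measurable distr_uminus_unit_var_interval])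
  show "combination m y (\<lambda>j\<in>{..<m}. - v j) t = - combination m y v t" for v t
    unfolding combination_eq by (simp add: sum_negf)
qed (fact T)

end

section \<open>Asymptotic equicontinuity of the distribution functions\<close>

lemma eventually_sqrt_ge: "eventually (\<lambda>n. a \<le> sqrt (real n)) sequentially"
  using filterlim_compose[OF sqrt_at_top filterlim_real_sequentially] by (auto simp: filterlim_at_top)

lemma eventually_div_sqrt_le:
  fixes a e :: real
  assumes "0 < e"
  shows "eventually (\<lambda>n. a / sqrt (real n) \<le> e) sequentially"
  using eventually_sqrt_ge[of "a / e"] eventually_gt_at_top[of 0]
proof eventually_elim
  case (elim n)
  then show ?case using assms by (simp add: field_simps)
qed

lemma (in prob_space) prob_all_ge:
  assumes I: "finite I" and meas: "\<And>i. i \<in> I \<Longrightarrow> {x \<in> space M. Q i x} \<in> events"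
    and p: "\<And>i. i \<in> I \<Longrightarrow> prob {x \<in> space M. Q i x} \<ge> 1 - p"
  shows "prob {x \<in> space M. \<forall>i\<in>I. Q i x} \<ge> 1 - real (card I) * p"
proof -
  have m: "{x \<in> space M. \<forall>i\<in>I. Q i x} \<in> events"
    by (intro sets.sets_Collect_finite_All I meas)
  have c: "prob {x \<in> space M. \<not> Q i x} \<le> p" if "i \<in> I" for i
    using prob_neg[OF meas[OF that]] p[OF that] by simp
  have mc: "{x \<in> space M. \<not> Q i x} \<in> events" if "i \<in> I" for i
    using meas[OF that] by (rule sets.sets_Collect_neg)
  have "prob {x \<in> space M. \<not> (\<forall>i\<in>I. Q i x)} = prob (\<Union>i\<in>I. {x \<in> space M. \<not> Q i x})"
    by (rule arg_cong[where f=prob]) auto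
  also have "\<dots> \<le> (\<Sum>i\<in>I. prob {x \<in> space M. \<not> Q i x})"
    using I mc by (intro finite_measure_subadditive_finite) auto
  also have "\<dots> \<le> (\<Sum>i\<in>I. p)" using c by (intro sum_mono) auto
  finally show ?thesis using prob_neg[OF m] by simp
qed

context path_law begin

lemma covariance_lln:
  assumes n: "0 < n" and \<epsilon>: "0 < \<epsilon>"
  shows "measure (sample N n) {\<omega> \<in> space (sample N n). \<forall>p\<in>{..k} \<times> {..k}.
      \<bar>(\<Sum>i<n. Y (\<omega> i) (grid T k (fst p)) * Y (\<omega> i) (grid T k (snd p))) / real n - path_cov N Y (grid T k (fst p)) (grid T k (snd p))\<bar> \<le> \<epsilon>}
    \<ge> 1 - (real k + 1)\<^sup>2 * ((2 * (C * T)\<^sup>2)\<^sup>2 / \<epsilon>\<^sup>2 / real n)"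
proof -
  interpret S: prob_space "sample N n" by (rule prob_space_sample)
  have "1 - real (card ({..k} \<times> {..k})) * ((2 * (C * T)\<^sup>2)\<^sup>2 / \<epsilon>\<^sup>2 / real n) \<le> measure (sample N n) {\<omega> \<in> space (sample N n). \<forall>p\<in>{..k} \<times> {..k}.
      \<bar>(\<Sum>i<n. Y (\<omega> i) (grid T k (fst p)) * Y (\<omega> i) (grid T k (snd p))) / real n - path_cov N Y (grid T k (fst p)) (grid T k (snd p))\<bar> \<le> \<epsilon>}"
  proof (rule S.prob_all_ge)
    fix p :: "nat \<times> nat"
    have bd: "\<bar>Y v s * Y v t\<bar> \<le> (C * T)\<^sup>2" if "v \<in> space N" for v s t
      unfolding abs_mult power2_eq_square using path_bound[OF that] C_nonneg T_pos by (intro mult_mono) auto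
    show "1 - (2 * (C * T)\<^sup>2)\<^sup>2 / \<epsilon>\<^sup>2 / real n \<le> measure (sample N n) {\<omega> \<in> space (sample N n).
      \<bar>(\<Sum>i<n. Y (\<omega> i) (grid T k (fst p)) * Y (\<omega> i) (grid T k (snd p))) / real n - path_cov N Y (grid T k (fst p)) (grid T k (snd p))\<bar> \<le> \<epsilon>}"
      using bd by (intro weak_law[OF _ _ _ n \<epsilon>]) (auto simp: path_cov_def)
  qed auto
  then show ?thesis by (simp add: card_cartesian_product power2_eq_square algebra_simps)
qed

lemma mean_lln:
  assumes n: "0 < n" and \<epsilon>: "0 < \<epsilon>"
  shows "measure (sample N n) {\<omega> \<in> space (sample N n). \<forall>j\<in>{..k}. \<bar>(\<Sum>i<n. Y (\<omega> i) (grid T k j)) / real n\<bar> \<le> \<epsilon>}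
    \<ge> 1 - (real k + 1) * ((2 * (C * T))\<^sup>2 / \<epsilon>\<^sup>2 / real n)"
proof -
  interpret S: prob_space "sample N n" by (rule prob_space_sample)
  have "1 - real (card {..k}) * ((2 * (C * T))\<^sup>2 / \<epsilon>\<^sup>2 / real n) \<le> measure (sample N n) {\<omega> \<in> space (sample N n). \<forall>j\<in>{..k}.
      \<bar>(\<Sum>i<n. Y (\<omega> i) (grid T k j)) / real n\<bar> \<le> \<epsilon>}"
  proof (rule S.prob_all_ge)
    fix j
    show "1 - (2 * (C * T))\<^sup>2 / \<epsilon>\<^sup>2 / real n \<le> measure (sample N n) {\<omega> \<in> space (sample N n).
      \<bar>(\<Sum>i<n. Y (\<omega> i) (grid T k j)) / real n\<bar> \<le> \<epsilon>}"
      using weak_law[OF path_measurable path_bound centered n \<epsilon>, of "grid T k j"] by simp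
  qed auto
  then show ?thesis by (simp add: algebra_simps)
qed

text \<open>By the weak law of large numbers some sample, of a size \<open>m\<close> that stays fixed when \<open>n\<close> grows, has an
empirical covariance close to the true one on the grid. Its paths serve as the fixed paths of a
\<open>combination\<close>, which then has almost the covariance of the data.\<close>

lemma finite_reference_sample:
  assumes C: "C = 2" and \<epsilon>: "0 < \<epsilon>"
  obtains m y where "0 < m" "\<And>j. j < m \<Longrightarrow> lip_path T 2 (y j)"
    "\<And>i l. i \<le> k \<Longrightarrow> l \<le> k \<Longrightarrow> \<bar>(\<Sum>j<m. y j (grid T k i) * y j (grid T k l)) / real m - path_cov N Y (grid T k i) (grid T k l)\<bar> \<le> \<epsilon>"
proof -
  define b where "b = (real k + 1)\<^sup>2 * ((2 * (C * T)\<^sup>2)\<^sup>2 / \<epsilon>\<^sup>2)"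
  define m where "m = Suc (nat \<lceil>b\<rceil>)"
  have m: "0 < m" "b < real m" unfolding m_def by linarith+
  let ?A = "{\<omega> \<in> space (sample N m). \<forall>p\<in>{..k} \<times> {..k}.
      \<bar>(\<Sum>i<m. Y (\<omega> i) (grid T k (fst p)) * Y (\<omega> i) (grid T k (snd p))) / real m - path_cov N Y (grid T k (fst p)) (grid T k (snd p))\<bar> \<le> \<epsilon>}"
  have "b / real m < 1" using m by simp
  then have "0 < measure (sample N m) ?A"
    using covariance_lln[OF m(1) \<epsilon>, of k] by (simp add: b_def)
  then have "?A \<noteq> {}" by (metis less_irrefl measure_empty)
  then obtain \<omega> where \<omega>: "\<omega> \<in> ?A" by blast
  show ?thesis
  proof (rule that[of m "\<lambda>j. Y (\<omega> j)"])
    show "lip_path T 2 (Y (\<omega> j))" if "j < m" for j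
      using path[of "\<omega> j"] \<omega> that C by (auto simp: space_PiM)
    show "\<bar>(\<Sum>j<m. Y (\<omega> j) (grid T k i) * Y (\<omega> j) (grid T k l)) / real m - path_cov N Y (grid T k i) (grid T k l)\<bar> \<le> \<epsilon>"
      if "i \<le> k" "l \<le> k" for i l
      using \<omega> that by force
  qed (rule m)
qed

lemma sup_cdf_nonneg: "0 \<le> sup_cdf N Y n r"
  by (simp add: sup_cdf_def)

text \<open>Near 0 the increments are small because \<open>sup_cdf N Y n \<rho>\<close> is. To the right of \<open>\<rho> / 2\<close> they
are compared with the increments for a log-concave law whose covariance is almost the same on a grid. The
parameters are chosen in the order: small ball constant \<open>c\<close>, number of steps \<open>p\<close>, smoothing
width \<open>\<eta>\<close>, grid size \<open>k\<close>, reference paths. Only then \<open>n\<close> tends to infinity.\<close>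

lemma asymptotic_equicontinuity:
  assumes C: "C = 2" and \<rho>: "0 < \<rho>" and e: "0 < e"
    and near0: "eventually (\<lambda>n. sup_cdf N Y n \<rho> \<le> e) sequentially"
  obtains \<delta> where "0 < \<delta>" "eventually (\<lambda>n. \<forall>r. sup_cdf N Y n (r + \<delta>) - sup_cdf N Y n r \<le> e) sequentially"
proof -
  \<comment> \<open>The small ball of radius \<open>3 \<eta>0 = \<rho> / 4\<close> has probability at least \<open>c\<close> under every log-concave law.\<close>
  define \<eta>0 where "\<eta>0 = \<rho> / 12"
  have \<eta>0: "0 < \<eta>0" using \<rho> by (simp add: \<eta>0_def)
  define k0 where "k0 = Suc (nat \<lceil>16 * T\<^sup>2 / \<eta>0\<^sup>2\<rceil>)"
  have k0: "0 < k0" "16 * T\<^sup>2 / \<eta>0\<^sup>2 \<le> real k0" unfolding k0_def by linarith+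
  define L where "L = Suc (nat \<lceil>sqrt (16 * real k0 * T\<^sup>2) / \<eta>0\<rceil>)"
  have L: "0 < L" "sqrt (16 * real k0 * T\<^sup>2) / \<eta>0 \<le> real L" unfolding L_def by linarith+
  have L2: "16 * real k0 * T\<^sup>2 \<le> (real L * \<eta>0)\<^sup>2"
  proof -
    have "sqrt (16 * real k0 * T\<^sup>2) \<le> real L * \<eta>0" using L(2) \<eta>0 by (simp add: divide_le_eq)
    then have "(sqrt (16 * real k0 * T\<^sup>2))\<^sup>2 \<le> (real L * \<eta>0)\<^sup>2" by (intro power_mono) auto
    then show ?thesis by simp
  qed
  define c where "c = 1 / (2 * (2 * real L + 1) ^ k0)"
  have c: "0 < c" unfolding c_def by (intro divide_pos_pos mult_pos_pos zero_less_power) auto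
  define p where "p = Suc (nat \<lceil>3 / (c * e)\<rceil>)"
  have p: "0 < p" "3 / (c * e) \<le> real p" unfolding p_def by linarith+
  have pc: "1 / (real p * c) \<le> e / 3" using p c e by (simp add: field_simps)
  \<comment> \<open>The comparison enlarges an interval of length \<open>\<eta>\<close> by \<open>5 \<eta>\<close> at both ends. With \<open>p\<close> steps of
    length \<open>11 \<eta>\<close> to the left of \<open>r - 5 \<eta>\<close> one still stays above \<open>\<rho> / 4\<close>, if \<open>r > \<rho> / 2\<close>.\<close>
  define \<eta> where "\<eta> = min 1 (\<rho> / (4 * (5 + 11 * real p)))"
  have \<eta>: "0 < \<eta>" "\<eta> \<le> 1" using \<rho> by (auto simp: \<eta>_def intro!: divide_pos_pos)
  have "\<eta> \<le> \<rho> / (4 * (5 + 11 * real p))" by (simp add: \<eta>_def)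
  then have \<eta>\<rho>: "5 * \<eta> + real p * (11 * \<eta>) \<le> \<rho> / 4" by (simp add: field_simps)
  define k where "k = Suc (nat \<lceil>4 * T\<^sup>2 / (\<eta>\<^sup>2 * (e / 9))\<rceil>)"
  have k: "0 < k" "4 * T\<^sup>2 / (\<eta>\<^sup>2 * (e / 9)) \<le> real k" unfolding k_def by linarith+
  have k2: "4 * T\<^sup>2 / (real k * \<eta>\<^sup>2) \<le> e / 9" using k \<eta> e by (simp add: field_simps)
  obtain K where K: "\<And>r. smooth3 {..k} K (bump {..k} \<eta> r)" using smooth3_bump[OF finite_atMost \<eta>, of k] by blast
  have K0: "0 \<le> K" using smooth3D(1)[OF K, of undefined undefined] by linarith
  define \<epsilon> where "\<epsilon> = e / 9 / (K + 1) / (real k + 1)\<^sup>2"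
  have \<epsilon>: "0 < \<epsilon>" using e K0 by (simp add: \<epsilon>_def)
  obtain m y where m: "0 < m" and y: "\<And>j. j < m \<Longrightarrow> lip_path T 2 (y j)"
    and cov: "\<And>i l. i \<le> k \<Longrightarrow> l \<le> k \<Longrightarrow> \<bar>(\<Sum>j<m. y j (grid T k i) * y j (grid T k l)) / real m - path_cov N Y (grid T k i) (grid T k l)\<bar> \<le> \<epsilon>"
    using finite_reference_sample[OF C \<epsilon>, of k] by metis
  let ?R = "cube m" and ?Z = "combination m y"
  interpret R: log_concave_path_law ?R ?Z T "2 * sqrt 3 * sqrt (real m)" "\<lambda>v w. \<lambda>j\<in>{..<m}. (v j + w j) / 2" "\<lambda>v. \<lambda>j\<in>{..<m}. - v j"
    by (rule combination_log_concave_path_law[OF m T_pos y])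
  have gap: "K * cov_gap T k ?R ?Z N Y \<le> e / 9"
    using K0 e cov by (intro cov_gap_le) (auto simp: combination_cov[OF m T_pos y] \<epsilon>_def)
  define B where "B = 2 * sqrt 3 * sqrt (real m) * T + 2 * T"
  have B: "C * T \<le> B" "2 * sqrt 3 * sqrt (real m) * T \<le> B" using T_pos C by (auto simp: B_def)
  have small: "eventually (\<lambda>n. 2 * K * B ^ 3 / sqrt (real n) \<le> e / 9) sequentially"
    using e by (intro eventually_div_sqrt_le) simp
  show ?thesis
  proof (rule that[of \<eta>])
    show "0 < \<eta>" by fact
    show "eventually (\<lambda>n. \<forall>r. sup_cdf N Y n (r + \<eta>) - sup_cdf N Y n r \<le> e) sequentially"
      using near0 small eventually_sqrt_ge[of B] eventually_gt_at_top[of 0]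
    proof eventually_elim
      case (elim n)
      have n: "0 < n" using elim by simp
      show ?case
      proof
        fix r
        show "sup_cdf N Y n (r + \<eta>) - sup_cdf N Y n r \<le> e"
        proof (cases "r \<le> \<rho> / 2")
          case True
          have "0 \<le> real p * (11 * \<eta>)" using \<eta> by simp
          then have "\<eta> \<le> \<rho> / 4" using \<eta>\<rho> \<eta>(1) by linarith
          then have "sup_cdf N Y n (r + \<eta>) \<le> sup_cdf N Y n \<rho>" using True \<rho> by (intro sup_cdf_mono) auto
          then show ?thesis using elim(1) sup_cdf_nonneg[of n r] by linarith
        next
          case False
          have 1: "sup_cdf N Y n (r + \<eta>) \<le> sup_cdf ?R ?Z n (r + \<eta> + 5 * \<eta>) + 4 * T\<^sup>2 / (real k * \<eta>\<^sup>2)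
            + K * cov_gap T k N Y ?R ?Z
            + 2 * K * B ^ 3 / sqrt (real n)"
            by (rule sup_cdf_transfer[OF path_law_axioms R.path_law_axioms n k(1) \<eta>(1) K B elim(3)])
          have 2: "sup_cdf ?R ?Z n (r - 5 * \<eta>) \<le> sup_cdf N Y n (r - 5 * \<eta> + 5 * \<eta>) + 4 * T\<^sup>2 / (real k * \<eta>\<^sup>2)
            + K * cov_gap T k ?R ?Z N Y
            + 2 * K * B ^ 3 / sqrt (real n)"
            by (rule sup_cdf_transfer[OF R.path_law_axioms path_law_axioms n k(1) \<eta>(1) K B(2,1) elim(3)])
          have "c \<le> sup_cdf ?R ?Z n (3 * \<eta>0)"
            unfolding c_def using k0 \<eta>0 by (intro R.small_ball[OF n k0(1) \<eta>0 _ L(1) L2]) (simp add: divide_le_eq)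
          also have "\<dots> \<le> sup_cdf ?R ?Z n (r - 5 * \<eta> - real p * (11 * \<eta>))"
            using False \<eta>\<rho> by (intro R.sup_cdf_mono) (simp add: \<eta>0_def)
          finally have 3: "sup_cdf ?R ?Z n (r - 5 * \<eta> + 11 * \<eta>) - sup_cdf ?R ?Z n (r - 5 * \<eta>) \<le> 1 / (real p * c)"
            using \<eta> by (intro R.anti_concentration[OF c _ p(1)]) auto
          have eq: "r - 5 * \<eta> + 11 * \<eta> = r + \<eta> + 5 * \<eta>" "r - 5 * \<eta> + 5 * \<eta> = r" by simp_all
          have "sup_cdf N Y n (r + \<eta>) \<le> sup_cdf ?R ?Z n (r + \<eta> + 5 * \<eta>) + e / 9 + e / 9 + e / 9"
            using 1 k2 gap elim(2) unfolding cov_gap_commute[of T k N] by linarith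
          moreover have "sup_cdf ?R ?Z n (r - 5 * \<eta>) \<le> sup_cdf N Y n r + e / 9 + e / 9 + e / 9"
            using 2[unfolded eq(2)] k2 gap elim(2) by linarith
          ultimately show ?thesis using 3[unfolded eq(1)] pc by linarith
        qed
      qed
    qed
  qed
qed

end

text \<open>The density is at most 1.\<close>

lemma std_normal_interval_le:
  assumes "0 \<le> x"
  shows "measure std_normal_distribution {-2 * x<..x} \<le> 3 * x"
proof -
  interpret prob_space std_normal_distribution by (rule prob_space_normal_density) simp
  have "emeasure std_normal_distribution {-2 * x<..x} = (\<integral>\<^sup>+z. ennreal (std_normal_density z) * indicator {-2 * x<..x} z \<partial>lborel)"
    by (rule emeasure_density) auto
  also have "\<dots> \<le> (\<integral>\<^sup>+z. indicator {-2 * x<..x} z \<partial>lborel)"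
  proof (intro nn_integral_mono)
    fix z
    have "std_normal_density z \<le> 1"
    proof -
      have "1 \<le> sqrt (2 * pi)" using pi_ge_two by simp
      moreover have "exp (- z\<^sup>2 / 2) \<le> 1" by simp
      ultimately show ?thesis unfolding std_normal_density_def
        by (metis divide_le_eq_1_pos exp_ge_zero mult_le_one order_less_le_trans zero_le_divide_1_iff zero_less_one order_trans zero_le_one)
    qed
    then have "ennreal (std_normal_density z) \<le> 1" by (metis ennreal_1 ennreal_leI)
    then show "ennreal (std_normal_density z) * indicator {-2 * x<..x} z \<le> indicator {-2 * x<..x} z"
      by (auto simp: indicator_def)
  qed
  also have "\<dots> = ennreal (3 * x)" using assms by simp
  finally show ?thesis using assms by (simp add: emeasure_eq_measure)
qed
lemma (in prob_space) distr_iid_sample: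
  assumes indep: "indep_vars (\<lambda>_. N) X UNIV" and distr: "\<And>i. distr M N (X i) = N" and n: "0 < n"
  shows "distr M (PiM {..<n} (\<lambda>_. N)) (\<lambda>x. \<lambda>i\<in>{..<n}. X i x) = PiM {..<n} (\<lambda>_. N)"
proof -
  have rv: "random_variable N (X i)" for i using indep by (auto simp: indep_vars_def)
  have "indep_vars (\<lambda>_. N) X {..<n}" using indep by (rule indep_vars_subset) auto
  then show ?thesis
    using n rv by (subst (asm) indep_vars_iff_distr_eq_PiM') (auto simp: distr)
qed

text \<open>The supremum is at least the value at a point \<open>t\<close> with positive variance, and this value is
asymptotically normal, hence unlikely to be close to 0.\<close>

lemma (in path_law) clt_small_ball:
  fixes X :: "nat \<Rightarrow> 'b \<Rightarrow> 'a" and M :: "'b measure"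
  assumes M: "prob_space M" and indep: "prob_space.indep_vars M (\<lambda>_. N) X UNIV" and distr: "\<And>i. distr M N (X i) = N"
    and var: "0 < path_cov N Y t t" and e: "0 < e"
  obtains \<rho> where "0 < \<rho>" "eventually (\<lambda>n. sup_cdf N Y n \<rho> \<le> e) sequentially"
proof -
  interpret M: prob_space M by fact
  have rv[measurable]: "X i \<in> M \<rightarrow>\<^sub>M N" for i using indep by (auto simp: M.indep_vars_def)
  have pb: "\<bar>Y (X i x) t\<bar> \<le> C * T" if "x \<in> space M" for i x
    using path_bound measurable_space[OF rv that] by auto
  define \<sigma> where "\<sigma> = sqrt (path_cov N Y t t)"
  have \<sigma>: "0 < \<sigma>" "\<sigma>\<^sup>2 = path_cov N Y t t" using var by (simp_all add: \<sigma>_def)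
  have E0: "M.expectation (\<lambda>x. Y (X i x) t) = 0" for i
  proof -
    have "M.expectation (\<lambda>x. Y (X i x) t) = (\<integral>v. Y v t \<partial>distr M N (X i))" by (rule integral_distr[symmetric]) auto
    then show ?thesis by (simp add: distr centered)
  qed
  have E2: "M.expectation (\<lambda>x. (Y (X i x) t)\<^sup>2) = path_cov N Y t t" for i
  proof -
    have "M.expectation (\<lambda>x. (Y (X i x) t)\<^sup>2) = (\<integral>v. (Y v t)\<^sup>2 \<partial>distr M N (X i))" by (rule integral_distr[symmetric]) auto
    then show ?thesis by (simp add: distr path_cov_def power2_eq_square)
  qed
  let ?\<mu> = "\<lambda>n. distr M borel (\<lambda>x. (\<Sum>i<n. Y (X i x) t - 0) / sqrt (real n * \<sigma>\<^sup>2))"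
  have wc: "weak_conv_m ?\<mu> std_normal_distribution"
  proof (rule M.central_limit_theorem)
    show "M.indep_vars (\<lambda>i. borel) (\<lambda>i x. Y (X i x) t) UNIV"
      by (rule M.indep_vars_compose2[OF indep]) auto
    show "integrable M (\<lambda>x. (Y (X n x) t)\<^sup>2)" for n
    proof (rule M.integrable_bounded)
      show "\<bar>(Y (X n x) t)\<^sup>2\<bar> \<le> (C * T)\<^sup>2" if "x \<in> space M" for x
        using power_mono[OF pb[OF that], of n 2] by simp
    qed measurable
    show "M.variance (\<lambda>x. Y (X n x) t) = \<sigma>\<^sup>2" for n by (simp add: E0 E2 \<sigma>)
    show "distr M borel (\<lambda>x. Y (X n x) t) = distr N borel (\<lambda>v. Y v t)" for n
      using distr_distr[of "\<lambda>v. Y v t" N borel "X n" M] by (simp add: distr comp_def)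
  qed (use \<sigma> E0 in auto)
  \<comment> \<open>Distribution functions measure half-open intervals; the closed interval from \<open>- x\<close> to \<open>x\<close> is
    enclosed in the interval from \<open>- 2 x\<close> to \<open>x\<close>, of length \<open>3 x = e / 2\<close>.\<close>
  define x where "x = e / 6"
  have x: "0 < x" using e by (simp add: x_def)
  interpret G: real_distribution std_normal_distribution by (rule real_dist_normal_dist)
  have cont: "isCont (cdf std_normal_distribution) z" for z
  proof -
    have "emeasure std_normal_distribution {z} = 0"
      by (subst emeasure_density) (auto simp: nn_integral_0_iff_AE intro!: AE_I[where N="{z}"])
    then show ?thesis by (simp add: G.isCont_cdf measure_def)
  qed
  have "(\<lambda>n. cdf (?\<mu> n) z) \<longlonglongrightarrow> cdf std_normal_distribution z" for z
    using wc cont by (auto simp: weak_conv_m_def weak_conv_def)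
  then have lim: "(\<lambda>n. cdf (?\<mu> n) x - cdf (?\<mu> n) (-2 * x)) \<longlonglongrightarrow> cdf std_normal_distribution x - cdf std_normal_distribution (-2 * x)"
    by (intro tendsto_diff)
  have "cdf std_normal_distribution x - cdf std_normal_distribution (-2 * x) = measure std_normal_distribution {-2 * x<..x}"
    using x by (intro G.cdf_diff_eq) auto
  also have "\<dots> \<le> 3 * x" using x by (intro std_normal_interval_le) auto
  also have "\<dots> < e" using e by (simp add: x_def)
  finally have ev: "eventually (\<lambda>n. cdf (?\<mu> n) x - cdf (?\<mu> n) (-2 * x) < e) sequentially"
    using order_tendstoD(2)[OF lim] by blast
  show ?thesis
  proof (rule that[of "x * \<sigma>"])
    show "0 < x * \<sigma>" using x \<sigma> by simp
    show "eventually (\<lambda>n. sup_cdf N Y n (x * \<sigma>) \<le> e) sequentially"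
      using ev eventually_gt_at_top[of 0]
    proof eventually_elim
      case (elim n)
      interpret D: real_distribution "?\<mu> n" by (rule M.real_distribution_distr) measurable
      let ?H = "{\<omega> \<in> space (sample N n). \<forall>t. \<bar>normalized_sum Y n \<omega> t\<bar> \<le> x * \<sigma>}"
      let ?X = "\<lambda>x. \<lambda>i\<in>{..<n}. X i x"
      have mX: "?X \<in> M \<rightarrow>\<^sub>M sample N n" by measurable
      have "sup_cdf N Y n (x * \<sigma>) = measure (distr M (sample N n) ?X) ?H"
        unfolding sup_cdf_def M.distr_iid_sample[OF indep distr elim(2)] ..
      also have "\<dots> = measure M (?X -` ?H \<inter> space M)" by (rule measure_distr[OF mX sup_event_measurable])
      also have "\<dots> \<le> measure M ((\<lambda>x. (\<Sum>i<n. Y (X i x) t - 0) / sqrt (real n * \<sigma>\<^sup>2)) -` {-2 * x<..x} \<inter> space M)"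
      proof (intro M.finite_measure_mono)
        show "?X -` ?H \<inter> space M \<subseteq> (\<lambda>x. (\<Sum>i<n. Y (X i x) t - 0) / sqrt (real n * \<sigma>\<^sup>2)) -` {-2 * x<..x} \<inter> space M"
        proof
          fix w assume w: "w \<in> ?X -` ?H \<inter> space M"
          have "(\<Sum>i<n. Y (X i w) t - 0) / sqrt (real n * \<sigma>\<^sup>2) = normalized_sum Y n (?X w) t / \<sigma>"
            using \<sigma>(1) by (simp add: normalized_sum_def real_sqrt_mult)
          moreover have "\<bar>normalized_sum Y n (?X w) t\<bar> \<le> x * \<sigma>" using w by auto
          then have "- x \<le> normalized_sum Y n (?X w) t / \<sigma>" "normalized_sum Y n (?X w) t / \<sigma> \<le> x"
            using \<sigma> by (auto simp: field_simps abs_le_iff)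
          ultimately show "w \<in> (\<lambda>x. (\<Sum>i<n. Y (X i x) t - 0) / sqrt (real n * \<sigma>\<^sup>2)) -` {-2 * x<..x} \<inter> space M"
            using w x by auto
        qed
      qed measurable
      also have "\<dots> = measure (?\<mu> n) {-2 * x<..x}"
        by (rule measure_distr[symmetric]) measurable
      also have "\<dots> = cdf (?\<mu> n) x - cdf (?\<mu> n) (-2 * x)" using x by (intro D.cdf_diff_eq[symmetric]) auto
      finally show ?case using elim(1) by simp
    qed
  qed
qed

text \<open>If all variances vanish, then almost every path vanishes at all rationals and therefore everywhere.\<close>

lemma (in path_law) degenerate_sup_cdf:
  assumes "\<And>t. path_cov N Y t t = 0"
  shows "sup_cdf N Y n 0 = 1"
proof -
  interpret S: prob_space "sample N n" by (rule prob_space_sample)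
  have sq: "(Y v t)\<^sup>2 \<le> (C * T)\<^sup>2" if "v \<in> space N" for v t
    using power_mono[OF path_bound[OF that], of t 2] by simp
  have "AE v in N. Y v t = 0" for t
  proof -
    have "(\<integral>v. (Y v t)\<^sup>2 \<partial>N) = 0" using assms[of t] by (simp add: path_cov_def power2_eq_square)
    moreover have "integrable N (\<lambda>v. (Y v t)\<^sup>2)" using sq by (intro integrable_bounded[where K="(C * T)\<^sup>2"]) auto
    ultimately have "AE v in N. (Y v t)\<^sup>2 = 0"
      using integral_nonneg_eq_0_iff_AE[of N "\<lambda>v. (Y v t)\<^sup>2"] by auto
    then show ?thesis by auto
  qed
  then have "AE v in N. \<forall>t\<in>\<rat>. Y v t = 0"
    by (intro AE_ball_countable[THEN iffD2] countable_rat) auto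
  then have "AE \<omega> in sample N n. \<forall>t\<in>\<rat>. Y (\<omega> i) t = 0" if "i < n" for i
    using that by (intro AE_PiM_component prob_space_axioms) auto
  then have "AE \<omega> in sample N n. \<forall>i\<in>{..<n}. \<forall>t\<in>\<rat>. Y (\<omega> i) t = 0"
    by (rule AE_finite_allI[rotated]) auto
  then have "AE \<omega> in sample N n. \<forall>t. \<bar>normalized_sum Y n \<omega> t\<bar> \<le> 0"
  proof (rule AE_mp, intro AE_I2 impI)
    fix \<omega> assume sp: "\<omega> \<in> space (sample N n)" and z: "\<forall>i\<in>{..<n}. \<forall>t\<in>\<rat>. Y (\<omega> i) t = 0"
    have "\<forall>t\<in>\<rat>. \<bar>normalized_sum Y n \<omega> t\<bar> \<le> 0" using z by (simp add: normalized_sum_def)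
    then show "\<forall>t. \<bar>normalized_sum Y n \<omega> t\<bar> \<le> 0"
      using lip_path_all_rat[OF normalized_sum_lip_path[OF sp], of 0] by blast
  qed
  then show ?thesis
    unfolding sup_cdf_def by (simp only: S.prob_Collect_eq_1[OF sup_event_measurable])
qed

section \<open>The bootstrap distribution and its quantile\<close>

abbreviation resample_index :: "nat \<Rightarrow> nat pmf" where
  "resample_index n \<equiv> pmf_of_set {..<n}"

abbreviation index_pmf :: "nat \<Rightarrow> (nat \<Rightarrow> nat) pmf" where
  "index_pmf n \<equiv> Pi_pmf {..<n} n (\<lambda>_. resample_index n)"

abbreviation index_prob :: "nat \<Rightarrow> (nat \<Rightarrow> nat) set \<Rightarrow> real" where
  "index_prob n \<equiv> measure_pmf.prob (index_pmf n)"

text \<open>Resampling is described by the index of the drawn diagram rather than by the diagram, since the law of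
the indices does not depend on the data. Indices outside the sample get the zero path, so that every
index has a Lipschitz path.\<close>

definition bootstrap_path :: "nat \<Rightarrow> (nat \<Rightarrow> diagram) \<Rightarrow> nat \<Rightarrow> real \<Rightarrow> real" where
  "bootstrap_path n Ds i t = (if i < n then first_landscape (Ds i) t - avg_landscape n Ds t else 0)"

lemma sum_pmf_of_set_lessThan:
  fixes f :: "nat \<Rightarrow> real"
  assumes "0 < n"
  shows "(\<integral>i. f i \<partial>resample_index n) = (\<Sum>i<n. f i) / real n"
  using assms by (subst integral_pmf_of_set) auto

lemma avg_landscape_lip_path:
  assumes n: "0 < n" and T: "0 < T" and Ds: "\<And>i. i < n \<Longrightarrow> Ds i \<in> diagrams T"
  shows "lip_path T 1 (avg_landscape n Ds)"
proof -
  have "lip_path T (\<bar>1 / real n\<bar> * (\<Sum>i<n. 1)) (\<lambda>t. (1 / real n) * (\<Sum>i<n. first_landscape (Ds i) t))"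
    using Ds T by (intro lip_path_cmult lip_path_sum first_landscape_lip_path) auto
  then show ?thesis using n by (simp add: avg_landscape_def[abs_def])
qed

lemma bootstrap_path_law:
  assumes n: "0 < n" and T: "0 < T" and Ds: "\<And>i. i < n \<Longrightarrow> Ds i \<in> diagrams T"
  shows "path_law (resample_index n) (bootstrap_path n Ds) T 2"
proof -
  interpret prob_space "measure_pmf (resample_index n)" by (rule prob_space_measure_pmf)
  have lp: "lip_path T 2 (bootstrap_path n Ds i)" for i
  proof (cases "i < n")
    case True
    have "lip_path T (1 + 1) (\<lambda>t. first_landscape (Ds i) t - avg_landscape n Ds t)"
      using assms True by (intro lip_path_diff first_landscape_lip_path avg_landscape_lip_path) auto
    then show ?thesis using True by (simp add: bootstrap_path_def[abs_def])
  next
    case False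
    then show ?thesis by (simp add: bootstrap_path_def[abs_def] lip_path_def)
  qed
  show ?thesis
  proof
    show "(\<integral>i. bootstrap_path n Ds i t \<partial>resample_index n) = 0" for t
      using n by (simp add: sum_pmf_of_set_lessThan bootstrap_path_def avg_landscape_def sum_subtractf)
    show "(\<integral>i. (bootstrap_path n Ds i s - bootstrap_path n Ds i t)\<^sup>2 \<partial>resample_index n) \<le> 4 * (s - t)\<^sup>2" for s t
    proof -
      have "(bootstrap_path n Ds i s - bootstrap_path n Ds i t)\<^sup>2 \<le> 4 * (s - t)\<^sup>2" for i
        using power_mono[OF lip_pathD(1)[OF lp[of i], of s t], of 2] by (simp add: power_mult_distrib)
      then have "(\<Sum>i<n. (bootstrap_path n Ds i s - bootstrap_path n Ds i t)\<^sup>2) \<le> (\<Sum>i<n. 4 * (s - t)\<^sup>2)"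
        by (intro sum_mono) auto
      then show ?thesis using n by (simp add: sum_pmf_of_set_lessThan divide_le_eq mult.commute)
    qed
  qed (use T lp in auto)
qed

lemma sup_abs_nonneg_le:
  assumes S: "lip_path T C S" and "0 < T"
  shows "0 \<le> (SUP t. \<bar>S t\<bar>)" "(SUP t. \<bar>S t\<bar>) \<le> C * T"
proof -
  show "(SUP t. \<bar>S t\<bar>) \<le> C * T" using lip_path_sup_le_iff[OF assms] lip_path_bound[OF assms] by blast
  have "\<bar>S 0\<bar> \<le> (SUP t. \<bar>S t\<bar>)" using lip_path_sup_le_iff[OF assms, of "SUP t. \<bar>S t\<bar>"] by blast
  then show "0 \<le> (SUP t. \<bar>S t\<bar>)" by (rule order_trans[OF abs_ge_zero])
qed

lemma sup_abs_measurable: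
  assumes lp: "\<And>x. x \<in> space M \<Longrightarrow> lip_path T C (S x)" and T: "0 < T"
    and [measurable]: "\<And>t. (\<lambda>x. S x t) \<in> borel_measurable M"
  shows "(\<lambda>x. SUP t. \<bar>S x t\<bar>) \<in> borel_measurable M"
  unfolding borel_measurable_iff_le
proof
  fix r
  have "{x \<in> space M. (SUP t. \<bar>S x t\<bar>) \<le> r} = {x \<in> space M. \<forall>t\<in>\<rat>. \<bar>S x t\<bar> \<le> r}"
    using lip_path_sup_le_iff[OF lp T] lip_path_all_rat[OF lp] by blast
  also have "\<dots> \<in> sets M" using countable_rat by measurable
  finally show "{x \<in> space M. (SUP t. \<bar>S x t\<bar>) \<le> r} \<in> sets M" .
qed

definition index_stat :: "nat \<Rightarrow> (nat \<Rightarrow> diagram) \<Rightarrow> (nat \<Rightarrow> nat) \<Rightarrow> real" where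
  "index_stat n Ds h = (SUP t. \<bar>normalized_sum (bootstrap_path n Ds) n h t\<bar>)"

text \<open>A bootstrap sample is a uniformly distributed map of indices, composed with the data. The default value of the
product distribution of the indices is \<open>n\<close>, an index outside the sample that can be mapped to
\<open>undefined\<close>, the default value for diagrams.\<close>

lemma prob_bootstrap_sample:
  assumes n: "0 < n"
  shows "measure_pmf.prob (bootstrap_sample n Ds) {Ds'. bootstrap_stat n Ds Ds' \<in> A}
    = index_prob n {h. index_stat n Ds h \<in> A}"
proof -
  define f where "f i = (if i < n then Ds i else undefined)" for i
  have set: "set_pmf (resample_index n) = {..<n}" using n by (intro set_pmf_of_set) auto
  then have "map_pmf Ds (resample_index n) = map_pmf f (resample_index n)"
    by (intro map_pmf_cong) (auto simp: f_def)
  then have "bootstrap_sample n Ds = Pi_pmf {..<n} (f n) (\<lambda>_. map_pmf f (resample_index n))"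
    by (simp add: bootstrap_sample_def empirical_def f_def)
  also have "\<dots> = map_pmf (\<lambda>h. f \<circ> h) (index_pmf n)"
    by (rule Pi_pmf_map) auto
  finally have eq: "bootstrap_sample n Ds = map_pmf (\<lambda>h. f \<circ> h) (index_pmf n)" .
  have stat: "bootstrap_stat n Ds (f \<circ> h) = index_stat n Ds h"
    if h: "h \<in> set_pmf (index_pmf n)" for h
  proof -
    have hn: "h i < n" if "i < n" for i
      using h that by (auto simp: set_Pi_pmf PiE_dflt_def set)
    have "sqrt (real n) * (avg_landscape n (f \<circ> h) t - avg_landscape n Ds t) = normalized_sum (bootstrap_path n Ds) n h t" for t
    proof -
      have "(\<Sum>i<n. bootstrap_path n Ds (h i) t) = (\<Sum>i<n. first_landscape (f (h i)) t - avg_landscape n Ds t)"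
        using hn by (intro sum.cong) (auto simp: bootstrap_path_def f_def)
      also have "\<dots> = real n * (avg_landscape n (f \<circ> h) t - avg_landscape n Ds t)"
        using n by (simp add: sum_subtractf avg_landscape_def[of n "f \<circ> h"] right_diff_distrib)
      also have "\<dots> = sqrt (real n) * (sqrt (real n) * (avg_landscape n (f \<circ> h) t - avg_landscape n Ds t))"
        by (simp flip: mult.assoc)
      finally show ?thesis using n by (simp add: normalized_sum_def)
    qed
    then show ?thesis by (simp add: bootstrap_stat_def index_stat_def)
  qed
  show ?thesis
    unfolding eq measure_map_pmf
    by (rule measure_pmf.finite_measure_eq_AE) (auto simp: AE_measure_pmf_iff stat)
qed

text \<open>The coordinates of the product distribution are independent, so its law is the product measure.\<close>

lemma sup_cdf_bootstrap_path:
  assumes n: "0 < n" and T: "0 < T" and Ds: "\<And>i. i < n \<Longrightarrow> Ds i \<in> diagrams T"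
  shows "sup_cdf (resample_index n) (bootstrap_path n Ds) n r
    = index_prob n {h. index_stat n Ds h \<le> r}"
proof -
  interpret B: path_law "resample_index n" "bootstrap_path n Ds" T 2
    by (rule bootstrap_path_law[OF assms])
  let ?Q = "index_pmf n"
  let ?S = "sample (resample_index n) n"
  let ?re = "\<lambda>h. \<lambda>i\<in>{..<n}. h i"
  have comp: "distr (measure_pmf ?Q) (count_space UNIV) (\<lambda>h. h i) = resample_index n" if "i < n" for i
    using that Pi_pmf_component[of "{..<n}" i n "\<lambda>_. resample_index n"] by (simp add: map_pmf_rep_eq[symmetric])
  have "distr (measure_pmf ?Q) (PiM {..<n} (\<lambda>_. count_space UNIV)) ?re = (\<Pi>\<^sub>M i\<in>{..<n}. distr (measure_pmf ?Q) (count_space UNIV) (\<lambda>h. h i))"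
    using n indep_vars_Pi_pmf[of "{..<n}" n "\<lambda>_. resample_index n"]
      prob_space.indep_vars_iff_distr_eq_PiM'[OF prob_space_measure_pmf[of ?Q], where I="{..<n}" and M'="\<lambda>_. count_space UNIV" and X="\<lambda>i h. h i"]
    by auto
  also have "\<dots> = ?S" using comp by (intro PiM_cong) auto
  finally have d: "distr (measure_pmf ?Q) (PiM {..<n} (\<lambda>_. count_space UNIV)) ?re = ?S" .
  let ?H = "{\<omega> \<in> space ?S. \<forall>t. \<bar>normalized_sum (bootstrap_path n Ds) n \<omega> t\<bar> \<le> r}"
  have sets: "sets (PiM {..<n} (\<lambda>_. count_space UNIV)) = sets ?S"
    by (metis d sets_distr)
  have re: "?re h \<in> space ?S" for h by (simp add: space_PiM)
  have ns: "normalized_sum (bootstrap_path n Ds) n (?re h) = normalized_sum (bootstrap_path n Ds) n h" for h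
    by (simp add: normalized_sum_def fun_eq_iff)
  have "sup_cdf (resample_index n) (bootstrap_path n Ds) n r
      = measure (distr (measure_pmf ?Q) (PiM {..<n} (\<lambda>_. count_space UNIV)) ?re) ?H"
    unfolding sup_cdf_def d ..
  also have "\<dots> = measure_pmf.prob ?Q (?re -` ?H \<inter> space (measure_pmf ?Q))"
    using B.sup_event_measurable[of n r] by (intro measure_distr) (auto simp: sets space_PiM)
  also have "?re -` ?H \<inter> space (measure_pmf ?Q) = {h. index_stat n Ds h \<le> r}"
    using re lip_path_sup_le_iff[OF B.normalized_sum_lip_path[OF re] T]
    by (auto simp: index_stat_def ns)
  finally show ?thesis .
qed

context
  fixes n :: nat and T \<alpha> :: real and Ds :: "nat \<Rightarrow> diagram"
  assumes n: "0 < n" and T: "0 < T" and Ds: "\<And>i. i < n \<Longrightarrow> Ds i \<in> diagrams T" and \<alpha>: "0 < \<alpha>" "\<alpha> < 1"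
begin

interpretation B: path_law "resample_index n" "bootstrap_path n Ds" T 2
  by (rule bootstrap_path_law[OF n T Ds])

lemma index_stat_range: "0 \<le> index_stat n Ds h" "index_stat n Ds h \<le> 2 * sqrt (real n) * T"
proof -
  have "lip_path T (2 * sqrt (real n)) (normalized_sum (bootstrap_path n Ds) n (\<lambda>i\<in>{..<n}. h i))"
    by (rule B.normalized_sum_lip_path) (simp add: space_PiM)
  moreover have "normalized_sum (bootstrap_path n Ds) n (\<lambda>i\<in>{..<n}. h i) = normalized_sum (bootstrap_path n Ds) n h"
    by (simp add: normalized_sum_def fun_eq_iff)
  ultimately have "lip_path T (2 * sqrt (real n)) (normalized_sum (bootstrap_path n Ds) n h)" by simp
  from sup_abs_nonneg_le[OF this T] show "0 \<le> index_stat n Ds h" "index_stat n Ds h \<le> 2 * sqrt (real n) * T"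
    by (simp_all add: index_stat_def)
qed

lemma bootstrap_quantile_eq:
  "bootstrap_quantile \<alpha> n Ds = Inf {q. index_prob n {h. q \<le> index_stat n Ds h} \<le> \<alpha>}"
  using prob_bootstrap_sample[OF n, of Ds "{q..}" for q] by (simp add: bootstrap_quantile_def)

lemma quantile_set_nonempty: "2 * sqrt (real n) * T + 1 \<in> {q. index_prob n {h. q \<le> index_stat n Ds h} \<le> \<alpha>}"
proof -
  have "\<not> 2 * sqrt (real n) * T + 1 \<le> index_stat n Ds h" for h
    using index_stat_range(2)[of h] by linarith
  then show ?thesis using \<alpha> by simp
qed

lemma quantile_set_pos:
  assumes "q \<in> {q. index_prob n {h. q \<le> index_stat n Ds h} \<le> \<alpha>}"
  shows "0 < q"
proof (rule ccontr)
  assume "\<not> 0 < q"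
  then have "q \<le> index_stat n Ds h" for h using index_stat_range(1)[of h] by linarith
  then show False using assms \<alpha> by simp
qed

lemma bootstrap_quantile_nonneg: "0 \<le> bootstrap_quantile \<alpha> n Ds"
  unfolding bootstrap_quantile_eq using quantile_set_nonempty quantile_set_pos
  by (intro cInf_greatest) (auto intro: less_imp_le)

lemma bootstrap_cdf_above_quantile:
  assumes "bootstrap_quantile \<alpha> n Ds < r"
  shows "1 - \<alpha> \<le> sup_cdf (resample_index n) (bootstrap_path n Ds) n r"
proof -
  obtain q where q: "index_prob n {h. q \<le> index_stat n Ds h} \<le> \<alpha>" "q < r"
    using assms cInf_lessD[of "{q. index_prob n {h. q \<le> index_stat n Ds h} \<le> \<alpha>}" r] quantile_set_nonempty
    unfolding bootstrap_quantile_eq by blast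
  have "1 - index_prob n {h. q \<le> index_stat n Ds h} = index_prob n (UNIV - {h. q \<le> index_stat n Ds h})"
    using measure_pmf.prob_compl[of "{h. q \<le> index_stat n Ds h}"] by simp
  also have "\<dots> \<le> index_prob n {h. index_stat n Ds h \<le> r}"
    using q(2) by (intro measure_pmf.finite_measure_mono) auto
  finally show ?thesis using q(1) by (simp add: sup_cdf_bootstrap_path[OF n T Ds])
qed

lemma bootstrap_cdf_below_quantile:
  assumes "r < bootstrap_quantile \<alpha> n Ds"
  shows "sup_cdf (resample_index n) (bootstrap_path n Ds) n r \<le> 1 - \<alpha>"
proof -
  obtain q where q: "r < q" "q < bootstrap_quantile \<alpha> n Ds" using dense assms by blast
  have "bdd_below {q. index_prob n {h. q \<le> index_stat n Ds h} \<le> \<alpha>}"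
    using quantile_set_pos by (intro bdd_belowI[of _ 0]) (auto intro: less_imp_le)
  then have "q \<notin> {q. index_prob n {h. q \<le> index_stat n Ds h} \<le> \<alpha>}"
    using q(2) unfolding bootstrap_quantile_eq by (meson cInf_lower not_le)
  then have "\<alpha> < index_prob n {h. q \<le> index_stat n Ds h}" by simp
  moreover have "index_prob n {h. index_stat n Ds h \<le> r} \<le> index_prob n (UNIV - {h. q \<le> index_stat n Ds h})"
    using q(1) by (intro measure_pmf.finite_measure_mono) auto
  moreover have "index_prob n (UNIV - {h. q \<le> index_stat n Ds h}) = 1 - index_prob n {h. q \<le> index_stat n Ds h}"
    using measure_pmf.prob_compl[of "{h. q \<le> index_stat n Ds h}"] by simp
  ultimately show ?thesis by (simp add: sup_cdf_bootstrap_path[OF n T Ds])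
qed

text \<open>The probability of exceeding \<open>q\<close> decreases in \<open>q\<close>, so the infimum may be taken over
rational numbers.\<close>

lemma bootstrap_quantile_less_iff:
  "bootstrap_quantile \<alpha> n Ds < c \<longleftrightarrow> (\<exists>r\<in>\<rat>. r < c \<and> index_prob n {h. r \<le> index_stat n Ds h} \<le> \<alpha>)"
proof
  assume "bootstrap_quantile \<alpha> n Ds < c"
  then obtain q where q: "index_prob n {h. q \<le> index_stat n Ds h} \<le> \<alpha>" "q < c"
    using cInf_lessD[of "{q. index_prob n {h. q \<le> index_stat n Ds h} \<le> \<alpha>}" c] quantile_set_nonempty
    unfolding bootstrap_quantile_eq by blast
  obtain r where r: "r \<in> \<rat>" "q < r" "r < c" using Rats_dense_in_real[OF q(2)] by blast
  have "index_prob n {h. r \<le> index_stat n Ds h} \<le> index_prob n {h. q \<le> index_stat n Ds h}"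
    using r by (intro measure_pmf.finite_measure_mono) auto
  then show "\<exists>r\<in>\<rat>. r < c \<and> index_prob n {h. r \<le> index_stat n Ds h} \<le> \<alpha>" using q r by force
next
  assume "\<exists>r\<in>\<rat>. r < c \<and> index_prob n {h. r \<le> index_stat n Ds h} \<le> \<alpha>"
  then obtain r where r: "r < c" "index_prob n {h. r \<le> index_stat n Ds h} \<le> \<alpha>" by blast
  have "bdd_below {q. index_prob n {h. q \<le> index_stat n Ds h} \<le> \<alpha>}"
    using quantile_set_pos by (intro bdd_belowI[of _ 0]) (auto intro: less_imp_le)
  then have "bootstrap_quantile \<alpha> n Ds \<le> r" unfolding bootstrap_quantile_eq using r(2) by (intro cInf_lower) auto
  then show "bootstrap_quantile \<alpha> n Ds < c" using r(1) by simp
qed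

end

lemma index_prob_eq_average:
  assumes n: "0 < n"
  shows "index_prob n A
    = (\<Sum>h\<in>PiE_dflt {..<n} n (\<lambda>_. {..<n}). indicator A h) / real (card (PiE_dflt {..<n} n (\<lambda>_. {..<n})))"
proof -
  have fin: "finite (PiE_dflt {..<n} n (\<lambda>_. {..<n}))" by (intro finite_PiE_dflt) auto
  have ne: "PiE_dflt {..<n} n (\<lambda>_. {..<n}) \<noteq> {}" using n by auto
  have "index_pmf n = pmf_of_set (PiE_dflt {..<n} n (\<lambda>_. {..<n}))"
    using n by (intro Pi_pmf_of_set) auto
  then show ?thesis
    using fin ne by (simp add: measure_pmf_of_set sum.If_cases indicator_def Int_def)
qed

text \<open>A bootstrap probability is the average over the finitely many maps of indices of the indicator
of an event on the data; the quantile is obtained from countably many of these probabilities.\<close>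

lemma bootstrap_quantile_measurable:
  assumes n: "0 < n" and T: "0 < T" and \<alpha>: "0 < \<alpha>" "\<alpha> < 1" and P: "space P = diagrams T"
    and meas[measurable]: "\<And>t. (\<lambda>D. first_landscape D t) \<in> borel_measurable P"
  shows "(\<lambda>Ds. bootstrap_quantile \<alpha> n Ds) \<in> borel_measurable (sample P n)"
  unfolding borel_measurable_iff_less
proof
  fix c
  have Ds: "Ds i \<in> diagrams T" if "Ds \<in> space (sample P n)" "i < n" for Ds i
    using that P by (auto simp: space_PiM)
  have stat: "(\<lambda>Ds. index_stat n Ds h) \<in> borel_measurable (sample P n)"
    if h: "h \<in> PiE_dflt {..<n} n (\<lambda>_. {..<n})" for h
    unfolding index_stat_def
  proof (rule sup_abs_measurable[OF _ T])
    fix Ds assume sp: "Ds \<in> space (sample P n)"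
    interpret B: path_law "resample_index n" "bootstrap_path n Ds" T 2
      using n T Ds[OF sp] by (rule bootstrap_path_law)
    have "lip_path T (2 * sqrt (real n)) (normalized_sum (bootstrap_path n Ds) n (\<lambda>i\<in>{..<n}. h i))"
      by (rule B.normalized_sum_lip_path) (simp add: space_PiM)
    moreover have "normalized_sum (bootstrap_path n Ds) n (\<lambda>i\<in>{..<n}. h i) = normalized_sum (bootstrap_path n Ds) n h"
      by (simp add: normalized_sum_def fun_eq_iff)
    ultimately show "lip_path T (2 * sqrt (real n)) (normalized_sum (bootstrap_path n Ds) n h)" by simp
  next
    fix t
    have hn: "h i < n" if "i < n" for i using h that by (auto simp: PiE_dflt_def)
    have comp: "(\<lambda>Ds. first_landscape (Ds j) t) \<in> borel_measurable (sample P n)" if "j < n" for j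
      using measurable_compose[OF measurable_component_singleton[of j "{..<n}" "\<lambda>_. P"] meas] that by simp
    have "(\<lambda>Ds. (\<Sum>i<n. first_landscape (Ds (h i)) t - (1 / real n) * (\<Sum>j<n. first_landscape (Ds j) t)) / sqrt (real n)) \<in> borel_measurable (sample P n)"
      using hn by (intro borel_measurable_divide borel_measurable_sum borel_measurable_diff borel_measurable_times borel_measurable_const comp) auto
    also have "(\<lambda>Ds. (\<Sum>i<n. first_landscape (Ds (h i)) t - (1 / real n) * (\<Sum>j<n. first_landscape (Ds j) t)) / sqrt (real n))
      = (\<lambda>Ds. normalized_sum (bootstrap_path n Ds) n h t)"
      using hn by (intro ext) (simp add: normalized_sum_def bootstrap_path_def avg_landscape_def)
    finally show "(\<lambda>Ds. normalized_sum (bootstrap_path n Ds) n h t) \<in> borel_measurable (sample P n)" .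
  qed
  have ip: "(\<lambda>Ds. index_prob n {h. r \<le> index_stat n Ds h}) \<in> borel_measurable (sample P n)" for r
  proof -
    have "(\<lambda>Ds. indicator {h. r \<le> index_stat n Ds h} h :: real) \<in> borel_measurable (sample P n)"
      if h: "h \<in> PiE_dflt {..<n} n (\<lambda>_. {..<n})" for h
    proof -
      note [measurable] = stat[OF h]
      have "(\<lambda>Ds. indicator {h. r \<le> index_stat n Ds h} h :: real) = (\<lambda>Ds. if r \<le> index_stat n Ds h then 1 else 0)"
        by (auto simp: indicator_def)
      also have "\<dots> \<in> borel_measurable (sample P n)" by measurable
      finally show ?thesis .
    qed
    then show ?thesis unfolding index_prob_eq_average[OF n] by (intro borel_measurable_divide borel_measurable_sum borel_measurable_const)
  qed
  have "{Ds \<in> space (sample P n). bootstrap_quantile \<alpha> n Ds < c}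
    = (\<Union>r\<in>{r\<in>\<rat>. r < c}. {Ds \<in> space (sample P n). index_prob n {h. r \<le> index_stat n Ds h} \<le> \<alpha>})"
  proof -
    have "bootstrap_quantile \<alpha> n Ds < c \<longleftrightarrow> (\<exists>r\<in>\<rat>. r < c \<and> index_prob n {h. r \<le> index_stat n Ds h} \<le> \<alpha>)"
      if "Ds \<in> space (sample P n)" for Ds
      using n T Ds[OF that] \<alpha> by (rule bootstrap_quantile_less_iff)
    then show ?thesis by auto
  qed
  also have "\<dots> \<in> sets (sample P n)"
    using ip by (intro sets.countable_UN'' countable_subset[OF _ countable_rat]) auto
  finally show "{Ds \<in> space (sample P n). bootstrap_quantile \<alpha> n Ds < c} \<in> sets (sample P n)" .
qed

section \<open>Coverage of the confidence band\<close>

text \<open>On \<open>G\<close> the random \<open>q\<close> lies between \<open>l\<close>, the infimum of all \<open>r\<close> with \<open>F r \<ge> 1 - \<alpha> - e\<close>, and \<open>u\<close>, the supremum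
of all \<open>r\<close> with \<open>F r \<le> 1 - \<alpha> + e\<close>. Hence the probability in question lies between \<open>F l\<close> and \<open>F u\<close> up to
the probability of the complement of \<open>G\<close>. Since \<open>F\<close> grows by at most \<open>e\<close> on intervals of length \<open>\<delta>\<close>, it
is at least \<open>1 - \<alpha> - 2 e\<close> at \<open>l\<close> and at most \<open>1 - \<alpha> + 2 e\<close> at \<open>u\<close>.\<close>

lemma (in prob_space) quantile_coverage:
  fixes \<theta> q :: "'a \<Rightarrow> real"
  assumes [measurable]: "\<theta> \<in> borel_measurable M" "q \<in> borel_measurable M" "G \<in> events"
    and ran: "\<And>x. x \<in> space M \<Longrightarrow> 0 \<le> \<theta> x \<and> \<theta> x \<le> R"
    and F: "\<And>r. F r = prob {x \<in> space M. \<theta> x \<le> r}"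
    and lo: "\<And>x r. x \<in> G \<Longrightarrow> q x < r \<Longrightarrow> 1 - \<alpha> - e \<le> F r"
    and hi: "\<And>x r. x \<in> G \<Longrightarrow> r < q x \<Longrightarrow> F r \<le> 1 - \<alpha> + e"
    and ac: "\<And>r. F (r + \<delta>) - F r \<le> e" and \<delta>: "0 < \<delta>" and \<alpha>: "0 < \<alpha>" "\<alpha> < 1" and e: "0 < e"
  shows "\<bar>prob {x \<in> space M. \<theta> x \<le> q x} - (1 - \<alpha>)\<bar> \<le> 2 * e + (1 - prob G)"
proof -
  have Gsp: "G \<subseteq> space M" by (rule sets.sets_into_space) measurable
  have mono: "F a \<le> F b" if "a \<le> b" for a b
    unfolding F using that by (intro finite_measure_mono) auto
  have neg: "F r = 0" if "r < 0" for r
  proof -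
    have "{x \<in> space M. \<theta> x \<le> r} = {}" using ran that by force
    then show ?thesis by (simp only: F measure_empty)
  qed
  have big: "F r = 1" if "R \<le> r" for r
  proof -
    have "{x \<in> space M. \<theta> x \<le> r} = space M" using ran that by force
    then show ?thesis by (simp only: F prob_space)
  qed
  let ?P = "prob {x \<in> space M. \<theta> x \<le> q x}"
  have "1 - \<alpha> - 2 * e - (1 - prob G) \<le> ?P"
  proof (cases "1 - \<alpha> - e \<le> 0")
    case True
    have "0 \<le> ?P" "prob G \<le> 1" by auto
    then show ?thesis using True e by linarith
  next
    case False
    define A where "A = {r. 1 - \<alpha> - e \<le> F r}"
    have ne: "A \<noteq> {}" using big[of R] \<alpha> e by (auto simp: A_def intro!: exI[of _ R])
    have bdd: "bdd_below A"
      using neg False by (intro bdd_belowI[of _ 0]) (force simp: A_def not_le[symmetric])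
    define l where "l = Inf A"
    obtain r where r: "r \<in> A" "r < l + \<delta>"
      using cInf_lessD[OF ne, of "l + \<delta>"] \<delta> by (auto simp: l_def)
    have "1 - \<alpha> - e \<le> F (l + \<delta>)" using r mono[of r "l + \<delta>"] by (simp add: A_def)
    then have Fl: "1 - \<alpha> - 2 * e \<le> F l" using ac[of l] by simp
    have ql: "l \<le> q x" if "x \<in> G" for x
    proof (rule ccontr)
      assume "\<not> l \<le> q x"
      then obtain s where s: "q x < s" "s < l" using dense[of "q x" l] by auto
      then have "s \<in> A" using lo[OF that] by (simp add: A_def)
      then have "l \<le> s" unfolding l_def using bdd by (rule cInf_lower)
      then show False using s by simp
    qed
    have "F l \<le> prob ({x \<in> space M. \<theta> x \<le> q x} \<union> (space M - G))"
      unfolding F using ql by (intro finite_measure_mono) force+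
    also have "\<dots> \<le> ?P + prob (space M - G)" by (intro measure_Un_le) auto
    also have "prob (space M - G) = 1 - prob G" by (rule prob_compl) measurable
    finally show ?thesis using Fl by simp
  qed
  moreover have "?P \<le> 1 - \<alpha> + 2 * e + (1 - prob G)"
  proof (cases "1 \<le> 1 - \<alpha> + e")
    case True
    have "?P \<le> 1" "prob G \<le> 1" by auto
    then show ?thesis using True e by linarith
  next
    case False
    define A where "A = {r. F r \<le> 1 - \<alpha> + e}"
    have ne: "A \<noteq> {}" using neg[of "-1"] \<alpha> e by (auto simp: A_def intro!: exI[of _ "-1"])
    have bdd: "bdd_above A"
    proof (rule bdd_aboveI[of _ R])
      fix r assume "r \<in> A"
      then have "F r \<noteq> 1" using False by (auto simp: A_def)
      then show "r \<le> R" using big[of r] by linarith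
    qed
    define u where "u = Sup A"
    obtain r where r: "r \<in> A" "u - \<delta> < r"
      using less_cSupD[OF ne, of "u - \<delta>"] \<delta> by (auto simp: u_def)
    have "F (u - \<delta>) \<le> 1 - \<alpha> + e" using r mono[of "u - \<delta>" r] by (simp add: A_def)
    then have Fu: "F u \<le> 1 - \<alpha> + 2 * e" using ac[of "u - \<delta>"] by simp
    have qu: "q x \<le> u" if "x \<in> G" for x
    proof (rule ccontr)
      assume "\<not> q x \<le> u"
      then obtain s where s: "u < s" "s < q x" using dense[of u "q x"] by auto
      then have "s \<in> A" using hi[OF that] by (simp add: A_def)
      then have "s \<le> u" unfolding u_def using bdd by (rule cSup_upper)
      then show False using s by simp
    qed
    have "?P \<le> prob ({x \<in> space M. \<theta> x \<le> u} \<union> (space M - G))"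
      using qu by (intro finite_measure_mono) force+
    also have "\<dots> \<le> F u + prob (space M - G)" unfolding F by (intro measure_Un_le) auto
    also have "prob (space M - G) = 1 - prob G" by (rule prob_compl) measurable
    finally show ?thesis using Fu by simp
  qed
  ultimately show ?thesis unfolding abs_le_iff by linarith
qed
definition centered_landscape :: "diagram measure \<Rightarrow> diagram \<Rightarrow> real \<Rightarrow> real" where
  "centered_landscape P D t = first_landscape D t - mean_landscape P t"

lemma landscape_path_law:
  assumes T: "0 < T" and P: "prob_space P" and sp: "space P = diagrams T"
    and meas[measurable]: "\<And>t. (\<lambda>D. first_landscape D t) \<in> borel_measurable P"
  shows "path_law P (centered_landscape P) T 2"
proof -
  interpret prob_space P by fact
  have lp: "lip_path T 1 (first_landscape D)" if "D \<in> space P" for D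
    using that sp first_landscape_lip_path[OF _ T] by simp
  have int: "integrable P (\<lambda>D. first_landscape D t)" for t
    using lip_path_bound[OF lp T] by (intro integrable_bounded[where K="1 * T"]) auto
  have mean: "lip_path T 1 (mean_landscape P)"
    unfolding lip_path_def
  proof (intro conjI allI impI)
    fix s t
    have "mean_landscape P s - mean_landscape P t = (\<integral>D. first_landscape D s - first_landscape D t \<partial>P)"
      unfolding mean_landscape_def using int by simp
    also have "\<bar>\<dots>\<bar> \<le> 1 * \<bar>s - t\<bar>"
      using lip_pathD(1)[OF lp] by (intro abs_integral_le_bound) auto
    finally show "\<bar>mean_landscape P s - mean_landscape P t\<bar> \<le> 1 * \<bar>s - t\<bar>" .
  next
    fix t assume "t \<le> 0 \<or> T \<le> t"
    then have "first_landscape D t = 0" if "D \<in> space P" for D using lip_pathD(2,3)[OF lp[OF that], of t] by auto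
    then have "mean_landscape P t = (\<integral>D. 0 \<partial>P)" unfolding mean_landscape_def by (intro Bochner_Integration.integral_cong) auto
    then show "mean_landscape P t = 0" by simp
  qed
  have lpc: "lip_path T 2 (centered_landscape P D)" if "D \<in> space P" for D
    using lip_path_diff[OF lp[OF that] mean] by (simp add: centered_landscape_def[abs_def])
  show ?thesis
  proof
    show "(\<lambda>D. centered_landscape P D t) \<in> borel_measurable P" for t unfolding centered_landscape_def by measurable
    show "(\<integral>D. centered_landscape P D t \<partial>P) = 0" for t
      unfolding centered_landscape_def using int by (simp add: prob_space mean_landscape_def)
    show "(\<integral>D. (centered_landscape P D s - centered_landscape P D t)\<^sup>2 \<partial>P) \<le> 4 * (s - t)\<^sup>2" for s t
    proof -
      have "\<bar>\<integral>D. (centered_landscape P D s - centered_landscape P D t)\<^sup>2 \<partial>P\<bar> \<le> 4 * (s - t)\<^sup>2"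
      proof (rule abs_integral_le_bound)
        show "\<bar>(centered_landscape P D s - centered_landscape P D t)\<^sup>2\<bar> \<le> 4 * (s - t)\<^sup>2" if "D \<in> space P" for D
          using power_mono[OF lip_pathD(1)[OF lpc[OF that], of s t], of 2] by (simp add: power_mult_distrib)
      qed (unfold centered_landscape_def, measurable)
      then show ?thesis by simp
    qed
  qed (use T lpc in auto)
qed

lemma mean_in_confidence_band_iff:
  assumes n: "0 < n"
  shows "mean_landscape P t \<in> confidence_band \<alpha> n Ds t
    \<longleftrightarrow> \<bar>normalized_sum (centered_landscape P) n Ds t\<bar> \<le> bootstrap_quantile \<alpha> n Ds"
proof -
  let ?d = "avg_landscape n Ds t - mean_landscape P t"
  have "(\<Sum>i<n. centered_landscape P (Ds i) t) = real n * ?d"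
    using n by (simp add: centered_landscape_def sum_subtractf avg_landscape_def right_diff_distrib)
  also have "\<dots> = sqrt (real n) * (sqrt (real n) * ?d)" by (simp flip: mult.assoc)
  finally have ns: "normalized_sum (centered_landscape P) n Ds t = sqrt (real n) * ?d"
    using n by (simp add: normalized_sum_def)
  have "mean_landscape P t \<in> confidence_band \<alpha> n Ds t \<longleftrightarrow> \<bar>?d\<bar> \<le> bootstrap_quantile \<alpha> n Ds / sqrt (real n)"
    by (auto simp: confidence_band_def abs_le_iff)
  also have "\<dots> \<longleftrightarrow> sqrt (real n) * \<bar>?d\<bar> \<le> bootstrap_quantile \<alpha> n Ds"
    using n by (simp add: le_divide_eq mult.commute)
  finally show ?thesis unfolding ns by (simp add: abs_mult)
qed

lemma avg_landscape_restrict: "avg_landscape n (\<lambda>i\<in>{..<n}. Ds i) = avg_landscape n Ds"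
  by (simp add: avg_landscape_def fun_eq_iff)

text \<open>The quantile at time \<open>n\<close> is a function of the first \<open>n\<close> diagrams.\<close>

lemma bootstrap_quantile_restrict:
  assumes n: "0 < n"
  shows "bootstrap_quantile \<alpha> n (\<lambda>i\<in>{..<n}. Ds i) = bootstrap_quantile \<alpha> n Ds"
proof -
  have "set_pmf (resample_index n) = {..<n}" using n by (intro set_pmf_of_set) auto
  then have "empirical n (\<lambda>i\<in>{..<n}. Ds i) = empirical n Ds"
    unfolding empirical_def by (intro map_pmf_cong) auto
  then show ?thesis
    by (simp add: bootstrap_quantile_def bootstrap_sample_def bootstrap_stat_def avg_landscape_restrict)
qed

text \<open>Centring at the mean landscape instead of the empirical mean landscape changes the empirical
second moments by a product of two empirical means.\<close>

lemma bootstrap_cov: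
  assumes n: "0 < n"
  shows "path_cov (resample_index n) (bootstrap_path n Ds) s t
    = (\<Sum>i<n. centered_landscape P (Ds i) s * centered_landscape P (Ds i) t) / real n
      - ((\<Sum>i<n. centered_landscape P (Ds i) s) / real n) * ((\<Sum>i<n. centered_landscape P (Ds i) t) / real n)"
proof -
  define m where "m t = (\<Sum>i<n. centered_landscape P (Ds i) t) / real n" for t
  have m: "(\<Sum>i<n. centered_landscape P (Ds i) t) = real n * m t" for t using n by (simp add: m_def)
  have b: "bootstrap_path n Ds i t = centered_landscape P (Ds i) t - m t" if "i < n" for i t
    using that n by (simp add: bootstrap_path_def m_def centered_landscape_def sum_subtractf avg_landscape_def diff_divide_distrib)
  have "(\<Sum>i<n. bootstrap_path n Ds i s * bootstrap_path n Ds i t)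
    = (\<Sum>i<n. centered_landscape P (Ds i) s * centered_landscape P (Ds i) t - m t * centered_landscape P (Ds i) s
        - m s * centered_landscape P (Ds i) t + m s * m t)"
    by (intro sum.cong) (auto simp: b algebra_simps)
  also have "\<dots> = (\<Sum>i<n. centered_landscape P (Ds i) s * centered_landscape P (Ds i) t) - real n * (m s * m t)"
    by (simp add: sum.distrib sum_subtractf sum_distrib_left[symmetric] m algebra_simps)
  finally show ?thesis
    using n unfolding path_cov_def sum_pmf_of_set_lessThan[OF n] m_def[symmetric] by (simp add: diff_divide_distrib)
qed

text \<open>The event \<open>G1 \<inter> G2\<close>, on which the empirical covariances and means are accurate on the grid, has probability
tending to 1. On it the distribution functions of the data and of the bootstrap differ by at most \<open>4 e\<close>
everywhere: three errors come from the comparison, and one from the shift of the argument by \<open>5 \<eta> \<le> \<delta>\<close>.\<close>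

lemma coverage_limit_nondegenerate:
  assumes T: "0 < T" and \<alpha>: "0 < \<alpha>" "\<alpha> < 1" and P: "prob_space P" and sp: "space P = diagrams T"
    and meas: "\<And>t. (\<lambda>D. first_landscape D t) \<in> borel_measurable P"
    and equi: "\<And>e. 0 < e \<Longrightarrow> \<exists>\<delta>>0. eventually (\<lambda>n. \<forall>r. sup_cdf P (centered_landscape P) n (r + \<delta>) - sup_cdf P (centered_landscape P) n r \<le> e) sequentially"
  shows "(\<lambda>n. measure (sample P n) {Ds \<in> space (sample P n). (SUP t. \<bar>normalized_sum (centered_landscape P) n Ds t\<bar>) \<le> bootstrap_quantile \<alpha> n Ds})
    \<longlonglongrightarrow> 1 - \<alpha>"
  unfolding LIMSEQ_iff
proof (intro allI impI)
  fix e0 :: real assume e0: "0 < e0"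
  define e where "e = e0 / 20"
  have e: "0 < e" using e0 by (simp add: e_def)
  let ?Y = "centered_landscape P"
  interpret Y: path_law P ?Y T 2 by (rule landscape_path_law[OF T P sp meas])
  obtain \<delta> where \<delta>: "0 < \<delta>" and ac: "eventually (\<lambda>n. \<forall>r. sup_cdf P ?Y n (r + \<delta>) - sup_cdf P ?Y n r \<le> e) sequentially"
    using equi[OF e] by blast
  define \<eta> where "\<eta> = min 1 (\<delta> / 5)"
  have \<eta>: "0 < \<eta>" "\<eta> \<le> 1" "5 * \<eta> \<le> \<delta>" using \<delta> by (auto simp: \<eta>_def)
  define k where "k = Suc (nat \<lceil>4 * T\<^sup>2 / (\<eta>\<^sup>2 * e)\<rceil>)"
  have k: "0 < k" "4 * T\<^sup>2 / (\<eta>\<^sup>2 * e) \<le> real k" unfolding k_def by linarith+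
  have k2: "4 * T\<^sup>2 / (real k * \<eta>\<^sup>2) \<le> e" using k \<eta> e by (simp add: field_simps)
  obtain K where K: "\<And>r. smooth3 {..k} K (bump {..k} \<eta> r)" using smooth3_bump[OF finite_atMost \<eta>(1,2), of k] by blast
  have K0: "0 \<le> K" using smooth3D(1)[OF K, of undefined undefined] by linarith
  define \<epsilon> where "\<epsilon> = e / (K + 1) / (real k + 1)\<^sup>2"
  have \<epsilon>: "0 < \<epsilon>" using e K0 by (simp add: \<epsilon>_def)
  \<comment> \<open>A product of two empirical means of size at most \<open>\<epsilon>'\<close> is at most \<open>\<epsilon> / 2\<close>.\<close>
  define \<epsilon>' where "\<epsilon>' = min 1 (\<epsilon> / 2)"
  have \<epsilon>': "0 < \<epsilon>'" "\<epsilon>' \<le> 1" "\<epsilon>' \<le> \<epsilon> / 2" using \<epsilon> by (auto simp: \<epsilon>'_def)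
  define G1 where "G1 n = {\<omega> \<in> space (sample P n). \<forall>p\<in>{..k} \<times> {..k}.
      \<bar>(\<Sum>i<n. ?Y (\<omega> i) (grid T k (fst p)) * ?Y (\<omega> i) (grid T k (snd p))) / real n - path_cov P ?Y (grid T k (fst p)) (grid T k (snd p))\<bar> \<le> \<epsilon> / 2}" for n
  define G2 where "G2 n = {\<omega> \<in> space (sample P n). \<forall>j\<in>{..k}. \<bar>(\<Sum>i<n. ?Y (\<omega> i) (grid T k j)) / real n\<bar> \<le> \<epsilon>'}" for n
  define b1 where "b1 = (real k + 1)\<^sup>2 * ((2 * (2 * T)\<^sup>2)\<^sup>2 / (\<epsilon> / 2)\<^sup>2)"
  define b2 where "b2 = (real k + 1) * ((2 * (2 * T))\<^sup>2 / \<epsilon>'\<^sup>2)"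
  have lim: "eventually (\<lambda>n. b / real n \<le> e) sequentially" for b :: real
  proof -
    have "(\<lambda>n. b / real n) \<longlonglongrightarrow> 0" by (rule lim_const_over_n)
    from order_tendstoD(2)[OF this e] show ?thesis by eventually_elim simp
  qed
  have small: "eventually (\<lambda>n. 2 * K * (2 * T) ^ 3 / sqrt (real n) \<le> e) sequentially"
    using e by (rule eventually_div_sqrt_le)
  have "eventually (\<lambda>n. \<bar>measure (sample P n) {Ds \<in> space (sample P n). (SUP t. \<bar>normalized_sum ?Y n Ds t\<bar>) \<le> bootstrap_quantile \<alpha> n Ds} - (1 - \<alpha>)\<bar> < e0) sequentially"
    using ac small lim[of b1] lim[of b2] eventually_sqrt_ge[of "2 * T"] eventually_gt_at_top[of 0]
  proof eventually_elim
    case (elim n)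
    have n: "0 < n" using elim by simp
    interpret S: prob_space "sample P n" by (rule Y.prob_space_sample)
    let ?\<theta> = "\<lambda>Ds. SUP t. \<bar>normalized_sum ?Y n Ds t\<bar>"
    let ?q = "bootstrap_quantile \<alpha> n"
    note lp = Y.normalized_sum_lip_path
    have m\<theta>: "?\<theta> \<in> borel_measurable (sample P n)"
      by (rule sup_abs_measurable[OF lp T]) (auto intro: Y.normalized_sum_measurable)
    have mq: "?q \<in> borel_measurable (sample P n)"
      by (rule bootstrap_quantile_measurable[OF n T \<alpha> sp meas])
    have mG1: "G1 n \<in> sets (sample P n)" unfolding G1_def by measurable
    have mG2: "G2 n \<in> sets (sample P n)" unfolding G2_def by measurable
    have pG1: "1 - e \<le> S.prob (G1 n)"
      using Y.covariance_lln[OF n, of "\<epsilon> / 2" k] \<epsilon> elim(3) by (simp add: G1_def b1_def)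
    have pG2: "1 - e \<le> S.prob (G2 n)"
      using Y.mean_lln[OF n \<epsilon>'(1), of k] elim(4) by (simp add: G2_def b2_def)
    let ?G = "G1 n \<inter> G2 n"
    have mG: "?G \<in> sets (sample P n)" using mG1 mG2 by auto
    have pG: "1 - 2 * e \<le> S.prob ?G"
    proof -
      have "S.prob (space (sample P n) - ?G) \<le> S.prob ((space (sample P n) - G1 n) \<union> (space (sample P n) - G2 n))"
        using mG1 mG2 by (intro S.finite_measure_mono) auto
      also have "\<dots> \<le> S.prob (space (sample P n) - G1 n) + S.prob (space (sample P n) - G2 n)"
        using mG1 mG2 by (intro measure_Un_le) auto
      finally show ?thesis using pG1 pG2 by (simp add: S.prob_compl mG mG1 mG2)
    qed
    have compare: "sup_cdf (resample_index n) (bootstrap_path n Ds) n r \<le> sup_cdf P ?Y n r + 4 * e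
        \<and> sup_cdf P ?Y n r \<le> sup_cdf (resample_index n) (bootstrap_path n Ds) n r + 4 * e"
      if G: "Ds \<in> ?G" for Ds r
    proof -
      let ?B = "measure_pmf (resample_index n)" and ?Z = "bootstrap_path n Ds"
      have spD: "Ds \<in> space (sample P n)" using G by (simp add: G1_def)
      have Dsi: "Ds i \<in> diagrams T" if "i < n" for i using spD that sp by (auto simp: space_PiM)
      interpret B: path_law ?B ?Z T 2 by (rule bootstrap_path_law[OF n T Dsi])
      have c: "\<bar>path_cov ?B ?Z (grid T k i) (grid T k j) - path_cov P ?Y (grid T k i) (grid T k j)\<bar> \<le> \<epsilon>" if ij: "i \<le> k" "j \<le> k" for i j
      proof -
        have 1: "\<bar>(\<Sum>l<n. ?Y (Ds l) (grid T k i) * ?Y (Ds l) (grid T k j)) / real n - path_cov P ?Y (grid T k i) (grid T k j)\<bar> \<le> \<epsilon> / 2"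
          using G ij by (force simp: G1_def)
        have 2: "\<bar>(\<Sum>l<n. ?Y (Ds l) (grid T k i)) / real n\<bar> \<le> \<epsilon>'" "\<bar>(\<Sum>l<n. ?Y (Ds l) (grid T k j)) / real n\<bar> \<le> 1"
          using G ij \<epsilon>'(2) by (force simp: G2_def)+
        have "\<bar>((\<Sum>l<n. ?Y (Ds l) (grid T k i)) / real n) * ((\<Sum>l<n. ?Y (Ds l) (grid T k j)) / real n)\<bar> \<le> \<epsilon>' * 1"
          unfolding abs_mult using 2 \<epsilon>'(1) by (intro mult_mono) auto
        then show ?thesis using 1 \<epsilon>'(3) unfolding bootstrap_cov[OF n, where P=P] by linarith
      qed
      then have gap: "K * cov_gap T k ?B ?Z P ?Y \<le> e"
        using K0 e by (intro cov_gap_le) (auto simp: \<epsilon>_def)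
      have 1: "sup_cdf ?B ?Z n r \<le> sup_cdf P ?Y n (r + 5 * \<eta>) + 4 * T\<^sup>2 / (real k * \<eta>\<^sup>2)
        + K * cov_gap T k ?B ?Z P ?Y
        + 2 * K * (2 * T) ^ 3 / sqrt (real n)"
        by (rule sup_cdf_transfer[OF B.path_law_axioms Y.path_law_axioms n k(1) \<eta>(1) K order_refl order_refl elim(5)])
      have 2: "sup_cdf P ?Y n (r - 5 * \<eta>) \<le> sup_cdf ?B ?Z n (r - 5 * \<eta> + 5 * \<eta>) + 4 * T\<^sup>2 / (real k * \<eta>\<^sup>2)
        + K * cov_gap T k P ?Y ?B ?Z
        + 2 * K * (2 * T) ^ 3 / sqrt (real n)"
        by (rule sup_cdf_transfer[OF Y.path_law_axioms B.path_law_axioms n k(1) \<eta>(1) K order_refl order_refl elim(5)])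
      have 3: "sup_cdf P ?Y n (r + 5 * \<eta>) \<le> sup_cdf P ?Y n (r + \<delta>)" "sup_cdf P ?Y n r \<le> sup_cdf P ?Y n (r - 5 * \<eta> + \<delta>)"
        using \<eta>(3) by (auto intro!: Y.sup_cdf_mono)
      have 4: "sup_cdf P ?Y n (r + \<delta>) - sup_cdf P ?Y n r \<le> e" "sup_cdf P ?Y n (r - 5 * \<eta> + \<delta>) - sup_cdf P ?Y n (r - 5 * \<eta>) \<le> e"
        using elim(1) by blast+
      have eq: "r - 5 * \<eta> + 5 * \<eta> = r" by simp
      show ?thesis
        using 1 2[unfolded eq cov_gap_commute[of T k P]] 3 4 k2 gap elim(2) by (intro conjI) linarith+
    qed
    have "\<bar>S.prob {Ds \<in> space (sample P n). ?\<theta> Ds \<le> ?q Ds} - (1 - \<alpha>)\<bar> \<le> 2 * (4 * e) + (1 - S.prob ?G)"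
    proof (rule S.quantile_coverage[OF m\<theta> mq mG])
      show "0 \<le> ?\<theta> Ds \<and> ?\<theta> Ds \<le> 2 * sqrt (real n) * T" if "Ds \<in> space (sample P n)" for Ds
        using sup_abs_nonneg_le[OF lp[OF that] T] by blast
      show "sup_cdf P ?Y n r = S.prob {Ds \<in> space (sample P n). ?\<theta> Ds \<le> r}" for r
        unfolding sup_cdf_def using lip_path_sup_le_iff[OF lp T] by (intro arg_cong[where f=S.prob]) auto
      show "1 - \<alpha> - 4 * e \<le> sup_cdf P ?Y n r" if "Ds \<in> ?G" "?q Ds < r" for Ds r
      proof -
        have "Ds i \<in> diagrams T" if "i < n" for i using \<open>Ds \<in> ?G\<close> that sp by (auto simp: G1_def space_PiM)
        from bootstrap_cdf_above_quantile[OF n T this \<alpha> that(2)] compare[OF that(1), of r] show ?thesis by linarith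
      qed
      show "sup_cdf P ?Y n r \<le> 1 - \<alpha> + 4 * e" if "Ds \<in> ?G" "r < ?q Ds" for Ds r
      proof -
        have "Ds i \<in> diagrams T" if "i < n" for i using \<open>Ds \<in> ?G\<close> that sp by (auto simp: G1_def space_PiM)
        from bootstrap_cdf_below_quantile[OF n T this \<alpha> that(2)] compare[OF that(1), of r] show ?thesis by linarith
      qed
      show "sup_cdf P ?Y n (r + \<delta>) - sup_cdf P ?Y n r \<le> 4 * e" for r
      proof -
        have "sup_cdf P ?Y n (r + \<delta>) - sup_cdf P ?Y n r \<le> e" using elim(1) by blast
        then show ?thesis using e by linarith
      qed
    qed (use \<delta> \<alpha> e in auto)
    also have "\<dots> \<le> 10 * e" using pG by linarith
    also have "\<dots> < e0" using e0 by (simp add: e_def)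
    finally show ?case .
  qed
  then show "\<exists>no. \<forall>n\<ge>no. norm (measure (sample P n) {Ds \<in> space (sample P n). (SUP t. \<bar>normalized_sum ?Y n Ds t\<bar>) \<le> bootstrap_quantile \<alpha> n Ds} - (1 - \<alpha>)) < e0"
    by (simp add: eventually_sequentially)
qed

theorem theorem2p5:
  fixes T \<alpha> :: real
    and P :: "diagram measure"
    and M :: "'w measure"
    and X :: "nat \<Rightarrow> 'w \<Rightarrow> diagram"
  assumes "0 < T" and "0 < \<alpha>" and "\<alpha> < 1"
    and "prob_space P" and "space P = diagrams T"
    and "\<And>t. (\<lambda>D. first_landscape D t) \<in> borel_measurable P"
    and "prob_space M"
    and "prob_space.indep_vars M (\<lambda>_. P) X UNIV"
    and "\<And>i. distr M P (X i) = P"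
  shows "\<exists>L. (\<lambda>n. measure M {\<omega> \<in> space M.
                \<forall>t. mean_landscape P t \<in> confidence_band \<alpha> n (\<lambda>i. X i \<omega>) t})
              \<longlonglongrightarrow> L \<and> L \<ge> 1 - \<alpha>"
proof -
  interpret M: prob_space M by fact
  let ?Y = "centered_landscape P"
  interpret Y: path_law P ?Y T 2 by (rule landscape_path_law[OF assms(1,4,5,6)])
  have rv: "X i \<in> M \<rightarrow>\<^sub>M P" for i using assms(8) by (auto simp: M.indep_vars_def)
  let ?\<theta> = "\<lambda>n Ds. SUP t. \<bar>normalized_sum ?Y n Ds t\<bar>"
  let ?H = "\<lambda>n. {Ds \<in> space (sample P n). ?\<theta> n Ds \<le> bootstrap_quantile \<alpha> n Ds}"
  let ?c = "\<lambda>n. measure M {\<omega> \<in> space M. \<forall>t. mean_landscape P t \<in> confidence_band \<alpha> n (\<lambda>i. X i \<omega>) t}"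
  have mH: "?H n \<in> sets (sample P n)" if n: "0 < n" for n
  proof -
    have [measurable]: "?\<theta> n \<in> borel_measurable (sample P n)"
      by (rule sup_abs_measurable[OF Y.normalized_sum_lip_path assms(1)]) (auto intro: Y.normalized_sum_measurable)
    have [measurable]: "bootstrap_quantile \<alpha> n \<in> borel_measurable (sample P n)"
      by (rule bootstrap_quantile_measurable[OF n assms(1-3,5,6)])
    show ?thesis by measurable
  qed
  have cov: "?c n = measure (sample P n) (?H n)" if n: "0 < n" for n
  proof -
    let ?X = "\<lambda>\<omega>. \<lambda>i\<in>{..<n}. X i \<omega>"
    have mX: "?X \<in> M \<rightarrow>\<^sub>M sample P n" using rv by (intro measurable_restrict) auto
    have "(\<forall>t. mean_landscape P t \<in> confidence_band \<alpha> n (\<lambda>i. X i \<omega>) t) \<longleftrightarrow> ?X \<omega> \<in> ?H n" if \<omega>: "\<omega> \<in> space M" for \<omega>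
    proof -
      have spX: "?X \<omega> \<in> space (sample P n)" using mX \<omega> by (rule measurable_space)
      have "normalized_sum ?Y n (?X \<omega>) = normalized_sum ?Y n (\<lambda>i. X i \<omega>)"
        by (simp add: normalized_sum_def fun_eq_iff)
      then show ?thesis
        using spX lip_path_sup_le_iff[OF Y.normalized_sum_lip_path[OF spX] assms(1), of "bootstrap_quantile \<alpha> n (?X \<omega>)"]
        by (simp add: mean_in_confidence_band_iff[OF n] bootstrap_quantile_restrict[OF n])
    qed
    then have "{\<omega> \<in> space M. \<forall>t. mean_landscape P t \<in> confidence_band \<alpha> n (\<lambda>i. X i \<omega>) t} = ?X -` ?H n \<inter> space M"
      by blast
    then have "?c n = measure M (?X -` ?H n \<inter> space M)" by simp
    also have "\<dots> = measure (distr M (sample P n) ?X) (?H n)"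
      by (rule measure_distr[OF mX mH[OF n], symmetric])
    also have "distr M (sample P n) ?X = sample P n"
      using assms(8,9) n by (rule M.distr_iid_sample)
    finally show ?thesis .
  qed
  show ?thesis
  proof (cases "\<exists>t. path_cov P ?Y t t \<noteq> 0")
    case True
    then obtain t where "path_cov P ?Y t t \<noteq> 0" by blast
    moreover have "0 \<le> path_cov P ?Y t t" unfolding path_cov_def by (intro integral_nonneg_AE) auto
    ultimately have var: "0 < path_cov P ?Y t t" by simp
    have "\<exists>\<delta>>0. eventually (\<lambda>n. \<forall>r. sup_cdf P ?Y n (r + \<delta>) - sup_cdf P ?Y n r \<le> e) sequentially" if e: "0 < e" for e
    proof -
      obtain \<rho> where "0 < \<rho>" "eventually (\<lambda>n. sup_cdf P ?Y n \<rho> \<le> e) sequentially"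
        using Y.clt_small_ball[OF assms(7-9) var e] by blast
      then show ?thesis using Y.asymptotic_equicontinuity[OF refl _ e] by blast
    qed
    then have "(\<lambda>n. measure (sample P n) (?H n)) \<longlonglongrightarrow> 1 - \<alpha>"
      by (rule coverage_limit_nondegenerate[OF assms(1-6)])
    moreover have "eventually (\<lambda>n. ?c n = measure (sample P n) (?H n)) sequentially"
      using eventually_gt_at_top[of 0] by eventually_elim (rule cov)
    ultimately have "?c \<longlonglongrightarrow> 1 - \<alpha>" by (simp add: tendsto_cong)
    then show ?thesis by (intro exI[of _ "1 - \<alpha>"]) simp
  next
    case False
    have "?c n = 1" if n: "0 < n" for n
    proof -
      interpret S: prob_space "sample P n" by (rule Y.prob_space_sample)
      have "1 = sup_cdf P ?Y n 0" using False Y.degenerate_sup_cdf by metis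
      also have "\<dots> \<le> measure (sample P n) (?H n)"
        unfolding sup_cdf_def
      proof (rule S.finite_measure_mono[OF _ mH[OF n]], rule subsetI)
        fix Ds assume Ds: "Ds \<in> {\<omega> \<in> space (sample P n). \<forall>t. \<bar>normalized_sum ?Y n \<omega> t\<bar> \<le> 0}"
        then have s: "Ds \<in> space (sample P n)" by simp
        have "?\<theta> n Ds \<le> 0"
          using lip_path_sup_le_iff[OF Y.normalized_sum_lip_path[OF s] assms(1)] Ds by blast
        moreover have "0 \<le> bootstrap_quantile \<alpha> n Ds"
          using s assms(5) by (intro bootstrap_quantile_nonneg[OF n assms(1) _ assms(2,3)]) (auto simp: space_PiM)
        ultimately show "Ds \<in> ?H n" using s by auto
      qed
      finally have "1 \<le> measure (sample P n) (?H n)" .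
      then show ?thesis using cov[OF n] S.prob_le_1[of "?H n"] by simp
    qed
    then have "?c n = 1" if "0 < n" for n using that .
    with eventually_gt_at_top[of 0] have "eventually (\<lambda>n. ?c n = 1) sequentially"
      by (rule eventually_mono)
    then have "?c \<longlonglongrightarrow> 1" by (rule tendsto_eventually)
    then show ?thesis using assms(2) by (intro exI[of _ 1]) simp
  qed
qed

end
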